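(* Let $(X,d,m)$ be a countably infinite homogeneous ultrametric measure space, $L$ a homogeneous hierarchical Laplacian on it with eigenvalues $\lambda_1>\lambda_2>\dots>0$, $a\in X$, and $\sigma\in\mathbb{R}\setminus\{0\}$. The operator $H=L-\sigma\delta_a$ has a pure point spectrum which consists of at most one negative eigenvalue and countably many positive eigenvalues with accumulation point $0$. The operator $H$ has precisely one negative eigenvalue $\lambda_-^\sigma$ if and only if $\sigma>0$ and one of the following two conditions holds: (i) the semigroup $(e^{-tL})_{t>0}$ is recurrent; (ii) the semigroup $(e^{-tL})_{t>0}$ is transient and $\mathcal{R}(0,a,a)>1/\sigma$. If this is the case, then $\mathrm{Spec}(H)$ consists of the numbers $$\lambda_-^\sigma<0<\dots<\lambda_{k+1}<\lambda_k^\sigma<\lambda_k<\dots<\lambda_2<\lambda_1^\sigma<\lambda_1.$$ Otherwise, for $\sigma>0$, $\mathrm{Spec}(H)$ consists of the numbers $$0<\dots<\lambda_{k+1}<\lambda_k^\sigma<\lambda_k<\dots<\lambda_2<\lambda_1^\sigma<\lambda_1.$$ If $\sigma<0$, then $\mathrm{Spec}(H)$ consists of the numbers $$0<\dots<\lambda_{k+1}<\lambda_k^\sigma<\lambda_k<\dots<\lambda_2<\lambda_1^\sigma<\lambda_1<\lambda_+^\sigma.$$ The numbers $\lambda_k$ are at the same time eigenvalues of $L$. All $\lambda_k$ (as eigenvalues of $H$) have infinite multiplicity and compactly supported eigenfunctions, namely the eigenfunctions of $L$ whose supports do not contain $a$. The eigenvalue $\lambda_k^\sigma$ (respectively $\lambda_-^\sigma$,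 $\lambda_+^\sigma$) is the unique solution of the equation $\mathcal{R}(\lambda,a,a)=1/\sigma$ in the interval $]\lambda_{k+1},\lambda_k[$ (respectively $]-\infty,0[$, $]\lambda_1,+\infty[$). Each $\lambda_k^\sigma$ (respectively $\lambda_-^\sigma$, $\lambda_+^\sigma$) has multiplicity one and non-compactly supported eigenfunction $\psi_k(x)=\mathcal{R}(\lambda_k^\sigma,x,a)$ (respectively $\psi_-(x)=\mathcal{R}(\lambda_-^\sigma,x,a)$, $\psi_+(x)=\mathcal{R}(\lambda_+^\sigma,x,a)$).
   Context: Countably infinite homogeneous ultrametric measure space: $X$ is a countably infinite set with an ultrametric $d$ ($d(x,y)\le\max\{d(x,z),d(z,y)\}$) whose balls $B_r(x)=\{y:d(x,y)\le r\}$ are all finite and whose isometry group acts transitively; $m$ is the counting measure, and $d$ is normalized so that $m(B)=\mathrm{diam}(B)$ for every non-singleton ball. $\mathcal{B}$ is the family of all balls of positive radius (singletons included), $\mathcal{B}(x)$ the family of those containing $x$. Homogeneous hierarchical Laplacian: let $C:\mathcal{B}\to(0,\infty)$ satisfy $C(A)=C(B)$ whenever $A,B$ have the same diameter, and $\lambda(B):=\sum_{T\in\mathcal{B},\,B\subseteq T}C(T)<\infty$ for all $B$. Then $$Lf(x)=\sum_{B\in\mathcal{B}(x)}C(B)\Big(f(x)-\frac1{m(B)}\int_B f\,dm\Big),$$ a bounded self-adjoint operator on $L^2(X,m)$. Let $\{a\}=B_0\subsetneq B_1\subsetneq B_2\subsetneq\cdots$ be all the balls containing $a$, and $\lambda_k=\lambda(B_k)$,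 $k\ge1$; by homogeneity these numbers do not depend on $a$, they strictly decrease to $0$, and $\mathrm{Spec}(L)=\{0\}\cup\{\lambda_k:k\ge1\}$, each $\lambda_k$ being an eigenvalue of infinite multiplicity. $\delta_a$ is the function equal to $1$ at $a$ and $0$ elsewhere, so $Hf=Lf-\sigma f(a)\delta_a$. For $\lambda\notin\mathrm{Spec}(L)$, $\mathcal{R}(\lambda,\cdot,y)\in L^2(X,m)$ is the solution $\psi$ of $L\psi-\lambda\psi=\delta_y$. The semigroup $(e^{-tL})_{t>0}$, with heat kernel $p(t,x,y)$ with respect to $m$, is transient if $\mathcal{R}(0,a,a):=\int_0^\infty p(t,a,a)\,dt<\infty$ and recurrent otherwise. In the lists, the point $0$ belongs to the spectrum as the accumulation point of the positive eigenvalues. Pure point spectrum means that $L^2(X,m)$ has an orthonormal basis of eigenfunctions. *)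

theory Defs
  imports
    "HOL-Analysis.Analysis"
    "HOL-Library.Function_Algebras"
    "HOL-Library.Extended_Nat"
begin

section \<open>The Hilbert space of square-summable functions\<close>

text \<open>
  Throughout, the measure m on the type \<^typ>\<open>'a\<close> is the counting measure. Thus the space of
  square-integrable functions with respect to m consists of the square-summable functions, the
  integral over a finite set is a finite sum, and m(B) is the cardinality of B. Operators are
  arbitrary maps on functions, used only on \<open>L2\<close>.
\<close>

definition L2 :: "('a \<Rightarrow> complex) set" where
  "L2 = {f. (\<lambda>x. (cmod (f x))\<^sup>2) summable_on UNIV}"

definition L2_inner :: "('a \<Rightarrow> complex) \<Rightarrow> ('a \<Rightarrow> complex) \<Rightarrow> complex" where
  "L2_inner f g = (\<Sum>\<^sub>\<infinity>x. f x * cnj (g x))"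

definition L2_norm :: "('a \<Rightarrow> complex) \<Rightarrow> real" where
  "L2_norm f = sqrt (\<Sum>\<^sub>\<infinity>x. (cmod (f x))\<^sup>2)"

definition fscale :: "complex \<Rightarrow> ('a \<Rightarrow> complex) \<Rightarrow> 'a \<Rightarrow> complex" where
  "fscale c f = (\<lambda>x. c * f x)"

global_interpretation fun_vs: vector_space "fscale :: complex \<Rightarrow> ('a \<Rightarrow> complex) \<Rightarrow> 'a \<Rightarrow> complex"
  by unfold_locales (auto simp: fscale_def fun_eq_iff algebra_simps)

text \<open>An orthonormal subset of V whose linear span is dense in V.\<close>

definition orthonormal_basis_of :: "('a \<Rightarrow> complex) set \<Rightarrow> ('a \<Rightarrow> complex) set \<Rightarrow> bool" where
  "orthonormal_basis_of E V \<longleftrightarrow>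
     E \<subseteq> V \<and>
     (\<forall>e\<in>E. \<forall>e'\<in>E. L2_inner e e' = (if e = e' then 1 else 0)) \<and>
     (\<forall>f\<in>V. \<forall>\<epsilon>>0. \<exists>g\<in>fun_vs.span E. L2_norm (f - g) < \<epsilon>)"

text \<open>The topological support.\<close>

definition supp :: "('a::metric_space \<Rightarrow> complex) \<Rightarrow> 'a set" where
  "supp f = closure {x. f x \<noteq> 0}"


section \<open>Spectral notions\<close>

text \<open>\<open>T - z\<close> is a bijection of \<open>L2\<close> onto itself with bounded inverse.\<close>

definition resolvent_set ::
  "(('a \<Rightarrow> complex) \<Rightarrow> 'a \<Rightarrow> complex) \<Rightarrow> complex set" where
  "resolvent_set T =
     {z. bij_betw (\<lambda>f. T f - fscale z f) L2 L2 \<and>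
         (\<exists>K. \<forall>f\<in>L2. L2_norm f \<le> K * L2_norm (T f - fscale z f))}"

definition spectrum ::
  "(('a \<Rightarrow> complex) \<Rightarrow> 'a \<Rightarrow> complex) \<Rightarrow> complex set" where
  "spectrum T = - resolvent_set T"

definition eigenspace ::
  "(('a \<Rightarrow> complex) \<Rightarrow> 'a \<Rightarrow> complex) \<Rightarrow> complex \<Rightarrow> ('a \<Rightarrow> complex) set" where
  "eigenspace T z = {f \<in> L2. T f = fscale z f}"

definition eigenfunction ::
  "(('a \<Rightarrow> complex) \<Rightarrow> 'a \<Rightarrow> complex) \<Rightarrow> complex \<Rightarrow> ('a \<Rightarrow> complex) \<Rightarrow> bool" where
  "eigenfunction T z f \<longleftrightarrow> f \<in> eigenspace T z \<and> f \<noteq> 0"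

definition eigenvalue ::
  "(('a \<Rightarrow> complex) \<Rightarrow> 'a \<Rightarrow> complex) \<Rightarrow> complex \<Rightarrow> bool" where
  "eigenvalue T z \<longleftrightarrow> (\<exists>f. eigenfunction T z f)"

text \<open>
  The dimension of the eigenspace. The case distinction is needed since \<open>dim\<close> is 0 on
  infinite-dimensional spaces.
\<close>

definition eig_mult ::
  "(('a \<Rightarrow> complex) \<Rightarrow> 'a \<Rightarrow> complex) \<Rightarrow> complex \<Rightarrow> enat" where
  "eig_mult T z =
     (if \<exists>F. finite F \<and> eigenspace T z \<subseteq> fun_vs.span F
      then enat (fun_vs.dim (eigenspace T z)) else \<infinity>)"

definition pure_point_spectrum ::
  "(('a \<Rightarrow> complex) \<Rightarrow> 'a \<Rightarrow> complex) \<Rightarrow> bool" where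
  "pure_point_spectrum T \<longleftrightarrow>
     (\<exists>E. orthonormal_basis_of E L2 \<and> (\<forall>e\<in>E. \<exists>z. eigenfunction T z e))"


section \<open>Homogeneous ultrametric measure spaces\<close>

definition balls :: "'a::metric_space set set" where
  "balls = {cball x r | x r. 0 < r}"

definition balls_at :: "'a::metric_space \<Rightarrow> 'a set set" where
  "balls_at x = {B \<in> balls. x \<in> B}"

text \<open>
  The normalization constrains only non-singleton balls: a singleton has measure 1 but diameter 0.
\<close>

definition homogeneous_ultrametric_measure_space :: "'a::metric_space itself \<Rightarrow> bool" where
  "homogeneous_ultrametric_measure_space TYPE('a) \<longleftrightarrow>
     countable (UNIV :: 'a set) \<and> infinite (UNIV :: 'a set) \<and>
     (\<forall>(x::'a) y z. dist x y \<le> max (dist x z) (dist z y)) \<and>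
     (\<forall>(x :: 'a) r. finite (cball x r)) \<and>
     (\<forall>(x::'a) (y::'a). \<exists>\<phi>. bij \<phi> \<and> (\<forall>u v. dist (\<phi> u) (\<phi> v) = dist u v) \<and> \<phi> x = y) \<and>
     (\<forall>B \<in> (balls :: 'a set set). \<not> is_singleton B \<longrightarrow> real (card B) = diameter B)"

text \<open>
  The increasing enumeration, starting with \<open>{a}\<close>, of all balls containing \<open>a\<close>; in a homogeneous
  ultrametric measure space it exists and is unique.
\<close>

definition ball_chain :: "'a::metric_space \<Rightarrow> nat \<Rightarrow> 'a set" where
  "ball_chain a =
     (THE B. B 0 = {a} \<and> (\<forall>k. B k \<subset> B (Suc k)) \<and> range B = balls_at a)"


section \<open>Hierarchical Laplacian, heat kernel and resolvent kernel\<close>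

definition lam :: "('a::metric_space set \<Rightarrow> real) \<Rightarrow> 'a set \<Rightarrow> real" where
  "lam C B = (\<Sum>\<^sub>\<infinity>T\<in>{T \<in> balls. B \<subseteq> T}. C T)"

definition homogeneous_choice_function :: "('a::metric_space set \<Rightarrow> real) \<Rightarrow> bool" where
  "homogeneous_choice_function C \<longleftrightarrow>
     (\<forall>B\<in>balls. 0 < C B) \<and>
     (\<forall>A\<in>balls. \<forall>B\<in>balls. diameter A = diameter B \<longrightarrow> C A = C B) \<and>
     (\<forall>B\<in>balls. C summable_on {T \<in> balls. B \<subseteq> T})"

definition Laplacian ::
  "('a::metric_space set \<Rightarrow> real) \<Rightarrow> ('a \<Rightarrow> complex) \<Rightarrow> 'a \<Rightarrow> complex" where
  "Laplacian C f x =
     (\<Sum>\<^sub>\<infinity>B\<in>balls_at x. of_real (C B) * (f x - (\<Sum>y\<in>B. f y) / of_nat (card B)))"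

text \<open>The eigenvalue \<open>\<lambda>\<^sub>k\<close> of the Laplacian; meaningful for \<open>k \<ge> 1\<close>.\<close>

definition lam_seq :: "('a::metric_space set \<Rightarrow> real) \<Rightarrow> 'a \<Rightarrow> nat \<Rightarrow> real" where
  "lam_seq C a k = lam C (ball_chain a k)"

definition delta :: "'a \<Rightarrow> 'a \<Rightarrow> complex" where
  "delta a = (\<lambda>x. if x = a then 1 else 0)"

definition Schroedinger ::
  "('a::metric_space set \<Rightarrow> real) \<Rightarrow> real \<Rightarrow> 'a \<Rightarrow> ('a \<Rightarrow> complex) \<Rightarrow> 'a \<Rightarrow> complex" where
  "Schroedinger C \<sigma> a f = (\<lambda>x. Laplacian C f x - of_real \<sigma> * f a * delta a x)"

text \<open>The resolvent kernel; meaningful for \<open>z\<close> outside the spectrum of the Laplacian.\<close>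

definition resolvent_kernel ::
  "('a::metric_space set \<Rightarrow> real) \<Rightarrow> complex \<Rightarrow> 'a \<Rightarrow> 'a \<Rightarrow> complex" where
  "resolvent_kernel C z x y =
     (THE \<psi>. \<psi> \<in> L2 \<and> Laplacian C \<psi> - fscale z \<psi> = delta y) x"

text \<open>
  The Laplacian is bounded, so \<open>e\<^sup>-\<^sup>t\<^sup>L\<close> is given by the exponential series. With respect to the
  counting measure its kernel at \<open>(x, y)\<close> is the value at \<open>x\<close> of the image of \<open>\<delta>\<^sub>y\<close>.
\<close>

definition heat_semigroup ::
  "('a::metric_space set \<Rightarrow> real) \<Rightarrow> real \<Rightarrow> ('a \<Rightarrow> complex) \<Rightarrow> 'a \<Rightarrow> complex" where
  "heat_semigroup C t f x = (\<Sum>n. of_real ((- t) ^ n / fact n) * (Laplacian C ^^ n) f x)"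

definition heat_kernel ::
  "('a::metric_space set \<Rightarrow> real) \<Rightarrow> real \<Rightarrow> 'a \<Rightarrow> 'a \<Rightarrow> complex" where
  "heat_kernel C t x y = heat_semigroup C t (delta y) x"

text \<open>
  \<open>\<R>(0,a,a)\<close>, possibly infinite. The heat kernel is real and nonnegative on the diagonal, so
  neither \<open>Re\<close> nor \<open>ennreal\<close> loses anything.
\<close>

definition green0 :: "('a::metric_space set \<Rightarrow> real) \<Rightarrow> 'a \<Rightarrow> ennreal" where
  "green0 C a = (\<integral>\<^sup>+t\<in>{0<..}. ennreal (Re (heat_kernel C t a a)) \<partial>lborel)"

definition transient :: "('a::metric_space set \<Rightarrow> real) \<Rightarrow> 'a \<Rightarrow> bool" where
  "transient C a \<longleftrightarrow> green0 C a < \<infinity>"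

definition recurrent :: "('a::metric_space set \<Rightarrow> real) \<Rightarrow> 'a \<Rightarrow> bool" where
  "recurrent C a \<longleftrightarrow> \<not> transient C a"

text \<open>
  \<open>\<mu>\<close> is the unique solution in the interval \<open>I\<close> of \<open>\<R>(\<mu>,a,a) = 1/\<sigma>\<close>, and it is an eigenvalue of
  \<open>L - \<sigma> \<delta>\<^sub>a\<close> of multiplicity one with the non-compactly supported eigenfunction \<open>\<R>(\<mu>,\<cdot>,a)\<close>.
\<close>

definition perturbed_eigenvalue ::
  "('a::metric_space set \<Rightarrow> real) \<Rightarrow> real \<Rightarrow> 'a \<Rightarrow> real set \<Rightarrow> real \<Rightarrow> bool" where
  "perturbed_eigenvalue C \<sigma> a I \<mu> \<longleftrightarrow>
     \<mu> \<in> I \<and>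
     (\<forall>\<nu>\<in>I. resolvent_kernel C (of_real \<nu>) a a = of_real (1 / \<sigma>) \<longleftrightarrow> \<nu> = \<mu>) \<and>
     eig_mult (Schroedinger C \<sigma> a) (of_real \<mu>) = 1 \<and>
     eigenfunction (Schroedinger C \<sigma> a) (of_real \<mu>) (\<lambda>x. resolvent_kernel C (of_real \<mu>) x a) \<and>
     \<not> compact (supp (\<lambda>x. resolvent_kernel C (of_real \<mu>) x a))"

end

theory Submission
  imports Defs
begin

text \<open>
  The balls of one level partition the space into classes of equal size. Let \<open>P k\<close> be the averaging
  over the balls of level \<open>k\<close> and \<open>Q j = P j - P (j + 1)\<close>. The \<open>P k\<close> are decreasing orthogonal
  projections with \<open>P 0 = 1\<close>, and \<open>P k f\<close> tends to 0 pointwise because the balls grow; so a function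
  in \<open>L2\<close> is determined by its components \<open>Q j f\<close> (lemma \<open>Q_eqI\<close>). The Laplacian acts on the
  component \<open>Q j f\<close> as the scalar \<open>ev j\<close>, which is the eigenvalue \<open>lam_seq C a (j + 1)\<close>. More
  generally every sequence \<open>m\<close> of bounded variation defines a bounded operator \<open>multiplier m\<close> acting
  on the \<open>j\<close>-th component as \<open>m j\<close>; summation by parts writes it as an absolutely convergent series
  of the \<open>P k\<close>. The sequence \<open>1 / (ev j - z)\<close> gives the resolvent \<open>R z\<close> of \<open>L\<close>. Its diagonal value
  is \<open>R z (delta a) a = \<Sum>j. weight j / (ev j - z)\<close> with positive weights of sum 1.

  For \<open>z\<close> outside the spectrum of \<open>L\<close>, the equation \<open>H f - z f = h\<close> is equivalent to
  \<open>f = R z h + \<sigma> f(a) R z (delta a)\<close>. Evaluation at \<open>a\<close> shows that \<open>z\<close> is in the resolvent set unless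
  \<open>\<sigma> R z (delta a) a = 1\<close>, and that otherwise \<open>z\<close> is an eigenvalue with the eigenspace spanned by
  \<open>R z (delta a)\<close>. As \<open>H\<close> is symmetric, such \<open>z\<close> are real. On the real line the diagonal value of the
  resolvent, called \<open>green\<close>, increases strictly on each of the intervals that the points \<open>ev k\<close> and 0
  cut out; on each gap it runs through all real values, above \<open>ev 0\<close> it runs through
  the negative ones, and on the negative half-line through the values between 0 and
  \<open>\<Sum>j. weight j / ev j\<close>. The last sum is the integral of the heat kernel
  \<open>\<Sum>j. weight j * exp (- t * ev j)\<close>, which gives the criterion for a negative eigenvalue. At
  \<open>z = ev k\<close> the \<open>k\<close>-th component of the eigenvalue equation, evaluated at \<open>a\<close>, forces \<open>f(a) = 0\<close>, so
  the eigenfunctions are those of \<open>L\<close> that vanish at \<open>a\<close>.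

  It remains to see that the eigenfunctions span \<open>L2\<close>. Let \<open>g\<close> be orthogonal to all
  eigenfunctions with eigenvalue different from 0. Every component of \<open>g\<close> is then a multiple of that of
  \<open>delta a\<close>. A Courant--Fischer argument compares the number of eigenvalues of \<open>H\<close> above \<open>ev K\<close> with the
  number of linear conditions on \<open>h\<close> under which \<open>\<langle>H h, h\<rangle> \<le> ev K \<parallel>h\<parallel>\<^sup>2\<close>; it yields
  \<open>\<langle>H g, g\<rangle> \<le> ev K \<parallel>g\<parallel>\<^sup>2\<close> for all \<open>K\<close>, hence \<open>\<langle>H g, g\<rangle> \<le> 0\<close>. In the same way \<open>\<langle>H g, g\<rangle> \<ge> 0\<close>: the
  negative part of \<open>H\<close> has rank at most one and is accounted for by the negative eigenvalue. So the
  form of \<open>H\<close> vanishes on the invariant subspace of these \<open>g\<close>, where \<open>H\<close> is therefore 0, and its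
  elements are eigenfunctions with eigenvalue 0 (lemmas \<open>minimax_upper_bound\<close>, \<open>residual_form_le\<close>,
  \<open>residual_form_nonneg\<close>, \<open>residual_kernel\<close>).
\<close>

section \<open>Square-summable functions\<close>

lemma sum_fun_apply: "sum f I x = (\<Sum>i\<in>I. f i x)"
  by (induction I rule: infinite_finite_induct) auto

lemma L2_bounded:
  assumes "0 \<le> M" and "\<And>F. finite F \<Longrightarrow> (\<Sum>x\<in>F. (cmod (f x))\<^sup>2) \<le> M\<^sup>2"
  shows "f \<in> L2" and "L2_norm f \<le> M"
proof -
  have s: "(\<lambda>x. (cmod (f x))\<^sup>2) summable_on UNIV"
    by (rule nonneg_bounded_partial_sums_imp_summable_on[where C = "M\<^sup>2"])
       (auto simp: assms eventually_finite_subsets_at_top intro!: exI[of _ "{}"])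
  then show "f \<in> L2" by (simp add: L2_def)
  have "(\<Sum>\<^sub>\<infinity>x. (cmod (f x))\<^sup>2) \<le> M\<^sup>2"
    by (rule infsum_le_finite_sums[OF s]) (auto simp: assms)
  then show "L2_norm f \<le> M"
    using assms(1) by (simp add: L2_norm_def real_le_lsqrt)
qed

lemma L2_norm_nonneg: "0 \<le> L2_norm f"
  by (simp add: L2_norm_def infsum_nonneg)

lemma L2_norm_sq: "(L2_norm f)\<^sup>2 = (\<Sum>\<^sub>\<infinity>x. (cmod (f x))\<^sup>2)"
  by (simp add: L2_norm_def infsum_nonneg)

lemma sum_le_L2_norm:
  assumes "f \<in> L2" "finite F"
  shows "(\<Sum>x\<in>F. (cmod (f x))\<^sup>2) \<le> (L2_norm f)\<^sup>2"
  unfolding L2_norm_sq using assms by (intro finite_sum_le_infsum) (auto simp: L2_def)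

lemma L2_set_le_L2_norm:
  assumes "f \<in> L2" "finite F"
  shows "L2_set (\<lambda>x. cmod (f x)) F \<le> L2_norm f"
  using sum_le_L2_norm[OF assms] by (simp add: L2_set_def L2_norm_nonneg real_le_lsqrt)

lemma cmod_le_L2_norm: "f \<in> L2 \<Longrightarrow> cmod (f x) \<le> L2_norm f"
  using L2_set_le_L2_norm[of f "{x}"] by (simp add: L2_set_def)

lemma L2_norm_0 [simp]: "L2_norm 0 = 0"
  by (simp add: L2_norm_def)

lemma L2_norm_eq_0_iff: "f \<in> L2 \<Longrightarrow> L2_norm f = 0 \<longleftrightarrow> f = 0"
  using cmod_le_L2_norm[of f] by (metis L2_norm_0 ext norm_le_zero_iff zero_fun_apply)

lemma L2_norm_pos: "f \<in> L2 \<Longrightarrow> f \<noteq> 0 \<Longrightarrow> 0 < L2_norm f"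
  using L2_norm_eq_0_iff[of f] L2_norm_nonneg[of f] by linarith

lemma
  assumes f: "f \<in> L2" and g: "g \<in> L2"
  shows L2_add: "f + g \<in> L2" and L2_norm_triangle: "L2_norm (f + g) \<le> L2_norm f + L2_norm g"
proof -
  have *: "(\<Sum>x\<in>F. (cmod ((f + g) x))\<^sup>2) \<le> (L2_norm f + L2_norm g)\<^sup>2" if "finite F" for F
  proof -
    have "L2_set (\<lambda>x. cmod ((f + g) x)) F \<le> L2_set (\<lambda>x. cmod (f x) + cmod (g x)) F"
      by (rule L2_set_mono) (auto simp: norm_triangle_ineq)
    also have "\<dots> \<le> L2_set (\<lambda>x. cmod (f x)) F + L2_set (\<lambda>x. cmod (g x)) F"
      by (rule L2_set_triangle_ineq)
    also have "\<dots> \<le> L2_norm f + L2_norm g"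
      using L2_set_le_L2_norm[OF f that] L2_set_le_L2_norm[OF g that] by linarith
    finally show ?thesis
      by (simp add: L2_set_def real_sqrt_le_iff sqrt_le_D)
  qed
  show "f + g \<in> L2" "L2_norm (f + g) \<le> L2_norm f + L2_norm g"
    by (rule L2_bounded[OF _ *]; simp add: L2_norm_nonneg)+
qed

lemma
  assumes "f \<in> L2"
  shows L2_fscale: "fscale c f \<in> L2" and L2_norm_fscale: "L2_norm (fscale c f) = cmod c * L2_norm f"
proof -
  show "fscale c f \<in> L2"
    using assms by (auto simp: L2_def fscale_def norm_mult power_mult_distrib intro!: summable_on_cmult_right)
  show "L2_norm (fscale c f) = cmod c * L2_norm f"
    by (simp add: L2_norm_def fscale_def norm_mult power_mult_distrib infsum_cmult_right' real_sqrt_mult)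
qed

lemma L2_0 [simp]: "0 \<in> L2"
  by (simp add: L2_def)

lemma L2_subspace: "fun_vs.subspace L2"
  by (auto simp: fun_vs.subspace_def L2_add L2_fscale)

lemma L2_diff: "f \<in> L2 \<Longrightarrow> g \<in> L2 \<Longrightarrow> f - g \<in> L2"
  using fun_vs.subspace_diff[OF L2_subspace] .

lemma L2_sum: "(\<And>i. i \<in> I \<Longrightarrow> f i \<in> L2) \<Longrightarrow> sum f I \<in> L2"
  using fun_vs.subspace_sum[OF L2_subspace] .

lemma L2_norm_sum:
  assumes "\<And>i. i \<in> I \<Longrightarrow> f i \<in> L2"
  shows "L2_norm (sum f I) \<le> (\<Sum>i\<in>I. L2_norm (f i))"
  using assms
proof (induction I rule: infinite_finite_induct)
  case (insert i I)
  then have "L2_norm (f i + sum f I) \<le> L2_norm (f i) + L2_norm (sum f I)"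
    by (intro L2_norm_triangle L2_sum) auto
  moreover have "L2_norm (sum f I) \<le> (\<Sum>i\<in>I. L2_norm (f i))"
    using insert by auto
  ultimately show ?case unfolding sum.insert[OF insert(1,2)] by linarith
qed auto

text \<open>The form that Fatou's lemma takes for the counting measure.\<close>

lemma L2_pointwise_limit:
  assumes "\<And>n. u n \<in> L2" "\<And>n. L2_norm (u n) \<le> M" "\<And>x. (\<lambda>n. u n x) \<longlonglongrightarrow> v x"
  shows "v \<in> L2" and "L2_norm v \<le> M"
proof -
  have M: "0 \<le> M" using L2_norm_nonneg[of "u 0"] assms(2)[of 0] by linarith
  have *: "(\<Sum>x\<in>F. (cmod (v x))\<^sup>2) \<le> M\<^sup>2" if "finite F" for F
  proof (rule tendsto_upperbound)
    show "(\<lambda>n. \<Sum>x\<in>F. (cmod (u n x))\<^sup>2) \<longlonglongrightarrow> (\<Sum>x\<in>F. (cmod (v x))\<^sup>2)"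
      by (intro tendsto_intros assms)
    show "\<forall>\<^sub>F n in sequentially. (\<Sum>x\<in>F. (cmod (u n x))\<^sup>2) \<le> M\<^sup>2"
      using sum_le_L2_norm[OF assms(1) that] power_mono[OF assms(2) L2_norm_nonneg, of _ 2]
      by (intro always_eventually allI) (meson order_trans)
  qed simp
  show "v \<in> L2" "L2_norm v \<le> M"
    by (rule L2_bounded[OF M *]; simp)+
qed

lemma sum_cmod_mult_le:
  assumes f: "f \<in> L2" and g: "g \<in> L2" and F: "finite F"
  shows "(\<Sum>x\<in>F. cmod (f x * cnj (g x))) \<le> L2_norm f * L2_norm g"
proof -
  have "(\<Sum>x\<in>F. cmod (f x * cnj (g x))) = (\<Sum>x\<in>F. \<bar>cmod (f x)\<bar> * \<bar>cmod (g x)\<bar>)"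
    by (simp add: norm_mult)
  also have "\<dots> \<le> L2_set (\<lambda>x. cmod (f x)) F * L2_set (\<lambda>x. cmod (g x)) F"
    by (rule L2_set_mult_ineq)
  also have "\<dots> \<le> L2_norm f * L2_norm g"
    by (intro mult_mono L2_set_le_L2_norm f g F L2_norm_nonneg) (simp_all add: L2_set_nonneg)
  finally show ?thesis .
qed

lemma L2_inner_abs_summable:
  assumes f: "f \<in> L2" and g: "g \<in> L2"
  shows "(\<lambda>x. norm (f x * cnj (g x))) summable_on UNIV"
  by (rule nonneg_bounded_partial_sums_imp_summable_on[where C = "L2_norm f * L2_norm g"])
     (auto simp: eventually_finite_subsets_at_top sum_cmod_mult_le[OF f g] intro!: exI[of _ "{}"])

lemma L2_inner_summable:
  "f \<in> L2 \<Longrightarrow> g \<in> L2 \<Longrightarrow> (\<lambda>x. f x * cnj (g x)) summable_on UNIV"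
  using abs_summable_summable[OF L2_inner_abs_summable] .

lemma L2_inner_add_left:
  assumes "f \<in> L2" "g \<in> L2" "h \<in> L2"
  shows "L2_inner (f + g) h = L2_inner f h + L2_inner g h"
  unfolding L2_inner_def
  by (simp add: distrib_right infsum_add[symmetric] L2_inner_summable assms)

lemma L2_inner_fscale_left: "L2_inner (fscale c f) g = c * L2_inner f g"
  unfolding L2_inner_def fscale_def by (simp add: mult.assoc infsum_cmult_right')

lemma L2_inner_commute: "L2_inner f g = cnj (L2_inner g f)"
  unfolding L2_inner_def by (simp add: infsum_cnj[symmetric] mult.commute)

lemma L2_inner_fscale_right: "L2_inner f (fscale c g) = cnj c * L2_inner f g"
  using L2_inner_fscale_left[of c g f] by (metis L2_inner_commute complex_cnj_mult)

lemma L2_inner_add_right: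
  assumes "f \<in> L2" "g \<in> L2" "h \<in> L2"
  shows "L2_inner f (g + h) = L2_inner f g + L2_inner f h"
  using L2_inner_add_left[of g h f] assms by (metis L2_inner_commute complex_cnj_add)

lemma L2_inner_minus_left: "L2_inner (- f) g = - L2_inner f g"
  unfolding L2_inner_def by (simp add: infsum_uminus)

lemma L2_minus: "f \<in> L2 \<Longrightarrow> - f \<in> L2"
  by (simp add: L2_def)

lemma L2_inner_diff_left:
  assumes "f \<in> L2" "g \<in> L2" "h \<in> L2"
  shows "L2_inner (f - g) h = L2_inner f h - L2_inner g h"
  using L2_inner_add_left[of f "- g" h] assms by (simp add: L2_minus L2_inner_minus_left)

lemma L2_inner_diff_right:
  assumes "f \<in> L2" "g \<in> L2" "h \<in> L2"
  shows "L2_inner f (g - h) = L2_inner f g - L2_inner f h"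
  using L2_inner_diff_left[of g h f] assms by (metis L2_inner_commute complex_cnj_diff)

lemma L2_inner_0_left [simp]: "L2_inner 0 f = 0"
  by (simp add: L2_inner_def)

lemma L2_inner_0_right [simp]: "L2_inner f 0 = 0"
  by (simp add: L2_inner_def)

lemma L2_inner_sum_left:
  assumes "\<And>i. i \<in> I \<Longrightarrow> f i \<in> L2" "g \<in> L2"
  shows "L2_inner (sum f I) g = (\<Sum>i\<in>I. L2_inner (f i) g)"
  using assms
  by (induction I rule: infinite_finite_induct) (simp_all add: L2_inner_add_left L2_sum)

lemma infsum_of_real_complex: "(\<Sum>\<^sub>\<infinity>x\<in>A. complex_of_real (f x)) = of_real (infsum f A)"
proof (cases "f summable_on A")
  case True
  then show ?thesis by (simp add: has_sum_of_real infsumI)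
next
  case False
  moreover from this have "\<not> (\<lambda>x. complex_of_real (f x)) summable_on A"
    using summable_on_Re[of "\<lambda>x. complex_of_real (f x)" A] by auto
  ultimately show ?thesis by (simp add: infsum_not_exists)
qed

lemma L2_inner_self: "L2_inner f f = of_real ((L2_norm f)\<^sup>2)"
proof -
  have "(\<lambda>x. f x * cnj (f x)) = (\<lambda>x. of_real ((cmod (f x))\<^sup>2))"
    by (simp only: complex_norm_square)
  then show ?thesis
    unfolding L2_inner_def L2_norm_sq by (simp only: infsum_of_real_complex)
qed

lemma cmod_L2_inner_le:
  assumes f: "f \<in> L2" and g: "g \<in> L2"
  shows "cmod (L2_inner f g) \<le> L2_norm f * L2_norm g"
proof -
  have "(\<Sum>\<^sub>\<infinity>x. cmod (f x * cnj (g x))) \<le> L2_norm f * L2_norm g"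
    by (intro infsum_le_finite_sums L2_inner_abs_summable sum_cmod_mult_le f g) auto
  with norm_infsum_bound[OF L2_inner_abs_summable[OF f g]] show ?thesis
    by (simp add: L2_inner_def)
qed

lemma L2_norm_sq_add:
  assumes "f \<in> L2" "g \<in> L2"
  shows "(L2_norm (f + g))\<^sup>2 = (L2_norm f)\<^sup>2 + 2 * Re (L2_inner f g) + (L2_norm g)\<^sup>2"
proof -
  have "of_real ((L2_norm (f + g))\<^sup>2)
      = L2_inner f f + (L2_inner f g + cnj (L2_inner f g)) + L2_inner g g"
    unfolding L2_inner_self[symmetric]
    by (simp add: L2_inner_add_left L2_inner_add_right assms L2_add L2_inner_commute[of g f]
        del: complex_add_cnj)
  then have "of_real ((L2_norm (f + g))\<^sup>2)
      = complex_of_real ((L2_norm f)\<^sup>2 + 2 * Re (L2_inner f g) + (L2_norm g)\<^sup>2)"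
    by (simp add: L2_inner_self complex_add_cnj)
  then show ?thesis by (simp only: of_real_eq_iff)
qed

lemma delta_in_L2 [simp]: "delta a \<in> L2"
  unfolding L2_def mem_Collect_eq
  by (rule finite_nonzero_values_imp_summable_on, rule finite_subset[of _ "{a}"])
     (auto simp: delta_def)

lemma L2_inner_delta: "L2_inner f (delta a) = f a"
proof -
  have "L2_inner f (delta a) = (\<Sum>\<^sub>\<infinity>x\<in>{a}. f x * cnj (delta a x))"
    unfolding L2_inner_def by (rule infsum_cong_neutral) (auto simp: delta_def)
  then show ?thesis by (simp add: delta_def)
qed

lemma L2_inner_tendsto:
  assumes "\<And>n. u n \<in> L2" "v \<in> L2" "g \<in> L2" "(\<lambda>n. L2_norm (v - u n)) \<longlonglongrightarrow> 0"
  shows "(\<lambda>n. L2_inner (u n) g) \<longlonglongrightarrow> L2_inner v g"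
proof -
  have "(\<lambda>n. L2_norm (v - u n) * L2_norm g) \<longlonglongrightarrow> 0"
    using tendsto_mult_right[OF assms(4), of "L2_norm g"] by simp
  then have "(\<lambda>n. L2_inner v g - L2_inner (u n) g) \<longlonglongrightarrow> 0"
    by (rule Lim_null_comparison[rotated])
       (auto simp: L2_inner_diff_left[symmetric] assms intro!: always_eventually cmod_L2_inner_le L2_diff)
  from tendsto_diff[OF tendsto_const[of "L2_inner v g"] this] show ?thesis by simp
qed

text \<open>Absolutely convergent combinations of a norm-bounded sequence. The tails are again of this form, so
  that they tend to 0 in norm; this is what permits taking inner products term by term.\<close>

lemma
  fixes u :: "nat \<Rightarrow> 'a \<Rightarrow> complex"
  assumes u: "\<And>k. u k \<in> L2" "\<And>k. L2_norm (u k) \<le> M" and p: "summable (\<lambda>k. cmod (p k))"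
  defines "s \<equiv> \<lambda>x. \<Sum>k. p k * u k x"
  shows L2_series: "s \<in> L2"
    and L2_norm_series_le: "L2_norm s \<le> (\<Sum>k. cmod (p k)) * M"
    and L2_series_summable: "summable (\<lambda>k. p k * u k x)"
    and L2_inner_series: "g \<in> L2 \<Longrightarrow> (\<lambda>k. p k * L2_inner (u k) g) sums L2_inner s g"
proof -
  have M: "0 \<le> M" using L2_norm_nonneg[of "u 0"] u(2)[of 0] by linarith
  have summ: "summable (\<lambda>k. p k * u k x)" for x
  proof (rule summable_comparison_test')
    show "summable (\<lambda>k. cmod (p k) * M)" using p by (rule summable_mult2)
    show "cmod (p k * u k x) \<le> cmod (p k) * M" for k
      using cmod_le_L2_norm[OF u(1)[of k], of x] u(2)[of k] by (simp add: norm_mult mult_left_mono)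
  qed
  then show "summable (\<lambda>k. p k * u k x)" .
  define S where "S N n = (\<Sum>k<n. fscale (p (k + N)) (u (k + N)))" for N n
  have S: "S N n \<in> L2" for N n unfolding S_def by (intro L2_sum L2_fscale u)
  have pN: "summable (\<lambda>k. cmod (p (k + N)))" for N using p by (rule summable_ignore_initial_segment)
  have S_le: "L2_norm (S N n) \<le> (\<Sum>k. cmod (p (k + N))) * M" for N n
  proof -
    have "L2_norm (S N n) \<le> (\<Sum>k<n. cmod (p (k + N)) * L2_norm (u (k + N)))"
      unfolding S_def by (rule order_trans[OF L2_norm_sum]) (auto simp: L2_fscale L2_norm_fscale u)
    also have "\<dots> \<le> (\<Sum>k<n. cmod (p (k + N)) * M)"
      by (intro sum_mono mult_left_mono u) auto
    also have "\<dots> \<le> (\<Sum>k. cmod (p (k + N))) * M"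
      unfolding sum_distrib_right[symmetric]
      by (intro mult_right_mono M sum_le_suminf pN) auto
    finally show ?thesis .
  qed
  define s' where "s' N x = (\<Sum>k. p (k + N) * u (k + N) x)" for N x
  have Sx: "(\<lambda>n. S N n x) \<longlonglongrightarrow> s' N x" for N x
  proof -
    have "summable (\<lambda>k. p (k + N) * u (k + N) x)"
      using summ[of x] by (rule summable_ignore_initial_segment)
    then show ?thesis
      by (simp add: S_def s'_def fscale_def sum_fun_apply summable_LIMSEQ)
  qed
  have s': "s' N \<in> L2" "L2_norm (s' N) \<le> (\<Sum>k. cmod (p (k + N))) * M" for N
    using L2_pointwise_limit[OF S S_le Sx] by auto
  have ss': "s = s' 0" by (simp add: s_def s'_def fun_eq_iff)
  then show sL: "s \<in> L2" and "L2_norm s \<le> (\<Sum>k. cmod (p k)) * M"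
    using s'[of 0] by auto
  assume g: "g \<in> L2"
  have tail: "s - S 0 N = s' N" for N
    using suminf_split_initial_segment[OF summ, of _ N]
    by (auto simp: fun_eq_iff s_def s'_def S_def fscale_def sum_fun_apply)
  have "(\<lambda>N. (\<Sum>k. cmod (p (k + N))) * M) \<longlonglongrightarrow> 0"
    using tendsto_mult_right[OF suminf_exist_split2[OF p], of M] by simp
  then have "(\<lambda>N. L2_norm (s - S 0 N)) \<longlonglongrightarrow> 0"
    by (rule Lim_null_comparison[rotated]) (auto simp: tail s' L2_norm_nonneg)
  from L2_inner_tendsto[OF S sL g this] show "(\<lambda>k. p k * L2_inner (u k) g) sums L2_inner s g"
    by (simp add: sums_def S_def L2_inner_sum_left L2_fscale u g L2_inner_fscale_left)
qed

section \<open>Orthonormal bases of eigenvectors\<close>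

lemma L2_inner_span_eq_0:
  assumes "S \<subseteq> L2" "g \<in> L2" "\<And>v. v \<in> S \<Longrightarrow> L2_inner g v = 0" "f \<in> fun_vs.span S"
  shows "L2_inner g f = 0"
proof -
  have "fun_vs.subspace {f \<in> L2. L2_inner g f = 0}"
    using assms(2) by (auto simp: fun_vs.subspace_def L2_add L2_fscale L2_inner_add_right L2_inner_fscale_right)
  then have "fun_vs.span S \<subseteq> {f \<in> L2. L2_inner g f = 0}"
    using assms by (intro fun_vs.span_minimal) auto
  then show ?thesis using assms(4) by blast
qed

text \<open>One step of the Gram--Schmidt process. The vector v has a nonzero component only along those e that
  lie in the same member of the family as v, so what the step adds stays in that member.\<close>

lemma orthonormal_step:
  assumes sub: "\<And>U. U \<in> \<U> \<Longrightarrow> fun_vs.subspace U \<and> U \<subseteq> L2"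
    and orth: "pairwise (\<lambda>U U'. \<forall>u\<in>U. \<forall>u'\<in>U'. L2_inner u u' = 0) \<U>"
    and E: "finite E" "E \<subseteq> \<Union>\<U>" "\<And>e e'. e \<in> E \<Longrightarrow> e' \<in> E \<Longrightarrow> L2_inner e e' = (if e = e' then 1 else 0)"
    and v: "v \<in> U" "U \<in> \<U>"
  shows "\<exists>E'. finite E' \<and> E \<subseteq> E' \<and> E' \<subseteq> \<Union>\<U> \<and> v \<in> fun_vs.span E' \<and>
     (\<forall>e\<in>E'. \<forall>e'\<in>E'. L2_inner e e' = (if e = e' then 1 else 0))"
proof -
  have EL: "e \<in> L2" if "e \<in> E" for e using that E(2) sub by blast
  define p where "p = (\<Sum>e\<in>E. fscale (L2_inner v e) e)"
  have vL: "v \<in> L2" using v sub by blast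
  have pL: "p \<in> L2" unfolding p_def by (intro L2_sum L2_fscale EL)
  have "fscale (L2_inner v e) e \<in> U" if e: "e \<in> E" for e
  proof (cases "L2_inner v e = 0")
    case True
    then show ?thesis
      using fun_vs.subspace_0[of U] sub[OF v(2)] by (simp only: fun_vs.scale_zero_left)
  next
    case False
    obtain U' where "U' \<in> \<U>" "e \<in> U'" using e E(2) by blast
    then have "U' = U" using orth v False unfolding pairwise_def by metis
    with \<open>e \<in> U'\<close> have "e \<in> U" by simp
    then show ?thesis using sub[OF v(2)] by (simp add: fun_vs.subspace_scale)
  qed
  then have "p \<in> U" unfolding p_def using sub[OF v(2)] by (intro fun_vs.subspace_sum) auto
  define r where "r = v - p"
  have rU: "r \<in> U" unfolding r_def using sub[OF v(2)] \<open>p \<in> U\<close> v(1) by (simp add: fun_vs.subspace_diff)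
  have rL: "r \<in> L2" using rU sub v by blast
  have rE: "L2_inner r e = 0" if e: "e \<in> E" for e
  proof -
    have "L2_inner p e = (\<Sum>e'\<in>E. L2_inner v e' * (if e' = e then 1 else 0))"
      unfolding p_def using e by (simp add: L2_inner_sum_left L2_fscale EL L2_inner_fscale_left E)
    also have "\<dots> = (\<Sum>e'\<in>E. if e' = e then L2_inner v e else 0)" by (intro sum.cong) auto
    also have "\<dots> = L2_inner v e" using e E(1) by simp
    finally show ?thesis by (simp add: r_def L2_inner_diff_left vL pL EL e)
  qed
  have pE: "p \<in> fun_vs.span E" unfolding p_def
    by (intro fun_vs.span_sum fun_vs.span_scale fun_vs.span_base)
  show ?thesis
  proof (cases "r = 0")
    case True
    then have "v = p" by (simp add: r_def)
    then show ?thesis using E pE by (intro exI[of _ E]) auto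
  next
    case False
    then have nr: "0 < L2_norm r" using rL L2_norm_pos by blast
    define e0 where "e0 = fscale (of_real (1 / L2_norm r)) r"
    have e0U: "e0 \<in> U" unfolding e0_def using rU sub[OF v(2)] by (simp add: fun_vs.subspace_scale)
    have "L2_norm e0 = 1" unfolding e0_def using nr by (simp add: L2_norm_fscale rL norm_divide)
    then have e0e0: "L2_inner e0 e0 = 1" unfolding L2_inner_self by simp
    have e0E: "L2_inner e0 e = 0" "L2_inner e e0 = 0" if "e \<in> E" for e
      using rE[OF that] L2_inner_commute[of e e0] by (simp_all add: e0_def L2_inner_fscale_left)
    have rr: "r = fscale (of_real (L2_norm r)) e0"
      using nr by (simp add: e0_def fscale_def fun_eq_iff)
    have "v = r + p" by (simp add: r_def)
    moreover have "r \<in> fun_vs.span (insert e0 E)"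
      by (subst rr) (intro fun_vs.span_scale fun_vs.span_base insertI1)
    moreover have "p \<in> fun_vs.span (insert e0 E)"
      using pE fun_vs.span_mono[OF subset_insertI] by blast
    ultimately have "v \<in> fun_vs.span (insert e0 E)"
      by (simp only: fun_vs.span_add)
    moreover have "insert e0 E \<subseteq> \<Union>\<U>" using E(2) e0U v(2) by blast
    moreover have "\<forall>e\<in>insert e0 E. \<forall>e'\<in>insert e0 E. L2_inner e e' = (if e = e' then 1 else 0)"
    proof (intro ballI)
      fix e e' assume "e \<in> insert e0 E" "e' \<in> insert e0 E"
      moreover have "e0 \<notin> E" using e0e0 e0E by fastforce
      ultimately show "L2_inner e e' = (if e = e' then 1 else 0)"
        using e0e0 e0E E(3) by auto
    qed
    ultimately show ?thesis using E(1) by (intro exI[of _ "insert e0 E"]) auto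
  qed
qed

text \<open>When the members of the family are eigenspaces, the Gram--Schmidt process turns eigenvectors into
  eigenvectors, although the eigenvalues of the given sequence may be mixed.\<close>

lemma orthonormalization:
  assumes sub: "\<And>U. U \<in> \<U> \<Longrightarrow> fun_vs.subspace U \<and> U \<subseteq> L2"
    and orth: "pairwise (\<lambda>U U'. \<forall>u\<in>U. \<forall>u'\<in>U'. L2_inner u u' = 0) \<U>"
    and S: "countable S" "S \<subseteq> \<Union>\<U>"
  shows "\<exists>E. countable E \<and> E \<subseteq> \<Union>\<U> \<and> S \<subseteq> fun_vs.span E \<and>
    (\<forall>e\<in>E. \<forall>e'\<in>E. L2_inner e e' = (if e = e' then 1 else 0))"
proof (cases "S = {}")
  case True
  then show ?thesis by (intro exI[of _ "{}"]) simp
next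
  case False
  define v where "v = from_nat_into S"
  have v: "range v = S" unfolding v_def using False S(1) by (rule range_from_nat_into)
  define good where "good E \<longleftrightarrow> finite E \<and> E \<subseteq> \<Union>\<U> \<and>
     (\<forall>e\<in>E. \<forall>e'\<in>E. L2_inner e e' = (if e = e' then 1 else 0))" for E :: "('a \<Rightarrow> complex) set"
  have "\<exists>E. \<forall>n. good (E n) \<and> (E n \<subseteq> E (Suc n) \<and> v n \<in> fun_vs.span (E (Suc n)))"
  proof (rule dependent_nat_choice)
    show "\<exists>E. good E" by (rule exI[of _ "{}"]) (simp add: good_def)
    fix E :: "('a \<Rightarrow> complex) set" and n assume E: "good E"
    obtain U where "v n \<in> U" "U \<in> \<U>" using v S(2) by blast
    note U = this
    have "\<exists>E'. finite E' \<and> E \<subseteq> E' \<and> E' \<subseteq> \<Union>\<U> \<and> v n \<in> fun_vs.span E' \<and>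
        (\<forall>e\<in>E'. \<forall>e'\<in>E'. L2_inner e e' = (if e = e' then 1 else 0))"
      by (rule orthonormal_step[of \<U> E "v n" U])
        (use sub orth E U in \<open>simp_all add: good_def\<close>)
    then show "\<exists>E'. good E' \<and> (E \<subseteq> E' \<and> v n \<in> fun_vs.span E')"
      unfolding good_def by (elim exE conjE, intro exI conjI) assumption+
  qed
  then obtain E where E: "\<And>n. good (E n)" "\<And>n. E n \<subseteq> E (Suc n)" "\<And>n. v n \<in> fun_vs.span (E (Suc n))"
    by blast
  have mono: "E m \<subseteq> E n" if "m \<le> n" for m n
    using lift_Suc_mono_le[of E, OF E(2) that] .
  show ?thesis
  proof (intro exI[of _ "\<Union>(range E)"] conjI ballI)
    show "countable (\<Union>(range E))" using E(1) by (auto simp: good_def intro: countable_finite)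
    show "\<Union>(range E) \<subseteq> \<Union>\<U>" using E(1) by (auto simp: good_def)
    have "v n \<in> fun_vs.span (\<Union>(range E))" for n
      using E(3)[of n] fun_vs.span_mono[of "E (Suc n)" "\<Union>(range E)"] by blast
    then show "S \<subseteq> fun_vs.span (\<Union>(range E))" using v by blast
    fix e e' assume "e \<in> \<Union>(range E)" "e' \<in> \<Union>(range E)"
    then obtain m n where "e \<in> E m" "e' \<in> E n" by blast
    then have "e \<in> E (max m n)" "e' \<in> E (max m n)" using mono[of m "max m n"] mono[of n "max m n"] by auto
    then show "L2_inner e e' = (if e = e' then 1 else 0)" using E(1) by (auto simp: good_def)
  qed
qed

lemma L2_norm_sq_orthogonal_sum:
  assumes "finite I" "\<And>i. i \<in> I \<Longrightarrow> v i \<in> L2"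
    and "\<And>i j. i \<in> I \<Longrightarrow> j \<in> I \<Longrightarrow> i \<noteq> j \<Longrightarrow> L2_inner (v i) (v j) = 0"
  shows "(L2_norm (\<Sum>i\<in>I. fscale (c i) (v i)))\<^sup>2 = (\<Sum>i\<in>I. (cmod (c i))\<^sup>2 * (L2_norm (v i))\<^sup>2)"
  using assms
proof (induction I rule: finite_induct)
  case (insert i I)
  let ?s = "\<Sum>i\<in>I. fscale (c i) (v i)"
  have "L2_inner ?s (v i) = 0"
  proof (subst L2_inner_sum_left)
    show "(\<Sum>j\<in>I. L2_inner (fscale (c j) (v j)) (v i)) = 0"
    proof (rule sum.neutral, rule ballI)
      fix j assume "j \<in> I"
      then have "L2_inner (v j) (v i) = 0" using insert(2) by (intro insert(5)) auto
      then show "L2_inner (fscale (c j) (v j)) (v i) = 0" by (simp add: L2_inner_fscale_left)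
    qed
  qed (use insert(4) in \<open>simp_all add: L2_fscale\<close>)
  then have "L2_inner (fscale (c i) (v i)) ?s = 0"
    by (subst L2_inner_commute) (simp add: L2_inner_fscale_right)
  moreover have "?s \<in> L2" using insert by (intro L2_sum L2_fscale) auto
  ultimately have "(L2_norm (fscale (c i) (v i) + ?s))\<^sup>2 =
      (cmod (c i))\<^sup>2 * (L2_norm (v i))\<^sup>2 + (L2_norm ?s)\<^sup>2"
    using insert by (subst L2_norm_sq_add) (auto simp: L2_fscale L2_norm_fscale power_mult_distrib)
  moreover have "(L2_norm ?s)\<^sup>2 = (\<Sum>i\<in>I. (cmod (c i))\<^sup>2 * (L2_norm (v i))\<^sup>2)"
    by (rule insert(3)) (simp_all add: insert(4,5))
  ultimately show ?case unfolding sum.insert[OF insert(1,2)] by linarith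
qed auto

text \<open>By Bessel's inequality the partial sums of the Fourier series form a Cauchy sequence in norm, hence
  pointwise, and their pointwise limit is a limit in norm by Fatou's lemma. Members of the sequence
  may vanish, so that finite orthonormal sets can be enumerated as well.\<close>

lemma orthonormal_expansion:
  assumes e: "\<And>n::nat. e n \<in> L2" "\<And>m n. m \<noteq> n \<Longrightarrow> L2_inner (e m) (e n) = 0"
    and n1: "\<And>n. L2_inner (e n) (e n) \<in> {0, 1}" and f: "f \<in> L2"
  obtains s where "s \<in> L2" "(\<lambda>N. L2_norm (s - (\<Sum>n<N. fscale (L2_inner f (e n)) (e n)))) \<longlonglongrightarrow> 0"
    "\<And>n. L2_inner (f - s) (e n) = 0"
proof -
  define b where "b n = (cmod (L2_inner f (e n)))\<^sup>2" for n
  define S where "S N = (\<Sum>n<N. fscale (L2_inner f (e n)) (e n))" for N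
  have SL: "S N \<in> L2" for N unfolding S_def by (intro L2_sum L2_fscale e)
  have norm_e: "L2_norm (e n) \<le> 1" for n
  proof -
    have "complex_of_real ((L2_norm (e n))\<^sup>2) \<in> {0, 1}"
      using n1[of n] unfolding L2_inner_self .
    then have "(L2_norm (e n))\<^sup>2 = 0 \<or> (L2_norm (e n))\<^sup>2 = 1"
      by (metis insertE of_real_eq_0_iff of_real_eq_1_iff singletonD)
    then show ?thesis using L2_norm_nonneg[of "e n"] by (auto simp: power2_eq_1_iff)
  qed
  have coeff: "L2_inner f (e n) * L2_inner (e n) (e n) = L2_inner f (e n)" for n
  proof (cases "L2_inner (e n) (e n) = 0")
    case True
    then have "e n = 0" using L2_norm_eq_0_iff[OF e(1)[of n]] unfolding L2_inner_self by simp
    then show ?thesis by simp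
  qed (use n1[of n] in auto)
  have Se: "L2_inner (S N) (e m) = (if m < N then L2_inner f (e m) else 0)" for N m
  proof -
    have "L2_inner (S N) (e m) = (\<Sum>n<N. L2_inner f (e n) * L2_inner (e n) (e m))"
      unfolding S_def by (simp add: L2_inner_sum_left L2_fscale e L2_inner_fscale_left)
    also have "\<dots> = (\<Sum>n<N. if n = m then L2_inner f (e m) else 0)"
      by (intro sum.cong) (auto simp: e(2) coeff)
    finally show ?thesis by simp
  qed
  have diff: "S (N + k) - S N = (\<Sum>n\<in>{N..<N+k}. fscale (L2_inner f (e n)) (e n))" for N k
  proof -
    have "S N + (\<Sum>n\<in>{N..<N+k}. fscale (L2_inner f (e n)) (e n)) = S (N + k)"
      unfolding S_def lessThan_atLeast0 by (rule sum.atLeastLessThan_concat) simp_all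
    then have "S (N + k) = S N + (\<Sum>n\<in>{N..<N+k}. fscale (L2_inner f (e n)) (e n))" ..
    then show ?thesis by (simp only: add_diff_cancel_left')
  qed
  have norm_diff: "(L2_norm (S (N + k) - S N))\<^sup>2 \<le> (\<Sum>n\<in>{N..<N+k}. b n)" for N k
    unfolding diff
    by (subst L2_norm_sq_orthogonal_sum)
       (auto simp: e b_def L2_norm_nonneg norm_e intro!: sum_mono mult_left_le power_le_one)
  have fS: "(L2_norm f)\<^sup>2 \<ge> (\<Sum>n<N. b n)" for N
  proof -
    have Sg: "L2_inner (S N) g = (\<Sum>n<N. L2_inner f (e n) * cnj (L2_inner g (e n)))"
      if "g \<in> L2" for g
      unfolding S_def using that
      by (subst L2_inner_sum_left)
         (simp_all add: L2_fscale e L2_inner_fscale_left L2_inner_commute[symmetric])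
    have SS: "L2_inner (S N) f = of_real (\<Sum>n<N. b n)"
      by (simp only: Sg f b_def complex_norm_square of_real_sum)
    have "L2_inner (S N) (S N) = of_real (\<Sum>n<N. b n)"
      unfolding Sg[OF SL] by (simp add: Se b_def complex_norm_square del: of_real_power)
    then have norm_S: "(L2_norm (S N))\<^sup>2 = (\<Sum>n<N. b n)"
      unfolding L2_inner_self by (simp only: of_real_eq_iff)
    show ?thesis
    proof (cases "L2_norm (S N) = 0")
      case False
      have "(L2_norm (S N))\<^sup>2 \<le> L2_norm (S N) * L2_norm f"
        using cmod_L2_inner_le[OF SL f, of N] unfolding SS norm_of_real norm_S by linarith
      then have "L2_norm (S N) \<le> L2_norm f"
        using False L2_norm_nonneg[of "S N"] by (simp add: power2_eq_square)
      then show ?thesis using norm_S L2_norm_nonneg[of "S N"] by (metis power_mono)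
    qed (use norm_S in auto)
  qed
  have b0: "0 \<le> b n" for n by (simp add: b_def)
  have sb: "summable b"
    by (rule summableI_nonneg_bounded[OF b0 fS])
  have tail: "(L2_norm (S (N + k) - S N))\<^sup>2 \<le> (\<Sum>n. b (n + N))" for N k
  proof -
    have "(\<Sum>n\<in>{N..<N+k}. b n) = (\<Sum>n<k. b (n + N))"
      using sum.shift_bounds_nat_ivl[of b 0 N k] by (simp add: lessThan_atLeast0 add.commute)
    also have "\<dots> \<le> (\<Sum>n. b (n + N))"
      by (intro sum_le_suminf) (auto simp: b0 sb summable_ignore_initial_segment)
    finally show ?thesis using norm_diff[of N k] by linarith
  qed
  define \<epsilon> where "\<epsilon> N = sqrt (\<Sum>n. b (n + N))" for N
  have \<epsilon>: "\<epsilon> \<longlonglongrightarrow> 0"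
    using tendsto_real_sqrt[OF suminf_exist_split2[OF sb]] by (simp add: \<epsilon>_def[abs_def])
  have tail': "L2_norm (S (N + k) - S N) \<le> \<epsilon> N" for N k
    unfolding \<epsilon>_def using tail by (rule real_le_rsqrt)
  have "Cauchy (\<lambda>N. S N x)" for x
  proof (rule CauchyI')
    fix r :: real assume "0 < r"
    then obtain M where M: "\<And>N. N \<ge> M \<Longrightarrow> \<epsilon> N < r"
      using order_tendstoD(2)[OF \<epsilon>, of r] by (auto simp: eventually_sequentially)
    show "\<exists>M. \<forall>m\<ge>M. \<forall>n>m. dist (S m x) (S n x) < r"
    proof (intro exI allI impI)
      fix m n assume mn: "m \<ge> M" "m < n"
      then obtain k where k: "n = m + k" using less_imp_add_positive by blast
      have "dist (S m x) (S n x) = cmod ((S (m + k) - S m) x)"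
        by (simp add: k dist_norm norm_minus_commute)
      also have "\<dots> \<le> \<epsilon> m"
        using cmod_le_L2_norm[OF L2_diff[OF SL SL]] tail' order_trans by blast
      also have "\<dots> < r" using M mn by auto
      finally show "dist (S m x) (S n x) < r" .
    qed
  qed
  then have "\<exists>l. (\<lambda>N. S N x) \<longlonglongrightarrow> l" for x
    by (simp add: Cauchy_convergent_iff convergent_def)
  then obtain s where s: "\<And>x. (\<lambda>N. S N x) \<longlonglongrightarrow> s x" by metis
  have sS: "s - S N \<in> L2" "L2_norm (s - S N) \<le> \<epsilon> N" for N
  proof -
    have "(\<lambda>k. (S (N + k) - S N) x) \<longlonglongrightarrow> (s - S N) x" for x
      using LIMSEQ_ignore_initial_segment[OF s[of x], of N]
      by (auto simp: add.commute intro!: tendsto_intros)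
    from L2_pointwise_limit[OF L2_diff[OF SL SL] tail' this]
    show "s - S N \<in> L2" "L2_norm (s - S N) \<le> \<epsilon> N" .
  qed
  have sL: "s \<in> L2" using L2_add[OF sS(1)[of 0] SL[of 0]] by simp
  have lim: "(\<lambda>N. L2_norm (s - S N)) \<longlonglongrightarrow> 0"
    by (rule Lim_null_comparison[OF _ \<epsilon>]) (auto simp: sS L2_norm_nonneg)
  have "L2_inner (f - s) (e n) = 0" for n
  proof -
    have "(\<lambda>N. L2_inner (S N) (e n)) \<longlonglongrightarrow> L2_inner f (e n)"
      by (rule tendsto_eventually) (auto simp: Se eventually_sequentially intro!: exI[of _ "Suc n"])
    moreover have "(\<lambda>N. L2_inner (S N) (e n)) \<longlonglongrightarrow> L2_inner s (e n)"
      by (rule L2_inner_tendsto[OF SL sL e(1) lim])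
    ultimately have "L2_inner f (e n) = L2_inner s (e n)" by (rule LIMSEQ_unique)
    then show ?thesis by (simp add: L2_inner_diff_left f sL e)
  qed
  with sL lim show ?thesis using that unfolding S_def by blast
qed

text \<open>The Fourier series of f converges to some s with f - s orthogonal to E. Then f - s is orthogonal to
  f by hypothesis and to s as a limit of combinations of E, so it vanishes.\<close>

lemma orthonormal_basis_ofI:
  assumes V: "V \<subseteq> L2" and E: "E \<subseteq> V" "countable E"
    and orth: "\<And>e e'. e \<in> E \<Longrightarrow> e' \<in> E \<Longrightarrow> L2_inner e e' = (if e = e' then 1 else 0)"
    and total: "\<And>g f. g \<in> L2 \<Longrightarrow> (\<And>e. e \<in> E \<Longrightarrow> L2_inner g e = 0) \<Longrightarrow> f \<in> V \<Longrightarrow> L2_inner g f = 0"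
  shows "orthonormal_basis_of E V"
  unfolding orthonormal_basis_of_def
proof (intro conjI ballI allI impI)
  fix f and \<epsilon> :: real assume f: "f \<in> V" and \<epsilon>: "0 < \<epsilon>"
  then have fL: "f \<in> L2" using V by blast
  define e where "e n = (if n \<in> to_nat_on E ` E then from_nat_into E n else 0)" for n
  have inE: "e n \<in> E" if "n \<in> to_nat_on E ` E" for n
    using that E(2) by (auto simp: e_def)
  have surj: "\<exists>n. x = e n" if "x \<in> E" for x
    using that E(2) by (intro exI[of _ "to_nat_on E x"]) (auto simp: e_def)
  have eL: "e n \<in> L2" for n
    using inE[of n] E(1) V by (cases "n \<in> to_nat_on E ` E") (auto simp: e_def)
  have inj: "e m \<noteq> e n" if "m \<noteq> n" "m \<in> to_nat_on E ` E" "n \<in> to_nat_on E ` E" for m n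
    using that E(2) by (auto simp: e_def)
  have e0: "L2_inner (e m) (e n) = 0" if "m \<noteq> n" for m n
  proof (cases "m \<in> to_nat_on E ` E \<and> n \<in> to_nat_on E ` E")
    case True
    then show ?thesis using orth[OF inE inE] inj[OF that] by auto
  qed (auto simp: e_def)
  have e1: "L2_inner (e n) (e n) \<in> {0, 1}" for n
    using orth[OF inE inE, of n n] by (cases "n \<in> to_nat_on E ` E") (auto simp: e_def)
  obtain s where s: "s \<in> L2" "(\<lambda>N. L2_norm (s - (\<Sum>n<N. fscale (L2_inner f (e n)) (e n)))) \<longlonglongrightarrow> 0"
    "\<And>n. L2_inner (f - s) (e n) = 0"
    using orthonormal_expansion[of e, OF eL e0 e1 fL] by blast
  define S where "S N = (\<Sum>n<N. fscale (L2_inner f (e n)) (e n))" for N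
  have SL: "S N \<in> L2" for N unfolding S_def by (intro L2_sum L2_fscale eL)
  have g: "f - s \<in> L2" using fL s(1) by (rule L2_diff)
  have "L2_inner (f - s) x = 0" if "x \<in> E" for x
    using surj[OF that] s(3) by auto
  from total[OF g this f] have gf: "L2_inner (f - s) f = 0" .
  have "L2_inner (S N) (f - s) = 0" for N
    unfolding S_def using s(3) L2_inner_commute[of "e _" "f - s"]
    by (subst L2_inner_sum_left) (auto simp: L2_fscale eL g L2_inner_fscale_left)
  moreover have "(\<lambda>N. L2_inner (S N) (f - s)) \<longlonglongrightarrow> L2_inner s (f - s)"
    by (rule L2_inner_tendsto[OF SL s(1) g]) (use s(2) in \<open>simp add: S_def\<close>)
  ultimately have "L2_inner s (f - s) = 0" by (simp add: LIMSEQ_const_iff)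
  then have "L2_inner (f - s) (f - s) = 0"
    using gf L2_inner_commute[of "f - s" s] by (simp add: L2_inner_diff_right g fL s(1))
  then have "L2_norm (f - s) = 0" unfolding L2_inner_self by simp
  then have fs: "f = s" using L2_norm_eq_0_iff[OF g] by simp
  obtain N where "L2_norm (s - S N) < \<epsilon>"
    using order_tendstoD(2)[OF s(2) \<epsilon>] unfolding S_def[symmetric]
    by (auto simp: eventually_sequentially)
  moreover have "S N \<in> fun_vs.span E"
  proof -
    have "e n \<in> fun_vs.span E" for n
      using inE[of n] by (cases "n \<in> to_nat_on E ` E") (auto simp: e_def fun_vs.span_base fun_vs.span_zero)
    then show ?thesis unfolding S_def by (intro fun_vs.span_sum fun_vs.span_scale)
  qed
  ultimately show "\<exists>g\<in>fun_vs.span E. L2_norm (f - g) < \<epsilon>" using fs by blast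
qed (use E orth in auto)

lemma orthonormal_basis_from_total_set:
  assumes sub: "\<And>U. U \<in> \<U> \<Longrightarrow> fun_vs.subspace U \<and> U \<subseteq> V" and V: "V \<subseteq> L2"
    and orth: "pairwise (\<lambda>U U'. \<forall>u\<in>U. \<forall>u'\<in>U'. L2_inner u u' = 0) \<U>"
    and S: "countable S" "S \<subseteq> \<Union>\<U>"
    and total: "\<And>g f. g \<in> L2 \<Longrightarrow> (\<And>v. v \<in> S \<Longrightarrow> L2_inner g v = 0) \<Longrightarrow> f \<in> V \<Longrightarrow> L2_inner g f = 0"
  shows "\<exists>E. orthonormal_basis_of E V \<and> E \<subseteq> \<Union>\<U>"
proof -
  have subL: "fun_vs.subspace U \<and> U \<subseteq> L2" if "U \<in> \<U>" for U
    using sub[OF that] V by (simp add: order_trans[of U V L2])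
  from orthonormalization[OF subL orth S]
  obtain E where E: "countable E" "E \<subseteq> \<Union>\<U>" "S \<subseteq> fun_vs.span E"
    "\<And>e e'. e \<in> E \<Longrightarrow> e' \<in> E \<Longrightarrow> L2_inner e e' = (if e = e' then 1 else 0)" by auto
  have EV: "E \<subseteq> V" using E(2) sub by blast
  have "orthonormal_basis_of E V"
  proof (rule orthonormal_basis_ofI[OF V EV E(1,4)])
    fix g f assume g: "g \<in> L2" "\<And>e. e \<in> E \<Longrightarrow> L2_inner g e = 0" and f: "f \<in> V"
    have "L2_inner g v = 0" if "v \<in> S" for v
      by (rule L2_inner_span_eq_0[of E]) (use EV V E(3) that g in auto)
    then show "L2_inner g f = 0" using total g f by blast
  qed auto
  with E(2) show ?thesis by blast
qed

text \<open>Gaussian elimination: an equation with a nonzero coefficient is used to eliminate one unknown.\<close>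

lemma homogeneous_system_nontrivial_solution:
  fixes M :: "'i \<Rightarrow> 'j \<Rightarrow> 'c::field"
  assumes "finite I" "finite J" "card I < card J"
  shows "\<exists>c. (\<exists>j\<in>J. c j \<noteq> 0) \<and> (\<forall>i\<in>I. (\<Sum>j\<in>J. c j * M i j) = 0)"
  using assms
proof (induction I arbitrary: J M rule: finite_induct)
  case empty
  then obtain j where "j \<in> J" by fastforce
  then show ?case by (intro exI[of _ "\<lambda>_. 1"]) auto
next
  case (insert i I)
  show ?case
  proof (cases "\<forall>j\<in>J. M i j = 0")
    case True
    have "card I < card J" using insert by auto
    from insert(3)[OF insert(4) this, of M] True show ?thesis by auto
  next
    case False
    then obtain k where k: "k \<in> J" "M i k \<noteq> 0" by blast
    have "card I < card (J - {k})" using insert k by auto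
    from insert(3)[OF _ this, of "\<lambda>i' j. M i' j - M i' k * M i j / M i k"] insert(4)
    obtain c where c: "\<exists>j\<in>J - {k}. c j \<noteq> 0"
      "\<And>i'. i' \<in> I \<Longrightarrow> (\<Sum>j\<in>J - {k}. c j * (M i' j - M i' k * M i j / M i k)) = 0" by auto
    define d where "d j = (if j = k then - (\<Sum>j\<in>J - {k}. c j * M i j) / M i k else c j)" for j
    have split: "(\<Sum>j\<in>J. d j * M i' j) = d k * M i' k + (\<Sum>j\<in>J - {k}. c j * M i' j)" for i'
      using sum.remove[OF insert(4) k(1), of "\<lambda>j. d j * M i' j"] by (simp add: d_def)
    have "(\<Sum>j\<in>J. d j * M i' j) = 0" if "i' \<in> I" for i'
    proof -
      have "(\<Sum>j\<in>J - {k}. c j * M i' j) = (\<Sum>j\<in>J - {k}. c j * M i j) * (M i' k / M i k)"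
        using c(2)[OF that] by (simp add: right_diff_distrib sum_subtractf sum_distrib_left sum_distrib_right field_simps)
      then show ?thesis unfolding split by (simp add: d_def)
    qed
    moreover have "(\<Sum>j\<in>J. d j * M i j) = 0" unfolding split using k(2) by (simp add: d_def)
    moreover have "\<exists>j\<in>J. d j \<noteq> 0" using c(1) by (auto simp: d_def)
    ultimately show ?thesis by (intro exI[of _ d]) auto
  qed
qed

section \<open>Symmetric operators and the min-max principle\<close>

definition symmetric_on_L2 :: "(('a \<Rightarrow> complex) \<Rightarrow> 'a \<Rightarrow> complex) \<Rightarrow> bool" where
  "symmetric_on_L2 T \<longleftrightarrow>
     (\<forall>f\<in>L2. T f \<in> L2) \<and> (\<forall>f\<in>L2. \<forall>g\<in>L2. T (f + g) = T f + T g) \<and>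
     (\<forall>f\<in>L2. \<forall>c. T (fscale c f) = fscale c (T f)) \<and>
     (\<forall>f\<in>L2. \<forall>g\<in>L2. L2_inner (T f) g = L2_inner f (T g))"

context
  fixes T :: "('a \<Rightarrow> complex) \<Rightarrow> 'a \<Rightarrow> complex"
  assumes T: "symmetric_on_L2 T"
begin

lemma symmetric_on_L2_L2: "f \<in> L2 \<Longrightarrow> T f \<in> L2"
  and symmetric_on_L2_add: "f \<in> L2 \<Longrightarrow> g \<in> L2 \<Longrightarrow> T (f + g) = T f + T g"
  and symmetric_on_L2_fscale: "f \<in> L2 \<Longrightarrow> T (fscale c f) = fscale c (T f)"
  and symmetric_on_L2_inner: "f \<in> L2 \<Longrightarrow> g \<in> L2 \<Longrightarrow> L2_inner (T f) g = L2_inner f (T g)"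
  using T by (auto simp: symmetric_on_L2_def)

lemma symmetric_on_L2_0: "T 0 = 0"
  using symmetric_on_L2_fscale[of 0 0] by (simp add: fun_vs.scale_zero_left)

lemma symmetric_on_L2_sum:
  "(\<And>i. i \<in> I \<Longrightarrow> f i \<in> L2) \<Longrightarrow> T (\<Sum>i\<in>I. f i) = (\<Sum>i\<in>I. T (f i))"
  by (induction I rule: infinite_finite_induct)
     (simp_all add: symmetric_on_L2_0 symmetric_on_L2_add L2_sum)

lemma eigenspace_subspace: "fun_vs.subspace (eigenspace T z)"
  by (auto simp: fun_vs.subspace_def eigenspace_def L2_add L2_fscale symmetric_on_L2_0
      symmetric_on_L2_add symmetric_on_L2_fscale fun_vs.scale_right_distrib mult.commute)

lemma eigenvalue_real:
  assumes "eigenfunction T z f"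
  shows "z \<in> \<real>"
proof -
  have f: "f \<in> L2" "T f = fscale z f" "f \<noteq> 0" using assms by (auto simp: eigenfunction_def eigenspace_def)
  have "z * L2_inner f f = cnj z * L2_inner f f"
    using symmetric_on_L2_inner[OF f(1,1)] by (simp add: f(2) L2_inner_fscale_left L2_inner_fscale_right)
  moreover have "L2_inner f f \<noteq> 0" unfolding L2_inner_self using L2_norm_pos[OF f(1,3)] by simp
  ultimately have "cnj z = z" by simp
  then show ?thesis by (simp add: Reals_cnj_iff)
qed

lemma eigenspaces_orthogonal:
  assumes "f \<in> eigenspace T z" "g \<in> eigenspace T z'" "z \<noteq> z'"
  shows "L2_inner f g = 0"
proof (cases "f = 0 \<or> g = 0")
  case False
  then have "z' \<in> \<real>" using assms eigenvalue_real[of z' g] by (auto simp: eigenfunction_def)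
  then have "cnj z' = z'" by (simp add: Reals_cnj_iff)
  then have "z * L2_inner f g = z' * L2_inner f g"
    using symmetric_on_L2_inner[of f g] assms
    by (auto simp: eigenspace_def L2_inner_fscale_left L2_inner_fscale_right)
  then show ?thesis using assms(3) by simp
qed auto

text \<open>If the conclusion failed, the form of T - t would be positive definite on the span of the n + 1
  orthogonal vectors. But the n linear conditions have a nonzero common solution in this span, and
  there the form is not positive.\<close>

lemma minimax_upper_bound:
  fixes v :: "nat \<Rightarrow> 'a \<Rightarrow> complex" and n :: nat and t :: real
  assumes v: "\<And>i. i \<le> n \<Longrightarrow> v i \<in> L2"
    and orth: "\<And>i j. i \<le> n \<Longrightarrow> j \<le> n \<Longrightarrow> i \<noteq> j \<Longrightarrow> L2_inner (v i) (v j) = 0"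
    and eig: "\<And>i. i < n \<Longrightarrow> T (v i) = fscale (of_real (\<mu> i)) (v i)" "\<And>i. i < n \<Longrightarrow> v i \<noteq> 0"
      "\<And>i. i < n \<Longrightarrow> t < \<mu> i"
    and lin: "\<And>i I c. i < n \<Longrightarrow> finite I \<Longrightarrow> l i (\<Sum>j\<in>I. fscale (c j) (v j)) = (\<Sum>j\<in>I. c j * l i (v j))"
    and bound: "\<And>h. h \<in> fun_vs.span (v ` {..n}) \<Longrightarrow> (\<And>i. i < n \<Longrightarrow> l i h = (0::complex)) \<Longrightarrow>
      Re (L2_inner (T h) h) \<le> t * (L2_norm h)\<^sup>2"
  shows "Re (L2_inner (T (v n)) (v n)) \<le> t * (L2_norm (v n))\<^sup>2"
proof (rule ccontr)
  assume contra: "\<not> ?thesis"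
  define q where "q i = Re (L2_inner (T (v i)) (v i)) - t * (L2_norm (v i))\<^sup>2" for i
  have q: "0 < q i" if "i \<le> n" for i
  proof (cases "i = n")
    case False
    with that have i: "i < n" by simp
    then have "q i = (\<mu> i - t) * (L2_norm (v i))\<^sup>2"
      by (simp add: q_def eig L2_inner_fscale_left L2_inner_self left_diff_distrib)
    moreover have "0 < L2_norm (v i)" using eig(2)[OF i] v[OF that] by (simp add: L2_norm_pos)
    ultimately show ?thesis using eig(3)[OF i] by simp
  qed (use contra in \<open>simp add: q_def\<close>)
  obtain c where c: "\<exists>j\<in>{..n}. c j \<noteq> 0" "\<And>i. i < n \<Longrightarrow> (\<Sum>j\<in>{..n}. c j * l i (v j)) = 0"
    using homogeneous_system_nontrivial_solution[of "{..<n}" "{..n}" "\<lambda>i j. l i (v j)"] by auto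
  define h where "h = (\<Sum>j\<in>{..n}. fscale (c j) (v j))"
  have hs: "h \<in> fun_vs.span (v ` {..n})" unfolding h_def
    by (intro fun_vs.span_sum fun_vs.span_scale fun_vs.span_base) auto
  have hL: "h \<in> L2" unfolding h_def by (intro L2_sum L2_fscale v) auto
  have Tv0: "L2_inner (T (v i)) (v j) = 0" if "i \<le> n" "j \<le> n" "i \<noteq> j" for i j
  proof (cases "i = n")
    case False
    then show ?thesis using that orth[of i j] by (simp add: eig L2_inner_fscale_left)
  next
    case True
    then have "L2_inner (T (v i)) (v j) = L2_inner (v i) (T (v j))"
      using that by (intro symmetric_on_L2_inner v) auto
    also have "\<dots> = 0" using True that orth[of i j] by (simp add: eig L2_inner_fscale_right)
    finally show ?thesis .
  qed
  have Th: "L2_inner (T h) h = (\<Sum>i\<le>n. of_real ((cmod (c i))\<^sup>2) * L2_inner (T (v i)) (v i))"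
  proof -
    have hv: "L2_inner (T (v i)) h = cnj (c i) * L2_inner (T (v i)) (v i)" if "i \<le> n" for i
    proof -
      have "L2_inner h (T (v i)) = (\<Sum>j\<le>n. c j * L2_inner (v j) (T (v i)))"
        unfolding h_def using that
        by (subst L2_inner_sum_left) (auto simp: L2_fscale v symmetric_on_L2_L2 L2_inner_fscale_left)
      also have "\<dots> = (\<Sum>j\<le>n. if j = i then c i * L2_inner (v i) (T (v i)) else 0)"
        using that Tv0 by (intro sum.cong) (auto simp: symmetric_on_L2_inner[symmetric] v)
      finally have "L2_inner h (T (v i)) = c i * L2_inner (v i) (T (v i))" using that by simp
      then show ?thesis by (metis L2_inner_commute complex_cnj_mult)
    qed
    have "T h = (\<Sum>i\<le>n. fscale (c i) (T (v i)))"
      unfolding h_def by (subst symmetric_on_L2_sum) (auto simp: L2_fscale v symmetric_on_L2_fscale)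
    then have "L2_inner (T h) h = (\<Sum>i\<le>n. L2_inner (fscale (c i) (T (v i))) h)"
      by (simp only:) (rule L2_inner_sum_left, auto simp: L2_fscale symmetric_on_L2_L2 v hL)
    also have "\<dots> = (\<Sum>i\<le>n. c i * L2_inner (T (v i)) h)"
      by (simp only: L2_inner_fscale_left)
    also have "\<dots> = (\<Sum>i\<le>n. c i * (cnj (c i) * L2_inner (T (v i)) (v i)))"
      by (intro sum.cong refl) (simp add: hv)
    finally show ?thesis by (simp only: complex_norm_square mult.assoc)
  qed
  have "(L2_norm h)\<^sup>2 = (\<Sum>i\<le>n. (cmod (c i))\<^sup>2 * (L2_norm (v i))\<^sup>2)"
    unfolding h_def by (rule L2_norm_sq_orthogonal_sum) (auto simp: v orth)
  then have "Re (L2_inner (T h) h) - t * (L2_norm h)\<^sup>2 = (\<Sum>i\<le>n. (cmod (c i))\<^sup>2 * q i)"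
    by (simp add: Th q_def sum_distrib_left sum_subtractf right_diff_distrib algebra_simps)
  moreover have "\<dots> > 0"
  proof -
    obtain j where "j \<le> n" "c j \<noteq> 0" using c(1) by auto
    then have "0 < (cmod (c j))\<^sup>2 * q j" using q by simp
    moreover have "0 \<le> (cmod (c i))\<^sup>2 * q i" if "i \<le> n" for i using q[OF that] by simp
    ultimately show ?thesis using \<open>j \<le> n\<close> by (intro sum_pos2[of _ j]) auto
  qed
  moreover have "Re (L2_inner (T h) h) \<le> t * (L2_norm h)\<^sup>2"
    by (rule bound[OF hs]) (use c(2) lin in \<open>auto simp: h_def\<close>)
  ultimately show False by linarith
qed

end

section \<open>Averages over balls\<close>

text \<open>The combinatorial content of a homogeneous ultrametric space: \<open>B x k\<close> is the k-th ball around x, the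
  balls of one level partition the space, and they all have the same size.\<close>

locale homogeneous_hierarchy =
  fixes B :: "'a \<Rightarrow> nat \<Rightarrow> 'a set"
  assumes B_0: "B x 0 = {x}"
    and B_psubset_Suc: "B x k \<subset> B x (Suc k)"
    and finite_B: "finite (B x k)"
    and B_eq: "y \<in> B x k \<Longrightarrow> B y k = B x k"
    and card_B_eq: "card (B x k) = card (B y k)"
begin

text \<open>The centre is arbitrary, since all balls of one level have the same size.\<close>

definition ball_card :: "nat \<Rightarrow> nat" where "ball_card k = card (B undefined k)"

lemma card_B: "card (B x k) = ball_card k"
  unfolding ball_card_def by (rule card_B_eq)

lemma B_mono: "j \<le> k \<Longrightarrow> B x j \<subseteq> B x k"
  using lift_Suc_mono_le[of "B x" j k] B_psubset_Suc by blast

lemma self_in_B: "x \<in> B x k"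
  using B_mono[of 0 k x] B_0[of x] by auto

lemma B_sym: "y \<in> B x k \<longleftrightarrow> x \<in> B y k"
  using B_eq self_in_B by metis

lemma ball_card_0: "ball_card 0 = 1"
  unfolding ball_card_def by (simp add: B_0)

lemma ball_card_less_Suc: "ball_card k < ball_card (Suc k)"
  unfolding ball_card_def by (intro psubset_card_mono finite_B B_psubset_Suc)

lemma ball_card_ge: "Suc k \<le> ball_card k"
proof (induction k)
  case (Suc k)
  then show ?case using ball_card_less_Suc[of k] by linarith
qed (simp add: ball_card_0)

lemma ball_card_pos: "0 < ball_card k"
  using ball_card_ge[of k] by linarith

text \<open>Double counting: a point z of F occurs in the ball around y exactly when y lies in the ball around z.\<close>

lemma sum_over_saturated:
  fixes g :: "'a \<Rightarrow> 'b::comm_semiring_1"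
  assumes F: "finite F" "\<And>y. y \<in> F \<Longrightarrow> B y k \<subseteq> F"
  shows "(\<Sum>y\<in>F. \<Sum>z\<in>B y k. g z) = of_nat (ball_card k) * (\<Sum>z\<in>F. g z)"
proof -
  have "(\<Sum>y\<in>F. \<Sum>z\<in>B y k. g z) = (\<Sum>y\<in>F. \<Sum>z\<in>{z \<in> F. z \<in> B y k}. g z)"
    using F(2) by (intro sum.cong) auto
  also have "\<dots> = (\<Sum>z\<in>F. \<Sum>y\<in>{y \<in> F. z \<in> B y k}. g z)"
    by (rule sum.swap_restrict[OF F(1) F(1)])
  also have "\<dots> = (\<Sum>z\<in>F. \<Sum>y\<in>B z k. g z)"
    using F(2) B_sym by (intro sum.cong) auto
  finally show ?thesis by (simp add: card_B sum_distrib_left)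
qed

definition P :: "nat \<Rightarrow> ('a \<Rightarrow> complex) \<Rightarrow> 'a \<Rightarrow> complex" where
  "P k f x = (\<Sum>y\<in>B x k. f y) / of_nat (ball_card k)"

lemma P_0: "P 0 f = f"
  by (auto simp: P_def fun_eq_iff ball_card_0 B_0)

lemma P_add: "P k (f + g) = P k f + P k g"
  by (auto simp: P_def fun_eq_iff sum.distrib add_divide_distrib)

lemma P_diff: "P k (f - g) = P k f - P k g"
  by (auto simp: P_def fun_eq_iff sum_subtractf diff_divide_distrib)

lemma P_fscale: "P k (fscale c f) = fscale c (P k f)"
  by (auto simp: P_def fun_eq_iff fscale_def sum_distrib_left)

lemma P_const: "y \<in> B x k \<Longrightarrow> P k f y = P k f x"
  by (simp add: P_def B_eq)

lemma P_P: "P j (P k f) = P (max j k) f"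
proof (rule ext)
  fix x
  show "P j (P k f) x = P (max j k) f x"
  proof (cases "j \<le> k")
    case True
    have "(\<Sum>y\<in>B x j. P k f y) = (\<Sum>y\<in>B x j. P k f x)"
      using B_mono[OF True] P_const by (intro sum.cong refl) blast
    then show ?thesis using True ball_card_pos[of j] by (simp add: P_def[of j] card_B max_def)
  next
    case False
    then have kj: "k \<le> j" by simp
    have "(\<Sum>y\<in>B x j. P k f y) = (\<Sum>y\<in>B x j. \<Sum>z\<in>B y k. f z) / of_nat (ball_card k)"
      unfolding P_def sum_divide_distrib ..
    also have "(\<Sum>y\<in>B x j. \<Sum>z\<in>B y k. f z) = of_nat (ball_card k) * (\<Sum>z\<in>B x j. f z)"
      using B_mono[OF kj] B_eq by (intro sum_over_saturated finite_B) fastforce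
    finally show ?thesis using False ball_card_pos[of k] by (simp add: P_def[of j] max_def)
  qed
qed

lemma cmod_P_sq_le: "(cmod (P k f x))\<^sup>2 \<le> (\<Sum>y\<in>B x k. (cmod (f y))\<^sup>2) / ball_card k"
proof -
  have "cmod (\<Sum>y\<in>B x k. f y) \<le> (\<Sum>y\<in>B x k. \<bar>1\<bar> * \<bar>cmod (f y)\<bar>)"
    using norm_sum[of f "B x k"] by simp
  also have "\<dots> \<le> L2_set (\<lambda>_. 1) (B x k) * L2_set (\<lambda>y. cmod (f y)) (B x k)"
    by (rule L2_set_mult_ineq)
  finally have "(cmod (\<Sum>y\<in>B x k. f y))\<^sup>2 \<le> (L2_set (\<lambda>_. 1) (B x k) * L2_set (\<lambda>y. cmod (f y)) (B x k))\<^sup>2"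
    by (rule power_mono) simp
  also have "\<dots> = ball_card k * (\<Sum>y\<in>B x k. (cmod (f y))\<^sup>2)"
    by (simp add: L2_set_def power_mult_distrib card_B sum_nonneg)
  finally show ?thesis
    using ball_card_pos[of k] by (simp add: P_def norm_divide power_divide divide_simps power2_eq_square mult.commute)
qed

text \<open>Jensen's inequality on each ball and double counting.\<close>

lemma
  assumes f: "f \<in> L2"
  shows P_L2: "P k f \<in> L2" and L2_norm_P_le: "L2_norm (P k f) \<le> L2_norm f"
proof -
  have *: "(\<Sum>x\<in>F. (cmod (P k f x))\<^sup>2) \<le> (L2_norm f)\<^sup>2" if F: "finite F" for F
  proof -
    define G where "G = (\<Union>x\<in>F. B x k)"
    have G: "finite G" unfolding G_def using F finite_B by blast
    have sat: "B y k \<subseteq> G" if "y \<in> G" for y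
      using that B_eq unfolding G_def by blast
    have "(\<Sum>x\<in>F. (cmod (P k f x))\<^sup>2) \<le> (\<Sum>x\<in>G. (cmod (P k f x))\<^sup>2)"
      using self_in_B by (intro sum_mono2 G) (auto simp: G_def)
    also have "\<dots> \<le> (\<Sum>x\<in>G. (\<Sum>y\<in>B x k. (cmod (f y))\<^sup>2) / ball_card k)"
      by (intro sum_mono cmod_P_sq_le)
    also have "\<dots> = (\<Sum>x\<in>G. \<Sum>y\<in>B x k. (cmod (f y))\<^sup>2) / ball_card k"
      by (simp add: sum_divide_distrib)
    also have "\<dots> = (\<Sum>y\<in>G. (cmod (f y))\<^sup>2)"
      using sum_over_saturated[OF G sat, of "\<lambda>y. (cmod (f y))\<^sup>2"] ball_card_pos[of k] by simp
    also have "\<dots> \<le> (L2_norm f)\<^sup>2"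
      by (rule sum_le_L2_norm[OF f G])
    finally show ?thesis .
  qed
  show "P k f \<in> L2" "L2_norm (P k f) \<le> L2_norm f"
    using L2_bounded[OF L2_norm_nonneg *] by auto
qed

lemma P_tendsto_0:
  assumes f: "f \<in> L2"
  shows "(\<lambda>k. P k f x) \<longlonglongrightarrow> 0"
proof -
  have bound: "cmod (P k f x) \<le> sqrt ((L2_norm f)\<^sup>2 / ball_card k)" for k
  proof -
    have "(cmod (P k f x))\<^sup>2 \<le> (\<Sum>y\<in>B x k. (cmod (f y))\<^sup>2) / ball_card k" by (rule cmod_P_sq_le)
    also have "\<dots> \<le> (L2_norm f)\<^sup>2 / ball_card k"
      by (intro divide_right_mono sum_le_L2_norm f finite_B) simp
    finally show ?thesis by (rule real_le_rsqrt)
  qed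
  have "filterlim ball_card at_top sequentially"
    by (rule filterlim_at_top_mono[OF filterlim_ident]) (simp add: Suc_leD[OF ball_card_ge])
  then have "filterlim (\<lambda>k. real (ball_card k)) at_top sequentially"
    by (rule filterlim_compose[OF filterlim_real_sequentially])
  then have "(\<lambda>k. (L2_norm f)\<^sup>2 / ball_card k) \<longlonglongrightarrow> 0"
    by (rule tendsto_divide_0[OF tendsto_const filterlim_at_top_imp_at_infinity])
  from tendsto_real_sqrt[OF this] have "(\<lambda>k. sqrt ((L2_norm f)\<^sup>2 / ball_card k)) \<longlonglongrightarrow> 0" by simp
  then show ?thesis
    by (rule Lim_null_comparison[rotated]) (auto simp: bound intro!: always_eventually)
qed

text \<open>An idempotent contraction is an orthogonal projection. Indeed u + p, with p a suitable small multiple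
  of v, is shorter than u unless u and v are orthogonal, but P maps it to u.\<close>

lemma P_range_kernel_orthogonal:
  assumes u: "u \<in> L2" "P k u = u" and v: "v \<in> L2" "P k v = 0"
  shows "L2_inner u v = 0"
proof (rule ccontr)
  define c where "c = L2_inner u v"
  assume "L2_inner u v \<noteq> 0"
  then have c: "0 < (cmod c)\<^sup>2" by (simp add: c_def)
  \<comment> \<open>A negative factor that makes the quadratic polynomial \<open>s * (2 + s * \<parallel>v\<parallel>\<^sup>2)\<close> negative.\<close>
  define s where "s = - 1 / (1 + (L2_norm v)\<^sup>2)"
  define p where "p = fscale (of_real s * c) v"
  have pL: "p \<in> L2" unfolding p_def by (intro L2_fscale v)
  have "P k (u + p) = u"
    by (simp add: P_add u p_def P_fscale v)
  then have "(L2_norm u)\<^sup>2 \<le> (L2_norm (u + p))\<^sup>2"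
    using L2_norm_P_le[OF L2_add[OF u(1) pL], of k] L2_norm_nonneg by (metis power_mono)
  also have "\<dots> = (L2_norm u)\<^sup>2 + 2 * Re (L2_inner u p) + (L2_norm p)\<^sup>2"
    by (rule L2_norm_sq_add[OF u(1) pL])
  also have "L2_inner u p = of_real (s * (cmod c)\<^sup>2)"
    unfolding p_def L2_inner_fscale_right c_def[symmetric] of_real_mult complex_norm_square
    by simp
  also have "(L2_norm p)\<^sup>2 = s\<^sup>2 * (cmod c)\<^sup>2 * (L2_norm v)\<^sup>2"
    by (simp add: p_def L2_norm_fscale v norm_mult power_mult_distrib)
  finally have "0 \<le> (cmod c)\<^sup>2 * (s * (2 + s * (L2_norm v)\<^sup>2))"
    by (simp add: power2_eq_square algebra_simps)
  then have 1: "0 \<le> s * (2 + s * (L2_norm v)\<^sup>2)" using c by (simp add: zero_le_mult_iff)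
  have pos: "0 < 1 + (L2_norm v)\<^sup>2" by (simp add: add_pos_nonneg)
  have "s < 0" using pos by (simp add: s_def divide_simps)
  have "2 + s * (L2_norm v)\<^sup>2 = 1 + 1 / (1 + (L2_norm v)\<^sup>2)"
    using pos by (simp add: s_def field_simps)
  moreover have "0 < 1 / (1 + (L2_norm v)\<^sup>2)" using pos by simp
  ultimately have "2 + s * (L2_norm v)\<^sup>2 > 0" by linarith
  then have "s * (2 + s * (L2_norm v)\<^sup>2) < 0" using \<open>s < 0\<close> by (rule mult_neg_pos[rotated])
  with 1 show False by simp
qed

lemma L2_inner_P:
  assumes f: "f \<in> L2" and g: "g \<in> L2"
  shows "L2_inner (P k f) g = L2_inner f (P k g)" and "L2_inner (P k f) g = L2_inner (P k f) (P k g)"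
proof -
  have z: "L2_inner (P k u) (v - P k v) = 0" if "u \<in> L2" "v \<in> L2" for u v
    using that by (intro P_range_kernel_orthogonal[of _ k]) (auto simp: P_L2 P_P P_diff L2_diff)
  have 1: "L2_inner (P k u) v = L2_inner (P k u) (P k v)" if "u \<in> L2" "v \<in> L2" for u v
    using z[OF that] that by (simp add: L2_inner_diff_right P_L2)
  show "L2_inner (P k f) g = L2_inner (P k f) (P k g)" by (rule 1[OF f g])
  moreover have "L2_inner f (P k g) = L2_inner (P k f) (P k g)"
    using 1[OF g f] by (metis L2_inner_commute)
  ultimately show "L2_inner (P k f) g = L2_inner f (P k g)" by simp
qed

text \<open>The projection onto the functions that are constant on the balls of level j and have mean zero over
  the balls of level j + 1. These are the eigenspaces of every hierarchical Laplacian.\<close>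

definition Q :: "nat \<Rightarrow> ('a \<Rightarrow> complex) \<Rightarrow> 'a \<Rightarrow> complex" where
  "Q j f = P j f - P (Suc j) f"

lemma Q_add: "Q j (f + g) = Q j f + Q j g"
  by (simp add: Q_def P_add)

lemma Q_diff: "Q j (f - g) = Q j f - Q j g"
  by (simp add: Q_def P_diff)

lemma Q_fscale: "Q j (fscale c f) = fscale c (Q j f)"
  by (simp add: Q_def P_fscale fun_vs.scale_right_diff_distrib)

lemma Q_0: "Q j 0 = 0"
  using Q_diff[of j 0 0] by simp

lemma Q_L2: "f \<in> L2 \<Longrightarrow> Q j f \<in> L2"
  by (simp add: Q_def L2_diff P_L2)

lemma Q_Q: "Q j (Q k f) = (if j = k then Q k f else 0)"
proof -
  consider "j < k" | "j = k" | "k < j" by linarith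
  then show ?thesis
  proof cases
    case 1
    then have "max j k = k" "max j (Suc k) = Suc k" "max (Suc j) k = k" "max (Suc j) (Suc k) = Suc k" by auto
    then show ?thesis using 1 by (simp add: Q_def P_diff P_P)
  next
    case 2
    then show ?thesis by (simp add: Q_def P_diff P_P)
  next
    case 3
    then have "max j k = j" "max j (Suc k) = j" "max (Suc j) k = Suc j" "max (Suc j) (Suc k) = Suc j" by auto
    then show ?thesis using 3 by (simp add: Q_def P_diff P_P)
  qed
qed

lemma L2_inner_Q: "f \<in> L2 \<Longrightarrow> g \<in> L2 \<Longrightarrow> L2_inner (Q j f) g = L2_inner f (Q j g)"
  by (simp add: Q_def L2_inner_diff_left L2_inner_diff_right P_L2 L2_inner_P(1))

lemma Q_sums: "f \<in> L2 \<Longrightarrow> (\<lambda>j. Q j f x) sums f x"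
  using telescope_sums'[OF P_tendsto_0[of f x]] by (simp add: Q_def P_0)

text \<open>The components add up to the function pointwise, by a telescoping sum.\<close>

lemma Q_eqI:
  assumes "f \<in> L2" "g \<in> L2" "\<And>j. Q j f = Q j g"
  shows "f = g"
proof (rule ext)
  show "f x = g x" for x
    using Q_sums[OF assms(1), of x] Q_sums[OF assms(2), of x] assms(3) by (simp add: sums_unique2)
qed

lemma P_delta: "P k (delta a) x = (if a \<in> B x k then 1 / of_nat (ball_card k) else 0)"
  using finite_B[of x k] by (auto simp: P_def delta_def)

text \<open>The mass that the spectral measure of \<open>delta a\<close> gives to the j-th eigenvalue.\<close>

definition weight :: "nat \<Rightarrow> real" where "weight j = 1 / ball_card j - 1 / ball_card (Suc j)"

lemma Q_delta_self: "Q j (delta a) a = of_real (weight j)"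
  by (simp add: Q_def P_delta self_in_B weight_def)

lemma weight_pos: "0 < weight j"
  using ball_card_less_Suc[of j] ball_card_pos[of j] by (simp add: weight_def frac_less2)

lemma weight_sums: "weight sums 1"
proof -
  have "(\<lambda>j. of_real (weight j) :: complex) sums of_real 1"
    using Q_sums[OF delta_in_L2, of undefined undefined] unfolding Q_delta_self by (simp add: delta_def)
  then show ?thesis by (simp only: sums_of_real_iff)
qed

section \<open>Multipliers\<close>

definition bounded_variation :: "(nat \<Rightarrow> complex) \<Rightarrow> bool" where
  "bounded_variation m \<longleftrightarrow> summable (\<lambda>k. cmod (m (Suc k) - m k))"

text \<open>The sum of \<open>m j * Q j f x\<close> over j, rewritten by summation by parts. In this form the series converges
  absolutely, also when m does not tend to 0.\<close>

definition multiplier :: "(nat \<Rightarrow> complex) \<Rightarrow> ('a \<Rightarrow> complex) \<Rightarrow> 'a \<Rightarrow> complex" where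
  "multiplier m f x = m 0 * f x + (\<Sum>k. (m (Suc k) - m k) * P (Suc k) f x)"

context
  fixes m :: "nat \<Rightarrow> complex" and f :: "'a \<Rightarrow> complex"
  assumes m: "bounded_variation m" and f: "f \<in> L2"
begin

private lemma series_facts:
  "(\<lambda>x. \<Sum>k. (m (Suc k) - m k) * P (Suc k) f x) \<in> L2"
  "L2_norm (\<lambda>x. \<Sum>k. (m (Suc k) - m k) * P (Suc k) f x) \<le> (\<Sum>k. cmod (m (Suc k) - m k)) * L2_norm f"
  "summable (\<lambda>k. (m (Suc k) - m k) * P (Suc k) f x)"
  "g \<in> L2 \<Longrightarrow> (\<lambda>k. (m (Suc k) - m k) * L2_inner (P (Suc k) f) g) sums
     L2_inner (\<lambda>x. \<Sum>k. (m (Suc k) - m k) * P (Suc k) f x) g"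
proof -
  note facts = P_L2[OF f] L2_norm_P_le[OF f] m[unfolded bounded_variation_def]
  show "(\<lambda>x. \<Sum>k. (m (Suc k) - m k) * P (Suc k) f x) \<in> L2"
    by (rule L2_series[where u = "\<lambda>k. P (Suc k) f", OF facts])
  show "L2_norm (\<lambda>x. \<Sum>k. (m (Suc k) - m k) * P (Suc k) f x) \<le> (\<Sum>k. cmod (m (Suc k) - m k)) * L2_norm f"
    by (rule L2_norm_series_le[where u = "\<lambda>k. P (Suc k) f", OF facts])
  show "summable (\<lambda>k. (m (Suc k) - m k) * P (Suc k) f x)"
    by (rule L2_series_summable[where u = "\<lambda>k. P (Suc k) f", OF facts])
  show "(\<lambda>k. (m (Suc k) - m k) * L2_inner (P (Suc k) f) g) sums
     L2_inner (\<lambda>x. \<Sum>k. (m (Suc k) - m k) * P (Suc k) f x) g" if "g \<in> L2"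
    by (rule L2_inner_series[where u = "\<lambda>k. P (Suc k) f", OF facts that])
qed

private lemma multiplier_eq: "multiplier m f = fscale (m 0) f + (\<lambda>x. \<Sum>k. (m (Suc k) - m k) * P (Suc k) f x)"
  by (simp add: multiplier_def fun_eq_iff fscale_def)

lemma multiplier_L2: "multiplier m f \<in> L2"
  unfolding multiplier_eq by (intro L2_add L2_fscale f series_facts)

lemma L2_norm_multiplier_le: "L2_norm (multiplier m f) \<le> (cmod (m 0) + (\<Sum>k. cmod (m (Suc k) - m k))) * L2_norm f"
proof -
  have "L2_norm (multiplier m f) \<le> L2_norm (fscale (m 0) f) +
      L2_norm (\<lambda>x. \<Sum>k. (m (Suc k) - m k) * P (Suc k) f x)"
    unfolding multiplier_eq by (intro L2_norm_triangle L2_fscale f series_facts)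
  then show ?thesis using series_facts(2) by (simp add: L2_norm_fscale f distrib_right)
qed

lemma L2_inner_multiplier:
  assumes g: "g \<in> L2"
  shows "(\<lambda>k. (m (Suc k) - m k) * L2_inner (P (Suc k) f) g) sums (L2_inner (multiplier m f) g - m 0 * L2_inner f g)"
  using series_facts(4)[OF g] unfolding multiplier_eq
  by (simp add: L2_inner_add_left L2_fscale f series_facts g L2_inner_fscale_left)

lemma P_multiplier: "(\<lambda>k. (m (Suc k) - m k) * P (max j (Suc k)) f x) sums (P j (multiplier m f) x - m 0 * P j f x)"
proof -
  have "(\<lambda>k. (m (Suc k) - m k) * P (Suc k) f y) sums (\<Sum>k. (m (Suc k) - m k) * P (Suc k) f y)" for y
    by (rule summable_sums[OF series_facts(3)])
  then have "(\<lambda>k. (\<Sum>y\<in>B x j. (m (Suc k) - m k) * P (Suc k) f y) / of_nat (ball_card j)) sums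
      ((\<Sum>y\<in>B x j. \<Sum>k. (m (Suc k) - m k) * P (Suc k) f y) / of_nat (ball_card j))"
    by (intro sums_divide sums_sum)
  moreover have "(\<Sum>y\<in>B x j. (m (Suc k) - m k) * P (Suc k) f y) / of_nat (ball_card j) =
      (m (Suc k) - m k) * P (max j (Suc k)) f x" for k
    unfolding P_P[symmetric] P_def[of j] by (simp add: sum_distrib_left)
  moreover have "(\<Sum>y\<in>B x j. \<Sum>k. (m (Suc k) - m k) * P (Suc k) f y) / of_nat (ball_card j) =
      P j (multiplier m f) x - m 0 * P j f x"
    by (simp add: P_def[of j] multiplier_def sum.distrib sum_distrib_left add_divide_distrib)
  ultimately show ?thesis by simp
qed

text \<open>The component Q j annihilates what P (k + 1) contributes for k \<ge> j and is not changed by P (k + 1)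
  for k < j, so that the increments of m up to j add up to m j.\<close>

lemma Q_multiplier: "Q j (multiplier m f) = fscale (m j) (Q j f)"
proof (rule ext)
  fix x
  have "(\<lambda>k. (m (Suc k) - m k) * (P (max j (Suc k)) f x - P (max (Suc j) (Suc k)) f x)) sums
     (Q j (multiplier m f) x - m 0 * Q j f x)"
    using sums_diff[OF P_multiplier[of j x] P_multiplier[of "Suc j" x]]
    by (simp add: Q_def algebra_simps)
  moreover have "(\<lambda>k. (m (Suc k) - m k) * (P (max j (Suc k)) f x - P (max (Suc j) (Suc k)) f x)) =
      (\<lambda>k. if k \<in> {..<j} then (m (Suc k) - m k) * Q j f x else 0)"
  proof (rule ext)
    fix k
    show "(m (Suc k) - m k) * (P (max j (Suc k)) f x - P (max (Suc j) (Suc k)) f x) =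
        (if k \<in> {..<j} then (m (Suc k) - m k) * Q j f x else 0)"
    proof (cases "k < j")
      case True
      then have "max j (Suc k) = j" "max (Suc j) (Suc k) = Suc j" by auto
      then show ?thesis using True by (simp add: Q_def)
    next
      case False
      then have "max j (Suc k) = Suc k" "max (Suc j) (Suc k) = Suc k" by auto
      then show ?thesis using False by simp
    qed
  qed
  ultimately have "(\<lambda>k. if k \<in> {..<j} then (m (Suc k) - m k) * Q j f x else 0) sums
      (Q j (multiplier m f) x - m 0 * Q j f x)" by simp
  then have "Q j (multiplier m f) x - m 0 * Q j f x = (\<Sum>k<j. (m (Suc k) - m k) * Q j f x)"
    by (rule sums_unique2[OF _ sums_If_finite_set]) simp
  also have "\<dots> = (m j - m 0) * Q j f x"
    by (simp add: sum_distrib_right[symmetric] sum_lessThan_telescope)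
  finally show "Q j (multiplier m f) x = fscale (m j) (Q j f) x"
    by (simp add: fscale_def algebra_simps)
qed

lemma multiplier_sums: "(\<lambda>j. m j * Q j f x) sums multiplier m f x"
  using Q_sums[OF multiplier_L2, of x] by (simp add: Q_multiplier fscale_def)

lemma multiplier_eqI: "g \<in> L2 \<Longrightarrow> (\<And>j. Q j g = fscale (m j) (Q j f)) \<Longrightarrow> g = multiplier m f"
  by (rule Q_eqI) (simp_all add: multiplier_L2 Q_multiplier)

end

lemma bounded_variation_of_decreasing:
  assumes "decseq (m :: nat \<Rightarrow> real)" "\<And>k. 0 \<le> m k"
  shows "bounded_variation (\<lambda>k. of_real (m k))"
proof -
  obtain l where "m \<longlonglongrightarrow> l"
    by (rule decseq_convergent[OF assms(1), of 0]) (auto simp: assms(2))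
  then have "summable (\<lambda>k. m k - m (Suc k))" by (rule sums_summable[OF telescope_sums'])
  moreover have "cmod (of_real (m (Suc k)) - of_real (m k)) = m k - m (Suc k)" for k
    using decseq_SucD[OF assms(1), of k] unfolding of_real_diff[symmetric] norm_of_real by linarith
  ultimately show ?thesis by (simp add: bounded_variation_def)
qed

text \<open>The form is \<open>m 0 \<parallel>f\<parallel>\<^sup>2\<close> minus the sum of \<open>(m k - m (k + 1)) \<parallel>P (k + 1) f\<parallel>\<^sup>2\<close>. The terms of this sum
  are nonnegative and at most \<open>(m k - m (k + 1)) \<parallel>f\<parallel>\<^sup>2\<close>, and the latter telescope.\<close>

lemma L2_inner_multiplier_decreasing:
  assumes m: "decseq (m :: nat \<Rightarrow> real)" "\<And>k. 0 \<le> m k" and f: "f \<in> L2"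
  shows "0 \<le> Re (L2_inner (multiplier (\<lambda>k. of_real (m k)) f) f)"
    and "Re (L2_inner (multiplier (\<lambda>k. of_real (m k)) f) f) \<le> m 0 * (L2_norm f)\<^sup>2"
proof -
  define I where "I = Re (L2_inner (multiplier (\<lambda>k. of_real (m k)) f) f)"
  have Pf: "L2_inner (P k f) f = of_real ((L2_norm (P k f))\<^sup>2)" for k
    using L2_inner_P(2)[OF f f] by (simp only: L2_inner_self)
  have "(\<lambda>k. (m k - m (Suc k)) * (L2_norm (P (Suc k) f))\<^sup>2) sums (m 0 * (L2_norm f)\<^sup>2 - I)"
    using sums_minus[OF sums_Re[OF L2_inner_multiplier[OF bounded_variation_of_decreasing[OF m] f f]]]
    by (simp add: I_def Pf L2_inner_self algebra_simps del: of_real_power)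
  note sums = this
  have d: "0 \<le> m k - m (Suc k)" for k using decseq_SucD[OF m(1), of k] by simp
  from sums_le[OF _ sums_zero sums] d have "0 \<le> m 0 * (L2_norm f)\<^sup>2 - I" by simp
  then show "Re (L2_inner (multiplier (\<lambda>k. of_real (m k)) f) f) \<le> m 0 * (L2_norm f)\<^sup>2"
    by (simp add: I_def)
  obtain l where l: "m \<longlonglongrightarrow> l"
    by (rule decseq_convergent[OF m(1), of 0]) (auto simp: m(2))
  have "0 \<le> l" by (rule LIMSEQ_le_const[OF l]) (auto simp: m)
  have "(\<lambda>k. (m k - m (Suc k)) * (L2_norm f)\<^sup>2) sums ((m 0 - l) * (L2_norm f)\<^sup>2)"
    by (rule sums_mult2[OF telescope_sums'[OF l]])
  from sums_le[OF _ sums this] have "m 0 * (L2_norm f)\<^sup>2 - I \<le> (m 0 - l) * (L2_norm f)\<^sup>2"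
    using d power_mono[OF L2_norm_P_le[OF f] L2_norm_nonneg, of _ 2] by (simp add: mult_left_mono)
  then have "l * (L2_norm f)\<^sup>2 \<le> I" by (simp add: algebra_simps)
  moreover have "0 \<le> l * (L2_norm f)\<^sup>2" using \<open>0 \<le> l\<close> by simp
  ultimately show "0 \<le> Re (L2_inner (multiplier (\<lambda>k. of_real (m k)) f) f)"
    unfolding I_def by linarith
qed

lemma L2_inner_multiplier_symmetric:
  assumes m: "bounded_variation m" "\<And>k. m k \<in> \<real>" and f: "f \<in> L2" and g: "g \<in> L2"
  shows "L2_inner (multiplier m f) g = L2_inner f (multiplier m g)"
proof -
  have cm: "cnj (m k) = m k" for k using m(2) by (simp add: Reals_cnj_iff)
  have "(\<lambda>k. cnj ((m (Suc k) - m k) * L2_inner (P (Suc k) g) f)) sums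
      cnj (L2_inner (multiplier m g) f - m 0 * L2_inner g f)"
    using L2_inner_multiplier[OF m(1) g f] by (simp only: sums_cnj)
  moreover have "cnj ((m (Suc k) - m k) * L2_inner (P (Suc k) g) f) =
      (m (Suc k) - m k) * L2_inner (P (Suc k) f) g" for k
    by (simp add: cm L2_inner_P(1) f g L2_inner_commute[symmetric])
  moreover have "cnj (L2_inner (multiplier m g) f - m 0 * L2_inner g f) = L2_inner f (multiplier m g) - m 0 * L2_inner f g"
    by (simp add: cm L2_inner_commute[symmetric])
  ultimately have "(\<lambda>k. (m (Suc k) - m k) * L2_inner (P (Suc k) f) g) sums
     (L2_inner f (multiplier m g) - m 0 * L2_inner f g)" by simp
  from sums_unique2[OF this L2_inner_multiplier[OF m(1) f g]] show ?thesis by simp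
qed

end

section \<open>Hierarchical operators and their resolvents\<close>

lemma tendsto_nonzero_bounded_away:
  fixes u :: "nat \<Rightarrow> complex"
  assumes "u \<longlonglongrightarrow> l" "l \<noteq> 0" "\<And>j. u j \<noteq> 0"
  obtains d where "0 < d" "\<And>j. d \<le> cmod (u j)"
proof -
  have "Bseq (\<lambda>j. inverse (u j))"
    by (rule convergent_imp_Bseq) (use tendsto_inverse[OF assms(1,2)] in \<open>auto simp: convergent_def\<close>)
  then obtain K where K: "0 < K" "\<And>j. cmod (inverse (u j)) \<le> K" by (auto elim: BseqE)
  have "1 / K \<le> cmod (u j)" for j
    using K(2)[of j] assms(3)[of j] K(1) by (simp add: norm_inverse norm_divide field_simps)
  with K(1) show ?thesis using that[of "1 / K"] by simp
qed

text \<open>The eigenvalues are indexed from 0, so \<open>ev k\<close> belongs to the balls of level k + 1. The operator is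
  prescribed on L2 only, because the series that defines a Laplacian need not converge elsewhere.\<close>

locale hierarchical_operator = homogeneous_hierarchy B
  for B :: "'a \<Rightarrow> nat \<Rightarrow> 'a set" +
  fixes L :: "('a \<Rightarrow> complex) \<Rightarrow> 'a \<Rightarrow> complex" and ev :: "nat \<Rightarrow> real"
  assumes L_eq_multiplier: "f \<in> L2 \<Longrightarrow> L f = multiplier (\<lambda>k. of_real (ev k)) f"
    and ev_Suc_less: "ev (Suc k) < ev k"
    and ev_tendsto_0: "ev \<longlonglongrightarrow> 0"
begin

lemma ev_decseq: "decseq ev"
  using ev_Suc_less by (auto simp: decseq_Suc_iff intro: less_imp_le)

lemma ev_less: "j < k \<Longrightarrow> ev k < ev j"
  using lift_Suc_mono_less[of "\<lambda>k. - ev k" j k] ev_Suc_less by simp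

lemma ev_pos: "0 < ev k"
  using decseq_ge[OF ev_decseq ev_tendsto_0, of "Suc k"] ev_Suc_less[of k] by linarith

lemma ev_eq_iff [simp]: "ev j = ev k \<longleftrightarrow> j = k"
  using ev_less[of j k] ev_less[of k j] by (cases j k rule: linorder_cases) auto

lemma bounded_variation_ev: "bounded_variation (\<lambda>k. of_real (ev k))"
  using bounded_variation_of_decreasing[OF ev_decseq] ev_pos less_imp_le by blast

lemma L_L2: "f \<in> L2 \<Longrightarrow> L f \<in> L2"
  by (simp add: L_eq_multiplier multiplier_L2 bounded_variation_ev)

lemma Q_L: "f \<in> L2 \<Longrightarrow> Q j (L f) = fscale (of_real (ev j)) (Q j f)"
  by (simp add: L_eq_multiplier Q_multiplier bounded_variation_ev)

lemma L_add: "f \<in> L2 \<Longrightarrow> g \<in> L2 \<Longrightarrow> L (f + g) = L f + L g"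
  by (rule Q_eqI) (simp_all add: L2_add L_L2 Q_L Q_add fun_vs.scale_right_distrib)

lemma L_fscale: "f \<in> L2 \<Longrightarrow> L (fscale c f) = fscale c (L f)"
  by (rule Q_eqI) (simp_all add: L2_fscale L_L2 Q_L Q_fscale mult.commute)

lemma L2_inner_L: "f \<in> L2 \<Longrightarrow> g \<in> L2 \<Longrightarrow> L2_inner (L f) g = L2_inner f (L g)"
  by (simp add: L_eq_multiplier L2_inner_multiplier_symmetric bounded_variation_ev)

text \<open>The complement of the spectrum of L.\<close>

definition regular :: "complex \<Rightarrow> bool" where
  "regular z \<longleftrightarrow> z \<noteq> 0 \<and> (\<forall>j. of_real (ev j) \<noteq> z)"

lemma regular_gap:
  assumes "regular z"
  obtains d where "0 < d" "\<And>j. d \<le> cmod (of_real (ev j) - z)"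
proof -
  have "(\<lambda>j. of_real (ev j) - z) \<longlonglongrightarrow> of_real 0 - z"
    by (intro tendsto_intros ev_tendsto_0)
  moreover have "of_real 0 - z \<noteq> 0" "\<And>j. of_real (ev j) - z \<noteq> 0"
    using assms by (auto simp: regular_def)
  ultimately show ?thesis using tendsto_nonzero_bounded_away that by blast
qed

text \<open>Since z has positive distance from the eigenvalues, the increments of \<open>1 / (ev j - z)\<close> are bounded by
  a multiple of the increments of \<open>ev\<close>.\<close>

lemma bounded_variation_resolvent:
  assumes z: "regular z"
  shows "bounded_variation (\<lambda>j. 1 / (of_real (ev j) - z))"
proof -
  obtain d where d: "0 < d" "\<And>j. d \<le> cmod (of_real (ev j) - z)" using regular_gap[OF z] by blast
  have nz: "of_real (ev j) - z \<noteq> 0" for j using z by (auto simp: regular_def)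
  have "summable (\<lambda>k. ev k - ev (Suc k))"
    by (rule sums_summable[OF telescope_sums'[OF ev_tendsto_0]])
  then have "summable (\<lambda>k. (ev k - ev (Suc k)) / d\<^sup>2)" by (rule summable_divide)
  then show ?thesis unfolding bounded_variation_def
  proof (rule summable_comparison_test')
    fix k :: nat
    have "1 / (of_real (ev (Suc k)) - z) - 1 / (of_real (ev k) - z) =
      of_real (ev k - ev (Suc k)) / ((of_real (ev (Suc k)) - z) * (of_real (ev k) - z))"
      using nz[of k] nz[of "Suc k"] by (simp add: field_simps)
    then have "cmod (1 / (of_real (ev (Suc k)) - z) - 1 / (of_real (ev k) - z)) =
      (ev k - ev (Suc k)) / (cmod (of_real (ev (Suc k)) - z) * cmod (of_real (ev k) - z))"
      using ev_Suc_less[of k] by (simp add: norm_divide norm_mult norm_of_real del: of_real_diff)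
    also have "\<dots> \<le> (ev k - ev (Suc k)) / d\<^sup>2"
      using ev_Suc_less[of k] d unfolding power2_eq_square
      by (intro divide_left_mono mult_mono mult_pos_pos; (insert nz[of k] nz[of "Suc k"], auto intro: less_imp_le)?)
    finally show "norm (cmod (1 / (of_real (ev (Suc k)) - z) - 1 / (of_real (ev k) - z))) \<le> (ev k - ev (Suc k)) / d\<^sup>2"
      by simp
  qed
qed

definition R :: "complex \<Rightarrow> ('a \<Rightarrow> complex) \<Rightarrow> 'a \<Rightarrow> complex" where
  "R z = multiplier (\<lambda>j. 1 / (of_real (ev j) - z))"

lemma R_L2: "regular z \<Longrightarrow> f \<in> L2 \<Longrightarrow> R z f \<in> L2"
  by (simp add: R_def multiplier_L2 bounded_variation_resolvent)

lemma Q_R: "regular z \<Longrightarrow> f \<in> L2 \<Longrightarrow> Q j (R z f) = fscale (1 / (of_real (ev j) - z)) (Q j f)"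
  by (simp add: R_def Q_multiplier bounded_variation_resolvent)

lemma resolvent_equation_iff:
  assumes z: "regular z" and f: "f \<in> L2" and h: "h \<in> L2"
  shows "L f - fscale z f = h \<longleftrightarrow> f = R z h"
proof -
  have nz: "of_real (ev j) - z \<noteq> 0" for j using z by (auto simp: regular_def)
  have Qf: "Q j (L f - fscale z f) = fscale (of_real (ev j) - z) (Q j f)" for j
    by (simp add: Q_diff Q_L f Q_fscale fun_vs.scale_left_diff_distrib)
  have "L f - fscale z f = h \<longleftrightarrow> (\<forall>j. Q j (L f - fscale z f) = Q j h)"
    using Q_eqI[of "L f - fscale z f" h] by (auto simp: L2_diff L_L2 L2_fscale f h)
  also have "\<dots> \<longleftrightarrow> (\<forall>j. Q j f = Q j (R z h))"
  proof (rule all_cong1)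
    fix j
    have "(c * u = v) = (u = 1 / c * v)" if "c \<noteq> 0" for c u v :: complex
      using that by (auto simp: field_simps)
    then show "(Q j (L f - fscale z f) = Q j h) = (Q j f = Q j (R z h))"
      unfolding Qf Q_R[OF z h] using nz[of j] by (simp add: fscale_def fun_eq_iff)
  qed
  also have "\<dots> \<longleftrightarrow> f = R z h"
    using Q_eqI[OF f R_L2[OF z h]] by auto
  finally show ?thesis .
qed

lemma R_fscale: "regular z \<Longrightarrow> f \<in> L2 \<Longrightarrow> R z (fscale c f) = fscale c (R z f)"
  by (rule Q_eqI) (simp_all add: L2_fscale R_L2 Q_R Q_fscale mult.commute)

lemma R_add: "regular z \<Longrightarrow> f \<in> L2 \<Longrightarrow> g \<in> L2 \<Longrightarrow> R z (f + g) = R z f + R z g"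
  by (rule Q_eqI) (simp_all add: L2_add R_L2 Q_R Q_add fun_vs.scale_right_distrib)

lemma R_bounded:
  assumes "regular z"
  obtains M where "0 \<le> M" "\<And>f. f \<in> L2 \<Longrightarrow> L2_norm (R z f) \<le> M * L2_norm f"
proof -
  define m where "m j = 1 / (of_real (ev j) - z)" for j
  have m: "bounded_variation m" unfolding m_def by (rule bounded_variation_resolvent[OF assms])
  show ?thesis
  proof (rule that)
    show "0 \<le> cmod (m 0) + (\<Sum>k. cmod (m (Suc k) - m k))"
      using m by (intro add_nonneg_nonneg suminf_nonneg) (auto simp: bounded_variation_def)
    show "L2_norm (R z f) \<le> (cmod (m 0) + (\<Sum>k. cmod (m (Suc k) - m k))) * L2_norm f" if "f \<in> L2" for f
      using L2_norm_multiplier_le[OF m that] by (simp add: R_def m_def[abs_def])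
  qed
qed

lemma R_delta_sums:
  assumes "regular z"
  shows "(\<lambda>j. of_real (weight j) / (of_real (ev j) - z)) sums R z (delta a) a"
  using multiplier_sums[OF bounded_variation_resolvent[OF assms] delta_in_L2, of a a]
  by (simp add: R_def Q_delta_self)

text \<open>If the support of \<open>\<psi> = R z (delta a)\<close> were finite, the sum of \<open>\<psi>\<close> over the ball of level k around a
  would be a constant S for large k, and the k-th component of \<open>\<psi>\<close> at a would be \<open>S * weight k\<close>. It is
  \<open>weight k / (ev k - z)\<close>, so the eigenvalues would be eventually constant.\<close>

lemma infinite_support_R_delta:
  assumes z: "regular z"
  shows "infinite {x. R z (delta a) x \<noteq> 0}"
proof
  define \<psi> where "\<psi> = R z (delta a)"
  assume "finite {x. R z (delta a) x \<noteq> 0}"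
  then have fin: "finite ({x. \<psi> x \<noteq> 0} \<inter> (\<Union>k. B a k))" by (simp add: \<psi>_def)
  define A where "A = {x. \<psi> x \<noteq> 0} \<inter> (\<Union>k. B a k)"
  define \<kappa> where "\<kappa> x = (SOME k. x \<in> B a k)" for x
  have \<kappa>: "x \<in> B a (\<kappa> x)" if "x \<in> A" for x
    unfolding \<kappa>_def by (rule someI_ex) (use that in \<open>auto simp: A_def\<close>)
  obtain K where K': "\<And>x. x \<in> A \<Longrightarrow> \<kappa> x \<le> K"
    using fin finite_nat_set_iff_bounded_le[of "\<kappa> ` A"] by (auto simp: A_def)
  have K: "x \<in> B a K" if "x \<in> A" for x
    using \<kappa>[OF that] B_mono[OF K'[OF that], of a] by blast
  define S where "S = (\<Sum>y\<in>B a K. \<psi> y)"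
  have S: "(\<Sum>y\<in>B a k. \<psi> y) = S" if "K \<le> k" for k
    unfolding S_def using K B_mono[OF that, of a]
    by (intro sum.mono_neutral_right finite_B) (auto simp: A_def)
  have Q1: "Q k \<psi> a = S * of_real (weight k)" if "K \<le> k" for k
    using S[OF that] S[of "Suc k"] that by (simp add: Q_def P_def weight_def algebra_simps)
  have Q2: "Q k \<psi> a = of_real (weight k) / (of_real (ev k) - z)" for k
    by (simp add: \<psi>_def Q_R z fscale_def Q_delta_self)
  have inv: "1 / (of_real (ev k) - z) = S" if "K \<le> k" for k
  proof -
    have "of_real (weight k) / (of_real (ev k) - z) = S * of_real (weight k)"
      using Q1[OF that] Q2[of k] by simp
    then show ?thesis using weight_pos[of k] by (simp add: divide_inverse)
  qed
  have nz: "of_real (ev j) - z \<noteq> 0" for j using z by (auto simp: regular_def)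
  have "1 / (of_real (ev K) - z) = 1 / (of_real (ev (Suc K)) - z)"
    using inv[of K] inv[of "Suc K"] by simp
  then have "complex_of_real (ev K) = of_real (ev (Suc K))"
    using nz[of K] nz[of "Suc K"] by (simp add: field_simps)
  then show False using ev_Suc_less[of K] by simp
qed

end

section \<open>Perturbation of rank one\<close>

locale rank_one_perturbation = hierarchical_operator B L ev
  for B :: "'a \<Rightarrow> nat \<Rightarrow> 'a set" and L ev +
  fixes a :: 'a and \<sigma> :: real and H :: "('a \<Rightarrow> complex) \<Rightarrow> 'a \<Rightarrow> complex"
  assumes H_def: "H f = (\<lambda>x. L f x - of_real \<sigma> * f a * delta a x)"
    and \<sigma>_nonzero: "\<sigma> \<noteq> 0"
begin

lemma H_eq: "H f = L f - fscale (of_real \<sigma> * f a) (delta a)"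
  by (simp add: H_def fscale_def fun_eq_iff)

lemma H_L2: "f \<in> L2 \<Longrightarrow> H f \<in> L2"
  by (simp add: H_eq L2_diff L_L2 L2_fscale)

lemma Q_H:
  "f \<in> L2 \<Longrightarrow> Q j (H f) = fscale (of_real (ev j)) (Q j f) - fscale (of_real \<sigma> * f a) (Q j (delta a))"
  by (simp add: H_eq Q_diff Q_L Q_fscale)

lemma L2_inner_H:
  assumes "f \<in> L2" "g \<in> L2"
  shows "L2_inner (H f) g = L2_inner (L f) g - of_real \<sigma> * f a * cnj (g a)"
proof -
  have "L2_inner (delta a) g = cnj (g a)" by (subst L2_inner_commute) (simp add: L2_inner_delta)
  then show ?thesis
    by (simp add: H_eq L2_inner_diff_left L_L2 L2_fscale assms L2_inner_fscale_left)
qed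

lemma symmetric_H: "symmetric_on_L2 H"
  unfolding symmetric_on_L2_def
proof (intro conjI ballI allI)
  fix f g :: "'a \<Rightarrow> complex" assume f: "f \<in> L2" and g: "g \<in> L2"
  have "L2_inner f (H g) = cnj (L2_inner (L g) f - of_real \<sigma> * g a * cnj (f a))"
    using L2_inner_H[OF g f] by (metis L2_inner_commute)
  also have "\<dots> = L2_inner f (L g) - of_real \<sigma> * f a * cnj (g a)"
    by (simp add: L2_inner_commute[symmetric])
  finally show "L2_inner (H f) g = L2_inner f (H g)"
    by (simp add: L2_inner_H f g L2_inner_L)
  show "H (f + g) = H f + H g"
    by (simp add: H_eq L_add f g distrib_left fun_vs.scale_left_distrib)
next
  fix f :: "'a \<Rightarrow> complex" and c assume f: "f \<in> L2"
  show "H (fscale c f) = fscale c (H f)"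
    by (simp add: H_eq L_fscale f fun_vs.scale_right_diff_distrib) (simp add: fscale_def mult_ac)
qed (simp add: H_L2)

lemma eigenspace_H_iff:
  assumes "f \<in> L2"
  shows "f \<in> eigenspace H z \<longleftrightarrow>
    (\<forall>j. fscale (of_real (ev j) - z) (Q j f) = fscale (of_real \<sigma> * f a) (Q j (delta a)))"
proof -
  have "f \<in> eigenspace H z \<longleftrightarrow> (\<forall>j. Q j (H f) = Q j (fscale z f))"
    using Q_eqI[of "H f" "fscale z f"] assms by (auto simp: eigenspace_def H_L2 L2_fscale)
  also have "\<dots> \<longleftrightarrow> (\<forall>j. fscale (of_real (ev j) - z) (Q j f) = fscale (of_real \<sigma> * f a) (Q j (delta a)))"
    unfolding Q_H[OF assms] Q_fscale fun_vs.scale_left_diff_distrib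
    by (intro all_cong1) (auto simp: algebra_simps)
  finally show ?thesis .
qed

lemma eigenvector_determined_by_value:
  assumes "f \<in> eigenspace H z" "f a = 0" "\<And>j. of_real (ev j) \<noteq> z"
  shows "f = 0"
proof (rule Q_eqI)
  show f: "f \<in> L2" using assms(1) by (simp add: eigenspace_def)
  show "Q j f = Q j 0" for j
  proof -
    have "fscale (of_real (ev j) - z) (Q j f) = 0"
      using assms(1,2) by (simp add: eigenspace_H_iff[OF f])
    then show ?thesis using assms(3)[of j] by (simp add: fun_vs.scale_eq_0_iff Q_0)
  qed
qed simp

lemma eigenspace_L_ev:
  "eigenspace L (of_real (ev k)) = {f \<in> L2. \<forall>j. j \<noteq> k \<longrightarrow> Q j f = 0}"
proof -
  have "L f = fscale (of_real (ev k)) f \<longleftrightarrow> (\<forall>j. j \<noteq> k \<longrightarrow> Q j f = 0)" if f: "f \<in> L2" for f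
  proof -
    have "L f = fscale (of_real (ev k)) f \<longleftrightarrow> (\<forall>j. Q j (L f) = Q j (fscale (of_real (ev k)) f))"
      using Q_eqI[of "L f" "fscale (of_real (ev k)) f"] f by (auto simp: L_L2 L2_fscale)
    also have "\<dots> \<longleftrightarrow> (\<forall>j. fscale (of_real (ev j) - of_real (ev k)) (Q j f) = 0)"
      by (simp add: Q_L f Q_fscale fun_vs.scale_left_diff_distrib)
    also have "\<dots> \<longleftrightarrow> (\<forall>j. j \<noteq> k \<longrightarrow> Q j f = 0)"
      by (auto simp: fun_vs.scale_eq_0_iff)
    finally show ?thesis .
  qed
  then show ?thesis by (auto simp: eigenspace_def)
qed

text \<open>The k-th component of the eigenvalue equation, evaluated at a, says \<open>\<sigma> * f a * weight k = 0\<close>. So f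
  vanishes at a, and there the perturbation has no effect.\<close>

lemma eigenspace_H_ev:
  "eigenspace H (of_real (ev k)) = {f \<in> eigenspace L (of_real (ev k)). f a = 0}"
proof (intro set_eqI iffI)
  fix f assume f: "f \<in> eigenspace H (of_real (ev k))"
  then have fL: "f \<in> L2" by (simp add: eigenspace_def)
  have eq: "fscale (of_real (ev j) - of_real (ev k)) (Q j f) = fscale (of_real \<sigma> * f a) (Q j (delta a))" for j
    using f eigenspace_H_iff[OF fL] by blast
  from fun_cong[OF eq[of k], of a] have "f a = 0"
    using weight_pos[of k] \<sigma>_nonzero by (auto simp: fscale_def Q_delta_self)
  moreover have "Q j f = 0" if "j \<noteq> k" for j
    using eq[of j] that \<open>f a = 0\<close> by (simp add: fun_vs.scale_eq_0_iff)
  ultimately show "f \<in> {f \<in> eigenspace L (of_real (ev k)). f a = 0}"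
    using fL by (simp add: eigenspace_L_ev)
next
  fix f assume "f \<in> {f \<in> eigenspace L (of_real (ev k)). f a = 0}"
  then show "f \<in> eigenspace H (of_real (ev k))" by (simp add: eigenspace_def H_eq)
qed

lemma eigenspace_H_ev_subspace: "fun_vs.subspace (eigenspace H (of_real (ev k)))"
  by (rule eigenspace_subspace[OF symmetric_H])

text \<open>The orthogonal projection onto the k-th eigenspace of H: from \<open>Q k f\<close> it removes the component along
  \<open>Q k (delta a)\<close>, which represents the evaluation at a on the range of \<open>Q k\<close>.\<close>

definition eigen_proj :: "nat \<Rightarrow> ('a \<Rightarrow> complex) \<Rightarrow> 'a \<Rightarrow> complex" where
  "eigen_proj k f = Q k f - fscale (Q k f a / of_real (weight k)) (Q k (delta a))"

lemma eigen_proj_L2: "f \<in> L2 \<Longrightarrow> eigen_proj k f \<in> L2"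
  by (simp add: eigen_proj_def L2_diff Q_L2 L2_fscale)

lemma eigen_proj_in_eigenspace: "f \<in> L2 \<Longrightarrow> eigen_proj k f \<in> eigenspace H (of_real (ev k))"
proof -
  assume f: "f \<in> L2"
  have "Q j (eigen_proj k f) = 0" if "j \<noteq> k" for j
    using that by (simp add: eigen_proj_def Q_diff Q_Q Q_fscale)
  moreover have "eigen_proj k f a = 0"
    using weight_pos[of k] by (simp add: eigen_proj_def fscale_def Q_delta_self)
  ultimately show ?thesis by (simp add: eigenspace_H_ev eigenspace_L_ev eigen_proj_L2 f)
qed

lemma Q_eq_self:
  assumes "f \<in> L2" "\<And>j. j \<noteq> k \<Longrightarrow> Q j f = 0"
  shows "Q k f = f"
  by (rule Q_eqI) (auto simp: Q_L2 assms Q_Q)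

lemma eigen_proj_eq_self: 
  assumes "f \<in> eigenspace H (of_real (ev k))"
  shows "eigen_proj k f = f"
proof -
  have "Q k f = f" "f a = 0"
    using assms Q_eq_self by (auto simp: eigenspace_H_ev eigenspace_L_ev)
  then show ?thesis by (simp add: eigen_proj_def)
qed

lemma L2_inner_eigen_proj:
  assumes "f \<in> L2" "g \<in> L2"
  shows "L2_inner (eigen_proj k f) g = L2_inner f (eigen_proj k g)"
proof -
  have "L2_inner (delta a) u = cnj (u a)" for u
    by (subst L2_inner_commute) (simp add: L2_inner_delta)
  then show ?thesis using assms
    by (simp add: eigen_proj_def L2_inner_diff_left L2_inner_diff_right Q_L2 L2_fscale L2_inner_fscale_left
        L2_inner_fscale_right L2_inner_Q L2_inner_Q[symmetric, of f "delta a"] L2_inner_delta mult.commute)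
qed

lemma orthogonal_to_eigen_proj_delta:
  assumes g: "g \<in> L2" and orth: "\<And>y. L2_inner g (eigen_proj k (delta y)) = 0"
  shows "eigen_proj k g = 0"
proof (rule ext)
  show "eigen_proj k g y = 0 y" for y
    using orth[of y] L2_inner_eigen_proj[OF g delta_in_L2, of k y] by (simp add: L2_inner_delta)
qed

lemma eigen_proj_delta_finite_support: "finite {x. eigen_proj k (delta y) x \<noteq> 0}"
proof (rule finite_subset)
  show "{x. eigen_proj k (delta y) x \<noteq> 0} \<subseteq> B y (Suc k) \<union> B a (Suc k)"
  proof (rule subsetI, rule ccontr)
    fix x assume x: "x \<in> {x. eigen_proj k (delta y) x \<noteq> 0}" "x \<notin> B y (Suc k) \<union> B a (Suc k)"
    have "Q k (delta u) x = 0" if "x \<notin> B u (Suc k)" for u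
      using that B_sym[of u x "Suc k"] B_mono[of k "Suc k" x] by (auto simp: Q_def P_delta)
    then have "eigen_proj k (delta y) x = 0" using x(2) by (simp add: eigen_proj_def fscale_def)
    then show False using x(1) by simp
  qed
qed (simp add: finite_B)

lemma infinite_UNIV_hierarchy: "infinite (UNIV :: 'a set)"
proof
  assume f: "finite (UNIV :: 'a set)"
  then have "ball_card (card (UNIV :: 'a set)) \<le> card (UNIV :: 'a set)"
    unfolding ball_card_def by (intro card_mono) auto
  then show False using ball_card_ge[of "card (UNIV :: 'a set)"] by simp
qed

text \<open>Every ball S of level k + 1 that does not contain a carries an eigenfunction \<open>Q k (delta (c S))\<close>,
  where c S is a point of S. There are infinitely many such balls, and they are disjoint.\<close>

lemma eig_mult_H_ev: "eig_mult H (of_real (ev k)) = \<infinity>"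
proof -
  have False if F: "finite F" "eigenspace H (of_real (ev k)) \<subseteq> fun_vs.span F" for F
  proof -
    define \<B> where "\<B> = range (\<lambda>x. B x (Suc k)) - {B a (Suc k)}"
    have inf: "infinite \<B>"
    proof
      assume "finite \<B>"
      then have "finite (range (\<lambda>x. B x (Suc k)))" by (simp add: \<B>_def)
      then have "finite (\<Union>(range (\<lambda>x. B x (Suc k))))" by (rule finite_Union) (auto simp: finite_B)
      moreover have "\<Union>(range (\<lambda>x. B x (Suc k))) = UNIV" using self_in_B by auto
      ultimately show False using infinite_UNIV_hierarchy by simp
    qed
    define c where "c S = (SOME x. B x (Suc k) = S)" for S
    have c: "B (c S) (Suc k) = S" if "S \<in> \<B>" for S
      unfolding c_def by (rule someI_ex) (use that in \<open>auto simp: \<B>_def\<close>)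
    define q where "q S = Q k (delta (c S))" for S
    have q_self: "q S (c S) \<noteq> 0" for S using weight_pos[of k] by (simp add: q_def Q_delta_self)
    have q_supp: "q S x = 0" if "x \<notin> S" "S \<in> \<B>" for S x
      using B_mono[of k "Suc k" "c S"] c[OF that(2)] that(1)
      by (auto simp: q_def Q_def P_delta B_sym[of _ "c S"])
    have disj: "c S \<notin> T" if "S \<in> \<B>" "T \<in> \<B>" "S \<noteq> T" for S T
      using c[OF that(1)] c[OF that(2)] B_eq[of "c S" "c T" "Suc k"] that(3) by auto
    have a_notin: "a \<notin> S" if "S \<in> \<B>" for S
      using B_eq[of a "c S" "Suc k"] c[OF that] that by (auto simp: \<B>_def)
    have q_eig: "q S \<in> eigenspace H (of_real (ev k))" if "S \<in> \<B>" for S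
      unfolding eigenspace_H_ev eigenspace_L_ev using q_supp[OF a_notin[OF that] that]
      by (simp add: q_def Q_L2 Q_Q)
    have q_neq: "q S \<noteq> q T" if "S \<in> \<B>" "T \<in> \<B>" "S \<noteq> T" for S T
      using q_self[of S] q_supp[OF disj[OF that] that(2)] by auto
    obtain \<C> where \<C>: "\<C> \<subseteq> \<B>" "finite \<C>" "card \<C> = Suc (card F)"
      using infinite_arbitrarily_large[OF inf] by blast
    have inj: "inj_on q \<C>" using q_neq \<C>(1) by (auto simp: inj_on_def)
    have "fun_vs.independent (q ` \<C>)"
    proof (subst fun_vs.independent_explicit_finite_subsets, intro allI impI ballI)
      fix A u v assume A: "A \<subseteq> q ` \<C>" "finite A" "(\<Sum>v\<in>A. fscale (u v) v) = 0" "v \<in> A"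
      then obtain S where S: "S \<in> \<C>" "v = q S" by blast
      have "(\<Sum>v'\<in>A. u v' * v' (c S)) = 0"
        using fun_cong[OF A(3), of "c S"] by (simp add: sum_fun_apply fscale_def)
      moreover have "(\<Sum>v'\<in>A. u v' * v' (c S)) = (\<Sum>v'\<in>A. if v' = v then u v * v (c S) else 0)"
      proof (rule sum.cong)
        fix v' assume "v' \<in> A"
        then obtain T where T: "T \<in> \<C>" "v' = q T" using A(1) by blast
        show "u v' * v' (c S) = (if v' = v then u v * v (c S) else 0)"
        proof (cases "S = T")
          case False
          then have "v' (c S) = 0" using q_supp[OF disj] S(1) T \<C>(1) by auto
          moreover have "v' \<noteq> v" 
            unfolding S(2) T(2) by (intro q_neq[THEN not_sym]) (use S T \<C>(1) False in blast)+
          ultimately show ?thesis by simp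
        qed (use S T in auto)
      qed simp
      ultimately have "u v * v (c S) = 0" using A(2,4) by simp
      then show "u v = 0" using q_self[of S] S(2) by simp
    qed
    moreover have "q ` \<C> \<subseteq> fun_vs.span F" using q_eig \<C>(1) F(2) by blast
    ultimately have "card (q ` \<C>) \<le> card F" using fun_vs.independent_span_bound[OF F(1)] by blast
    then show False using \<C>(3) card_image[OF inj] by simp
  qed
  then have "\<not> (\<exists>F. finite F \<and> eigenspace H (of_real (ev k)) \<subseteq> fun_vs.span F)" by blast
  then show ?thesis unfolding eig_mult_def by (simp only: if_False)
qed

lemma eigenvalue_ev: "eigenvalue H (of_real (ev k))" "eigenvalue L (of_real (ev k))"
proof -
  have "\<not> eigenspace H (of_real (ev k)) \<subseteq> {0}"
  proof
    assume "eigenspace H (of_real (ev k)) \<subseteq> {0}"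
    then have "eigenspace H (of_real (ev k)) \<subseteq> fun_vs.span {}" by simp
    then have "\<exists>F. finite F \<and> eigenspace H (of_real (ev k)) \<subseteq> fun_vs.span F" by blast
    then have "eig_mult H (of_real (ev k)) \<noteq> \<infinity>" by (simp add: eig_mult_def)
    then show False by (simp add: eig_mult_H_ev)
  qed
  then obtain f where "f \<in> eigenspace H (of_real (ev k))" "f \<noteq> 0" by blast
  then have "eigenfunction H (of_real (ev k)) f" "eigenfunction L (of_real (ev k)) f"
    unfolding eigenfunction_def eigenspace_H_ev by blast+
  then show "eigenvalue H (of_real (ev k))" "eigenvalue L (of_real (ev k))"
    unfolding eigenvalue_def by blast+
qed

lemma eigenfunctions_H_ev:
  "{f. eigenfunction H (of_real (ev k)) f} = {f. eigenfunction L (of_real (ev k)) f \<and> f a = 0}"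
proof (intro Collect_cong iffI)
  fix f assume "eigenfunction H (of_real (ev k)) f"
  then show "eigenfunction L (of_real (ev k)) f \<and> f a = 0"
    unfolding eigenfunction_def eigenspace_H_ev mem_Collect_eq by (elim conjE, intro conjI)
next
  fix f assume "eigenfunction L (of_real (ev k)) f \<and> f a = 0"
  then show "eigenfunction H (of_real (ev k)) f"
    unfolding eigenfunction_def eigenspace_H_ev mem_Collect_eq by (elim conjE, intro conjI)
qed

lemma eigenspace_ev_basis:
  assumes "countable (UNIV :: 'a set)"
  shows "\<exists>E. orthonormal_basis_of E (eigenspace H (of_real (ev k))) \<and> (\<forall>e\<in>E. finite {x. e x \<noteq> 0})"
proof -
  define V where "V = eigenspace H (of_real (ev k))"
  define U where "U = {f \<in> V. finite {x. f x \<noteq> 0}}"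
  have sub: "fun_vs.subspace U"
  proof (rule fun_vs.subspaceI)
    show "0 \<in> U" using eigenspace_H_ev_subspace by (simp add: U_def V_def fun_vs.subspace_0)
    show "x + y \<in> U" if "x \<in> U" "y \<in> U" for x y
    proof -
      have "{z. (x + y) z \<noteq> 0} \<subseteq> {z. x z \<noteq> 0} \<union> {z. y z \<noteq> 0}" by auto
      then have "finite {z. (x + y) z \<noteq> 0}" using that by (rule_tac finite_subset) (auto simp: U_def)
      then show ?thesis
        using that fun_vs.subspace_add[OF eigenspace_H_ev_subspace] by (simp add: U_def V_def)
    qed
    show "fscale c x \<in> U" if "x \<in> U" for c x
    proof -
      have "{z. fscale c x z \<noteq> 0} \<subseteq> {z. x z \<noteq> 0}" by (auto simp: fscale_def)
      then have "finite {z. fscale c x z \<noteq> 0}" using that by (rule_tac finite_subset) (auto simp: U_def)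
      then show ?thesis
        using that fun_vs.subspace_scale[OF eigenspace_H_ev_subspace] by (simp add: U_def V_def)
    qed
  qed
  have "\<exists>E. orthonormal_basis_of E V \<and> E \<subseteq> \<Union>{U}"
  proof (rule orthonormal_basis_from_total_set[where S = "range (\<lambda>y. eigen_proj k (delta y))"])
    show "fun_vs.subspace U' \<and> U' \<subseteq> V" if "U' \<in> {U}" for U' using that sub by (auto simp: U_def)
    show "V \<subseteq> L2" by (auto simp: V_def eigenspace_def)
    show "countable (range (\<lambda>y. eigen_proj k (delta y)))" using assms by simp
    show "range (\<lambda>y. eigen_proj k (delta y)) \<subseteq> \<Union>{U}"
      using eigen_proj_in_eigenspace eigen_proj_delta_finite_support by (auto simp: U_def V_def)
    fix g f assume g: "g \<in> L2" "\<And>v. v \<in> range (\<lambda>y. eigen_proj k (delta y)) \<Longrightarrow> L2_inner g v = 0" and f: "f \<in> V"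
    have "eigen_proj k g = 0" by (rule orthogonal_to_eigen_proj_delta) (auto simp: g)
    moreover have "L2_inner g f = L2_inner (eigen_proj k g) f"
      using f L2_inner_eigen_proj[OF g(1), of f k] by (simp add: V_def eigen_proj_eq_self eigenspace_def)
    ultimately show "L2_inner g f = 0" by simp
  qed simp
  then obtain E where E: "orthonormal_basis_of E V" "E \<subseteq> U" by auto
  show ?thesis
  proof (intro exI conjI ballI)
    show "orthonormal_basis_of E (eigenspace H (of_real (ev k)))" using E(1) by (simp only: V_def)
    show "finite {x. e x \<noteq> 0}" if "e \<in> E" for e using E(2) that by (auto simp: U_def)
  qed
qed

text \<open>The resolvent formula for a perturbation of rank one, before it is solved for f a.\<close>

lemma perturbed_equation_iff:
  assumes z: "regular z" and f: "f \<in> L2" and h: "h \<in> L2"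
  shows "H f - fscale z f = h \<longleftrightarrow> f = R z h + fscale (of_real \<sigma> * f a) (R z (delta a))"
proof -
  have "H f - fscale z f = h \<longleftrightarrow> L f - fscale z f = h + fscale (of_real \<sigma> * f a) (delta a)"
  proof -
    have "u - s - v = h \<longleftrightarrow> u - v = h + s" for u s v :: "'a \<Rightarrow> complex"
      by (simp only: diff_eq_eq add.commute add.left_commute add.assoc)
    then show ?thesis unfolding H_eq by this
  qed
  also have "\<dots> \<longleftrightarrow> f = R z (h + fscale (of_real \<sigma> * f a) (delta a))"
    by (rule resolvent_equation_iff[OF z f]) (simp add: L2_add h L2_fscale)
  finally show ?thesis by (simp add: R_add R_fscale z h L2_fscale)
qed

lemma eigenspace_H_regular:
  assumes z: "regular z" and f: "f \<in> eigenspace H z"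
  shows "f = fscale (of_real \<sigma> * f a) (R z (delta a))"
proof -
  have R0: "R z 0 = 0" using R_fscale[OF z L2_0, of 0] by (simp add: fun_vs.scale_zero_left)
  have "H f - fscale z f = 0" "f \<in> L2" using f by (auto simp: eigenspace_def)
  then show ?thesis using perturbed_equation_iff[OF z, of f 0] by (simp add: R0)
qed

lemma R_delta_nonzero: "regular z \<Longrightarrow> R z (delta a) \<noteq> 0"
proof
  assume "regular z" "R z (delta a) = 0"
  then show False using infinite_support_R_delta[of z a] by simp
qed

lemma R_delta_eigenfunction:
  assumes z: "regular z" and root: "of_real \<sigma> * R z (delta a) a = 1"
  shows "eigenfunction H z (R z (delta a))"
proof -
  have R0: "R z 0 = 0" using R_fscale[OF z L2_0, of 0] by (simp add: fun_vs.scale_zero_left)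
  have "H (R z (delta a)) - fscale z (R z (delta a)) = 0"
    by (subst perturbed_equation_iff[OF z]) (simp_all add: R_L2 z root R0)
  then show ?thesis using R_delta_nonzero[OF z] by (simp add: eigenfunction_def eigenspace_def R_L2 z)
qed

lemma eigenvalue_H_regular_iff:
  assumes z: "regular z"
  shows "eigenvalue H z \<longleftrightarrow> of_real \<sigma> * R z (delta a) a = 1"
proof
  assume "eigenvalue H z"
  then obtain f where f: "f \<in> eigenspace H z" "f \<noteq> 0" by (auto simp: eigenvalue_def eigenfunction_def)
  have eq: "f = fscale (of_real \<sigma> * f a) (R z (delta a))" by (rule eigenspace_H_regular[OF z f(1)])
  have "f a \<noteq> 0" using eq f(2) by (auto simp: fun_vs.scale_zero_left)
  moreover have "f a = of_real \<sigma> * f a * R z (delta a) a"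
    using fun_cong[OF eq, of a] by (simp add: fscale_def)
  ultimately show "of_real \<sigma> * R z (delta a) a = 1" by (simp add: mult_ac)
qed (use R_delta_eigenfunction[OF z] in \<open>auto simp: eigenvalue_def\<close>)

lemma eig_mult_H_regular:
  assumes z: "regular z" and root: "of_real \<sigma> * R z (delta a) a = 1"
  shows "eig_mult H z = 1"
proof -
  let ?\<psi> = "R z (delta a)"
  have span: "eigenspace H z \<subseteq> fun_vs.span {?\<psi>}"
    using eigenspace_H_regular[OF z] by (metis fun_vs.span_base fun_vs.span_scale insertI1 subsetI)
  have "fun_vs.dim (eigenspace H z) = 1"
  proof (rule fun_vs.dim_unique[OF _ span])
    show "{?\<psi>} \<subseteq> eigenspace H z" using R_delta_eigenfunction[OF assms] by (simp add: eigenfunction_def)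
    show "fun_vs.independent {?\<psi>}" using R_delta_nonzero[OF z] by simp
  qed simp
  moreover have "\<exists>F. finite F \<and> eigenspace H z \<subseteq> fun_vs.span F"
    using span by (intro exI[of _ "{?\<psi>}"] conjI) simp
  ultimately show ?thesis unfolding eig_mult_def by (simp only: if_True one_enat_def)
qed

text \<open>Evaluating the resolvent formula at a gives \<open>f a * D = R z h a\<close> with \<open>D \<noteq> 0\<close>, which determines f a
  and with it f.\<close>

lemma resolvent_set_H:
  assumes z: "regular z" and no_root: "of_real \<sigma> * R z (delta a) a \<noteq> 1"
  shows "z \<in> resolvent_set H"
proof -
  let ?\<psi> = "R z (delta a)" and ?T = "\<lambda>f. H f - fscale z f"
  define D where "D = 1 - of_real \<sigma> * ?\<psi> a"
  have D: "D \<noteq> 0" using no_root by (simp add: D_def)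
  have TL: "?T f \<in> L2" if "f \<in> L2" for f using that by (simp add: L2_diff H_L2 L2_fscale)
  have val: "f a * D = R z (?T f) a" and sol: "f = R z (?T f) + fscale (of_real \<sigma> * f a) ?\<psi>"
    if "f \<in> L2" for f
  proof -
    show sol: "f = R z (?T f) + fscale (of_real \<sigma> * f a) ?\<psi>"
      using perturbed_equation_iff[OF z that TL[OF that]] by simp
    show "f a * D = R z (?T f) a"
      using fun_cong[OF sol, of a] by (simp add: D_def fscale_def algebra_simps)
  qed
  have bij: "bij_betw ?T L2 L2"
    unfolding bij_betw_def
  proof (intro conjI)
    show "inj_on ?T L2"
    proof (rule inj_onI)
      fix f g assume fg: "f \<in> L2" "g \<in> L2" "?T f = ?T g"
      then have "f a * D = g a * D" using val by metis
      then have "f a = g a" using D by simp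
      then show "f = g" using sol[OF fg(1)] sol[OF fg(2)] fg(3) by metis
    qed
    show "?T ` L2 = L2"
    proof
      show "?T ` L2 \<subseteq> L2" using TL by blast
      show "L2 \<subseteq> ?T ` L2"
      proof
        fix h :: "'a \<Rightarrow> complex" assume h: "h \<in> L2"
        define f where "f = R z h + fscale (of_real \<sigma> * (R z h a / D)) ?\<psi>"
        have fL: "f \<in> L2" unfolding f_def by (intro L2_add L2_fscale R_L2 z h delta_in_L2)
        have "f a = R z h a / D"
          using D by (simp add: f_def fscale_def D_def field_simps)
        then have "?T f = h" using perturbed_equation_iff[OF z fL h] by (simp add: f_def)
        then show "h \<in> ?T ` L2" using fL by blast
      qed
    qed
  qed
  obtain M where M: "0 \<le> M" "\<And>f. f \<in> L2 \<Longrightarrow> L2_norm (R z f) \<le> M * L2_norm f"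
    using R_bounded[OF z] by blast
  have bound: "L2_norm f \<le> (M + \<bar>\<sigma>\<bar> * (M / cmod D) * L2_norm ?\<psi>) * L2_norm (?T f)" if f: "f \<in> L2" for f
  proof -
    have "cmod (f a) * cmod D \<le> M * L2_norm (?T f)"
      using M(2)[OF TL[OF f]] cmod_le_L2_norm[OF R_L2[OF z TL[OF f]], of a]
      by (simp add: norm_mult[symmetric] val[OF f])
    then have fa: "cmod (f a) \<le> M / cmod D * L2_norm (?T f)" using D by (simp add: field_simps)
    have "L2_norm f \<le> L2_norm (R z (?T f)) + L2_norm (fscale (of_real \<sigma> * f a) ?\<psi>)"
      by (subst sol[OF f]) (intro L2_norm_triangle L2_fscale R_L2 z TL f delta_in_L2)
    also have "\<dots> \<le> M * L2_norm (?T f) + \<bar>\<sigma>\<bar> * cmod (f a) * L2_norm ?\<psi>"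
      using M(2)[OF TL[OF f]] by (simp add: L2_norm_fscale R_L2 z norm_mult)
    also have "\<dots> \<le> M * L2_norm (?T f) + \<bar>\<sigma>\<bar> * (M / cmod D * L2_norm (?T f)) * L2_norm ?\<psi>"
      by (intro add_left_mono mult_right_mono mult_left_mono fa L2_norm_nonneg) simp
    finally show ?thesis by (simp add: algebra_simps)
  qed
  show ?thesis unfolding resolvent_set_def mem_Collect_eq
    by (intro conjI bij exI[of _ "M + \<bar>\<sigma>\<bar> * (M / cmod D) * L2_norm ?\<psi>"] ballI bound)
qed

lemma eigenvalue_in_spectrum: "eigenvalue H z \<Longrightarrow> z \<in> spectrum H"
proof -
  assume "eigenvalue H z"
  then obtain f where f: "f \<in> L2" "H f = fscale z f" "f \<noteq> 0"
    by (auto simp: eigenvalue_def eigenfunction_def eigenspace_def)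
  have "H 0 = fscale z 0" by (simp add: symmetric_on_L2_0[OF symmetric_H])
  then have "\<not> inj_on (\<lambda>f. H f - fscale z f) L2"
    using f unfolding inj_on_def by (metis L2_0 diff_self)
  then show ?thesis by (auto simp: spectrum_def resolvent_set_def bij_betw_def)
qed

text \<open>A bounded inverse is excluded by eigenvalues arbitrarily close to 0.\<close>

lemma zero_in_spectrum: "0 \<in> spectrum H"
proof (rule ccontr)
  assume "0 \<notin> spectrum H"
  then obtain K where K: "\<And>f. f \<in> L2 \<Longrightarrow> L2_norm f \<le> K * L2_norm (H f)"
    by (auto simp: spectrum_def resolvent_set_def fun_vs.scale_zero_left)
  have "1 \<le> K * ev k" for k
  proof -
    obtain f where f: "f \<in> L2" "H f = fscale (of_real (ev k)) f" "f \<noteq> 0"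
      using eigenvalue_ev(1)[of k] by (auto simp: eigenvalue_def eigenfunction_def eigenspace_def)
    have "L2_norm f \<le> K * (ev k * L2_norm f)"
      using K[OF f(1)] ev_pos[of k] by (simp add: f L2_norm_fscale)
    then have "1 * L2_norm f \<le> (K * ev k) * L2_norm f" by simp
    then show ?thesis using L2_norm_pos[OF f(1,3)] by (simp only: mult_le_cancel_right_pos)
  qed
  moreover have "(\<lambda>k. K * ev k) \<longlonglongrightarrow> K * 0" by (intro tendsto_intros ev_tendsto_0)
  ultimately have "1 \<le> K * 0" by (intro LIMSEQ_le_const) auto
  then show False by simp
qed

text \<open>A regular point of the spectrum solves the equation for eigenvalues, and eigenvalues of a symmetric
  operator are real.\<close>

lemma spectrum_H: "spectrum H = insert 0 (of_real ` {\<mu>::real. eigenvalue H (of_real \<mu>)})"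
proof (intro set_eqI iffI)
  fix z assume z: "z \<in> spectrum H"
  show "z \<in> insert 0 (of_real ` {\<mu>::real. eigenvalue H (of_real \<mu>)})"
  proof (cases "z = 0")
    case False
    have "eigenvalue H z"
    proof (cases "regular z")
      case True
      then show ?thesis using z resolvent_set_H eigenvalue_H_regular_iff by (auto simp: spectrum_def)
    next
      case not_regular: False
      then show ?thesis using False eigenvalue_ev(1) by (auto simp: regular_def)
    qed
    moreover from this have "z \<in> \<real>" using eigenvalue_real[OF symmetric_H] by (auto simp: eigenvalue_def)
    ultimately show ?thesis by (auto elim!: Reals_cases)
  qed simp
next
  fix z :: complex assume "z \<in> insert 0 (of_real ` {\<mu>::real. eigenvalue H (of_real \<mu>)})"
  then have "z = 0 \<or> eigenvalue H z" by blast
  then show "z \<in> spectrum H" using eigenvalue_in_spectrum zero_in_spectrum by blast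
qed

end

section \<open>The resolvent kernel on the diagonal\<close>

context hierarchical_operator
begin

abbreviation regular_real :: "real \<Rightarrow> bool" where
  "regular_real \<nu> \<equiv> regular (of_real \<nu>)"

lemma regular_real_iff: "regular_real \<nu> \<longleftrightarrow> \<nu> \<noteq> 0 \<and> (\<forall>j. ev j \<noteq> \<nu>)"
  by (simp add: regular_def)

text \<open>The resolvent kernel \<open>\<R>(\<nu>, a, a)\<close> at real arguments. By homogeneity it is the same for all a.\<close>

definition green :: "real \<Rightarrow> real" where
  "green \<nu> = (\<Sum>j. weight j / (ev j - \<nu>))"

lemma
  assumes "regular_real \<nu>"
  shows green_sums: "(\<lambda>j. weight j / (ev j - \<nu>)) sums green \<nu>"
    and R_delta_eq_green: "R (of_real \<nu>) (delta a) a = of_real (green \<nu>)"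
proof -
  have s: "(\<lambda>j. complex_of_real (weight j / (ev j - \<nu>))) sums R (of_real \<nu>) (delta a) a"
    using R_delta_sums[OF assms, of a] by simp
  then have "(\<lambda>j. weight j / (ev j - \<nu>)) sums Re (R (of_real \<nu>) (delta a) a)"
    using sums_Re by fastforce
  then show g: "(\<lambda>j. weight j / (ev j - \<nu>)) sums green \<nu>"
    by (simp add: green_def sums_iff)
  then have "(\<lambda>j. complex_of_real (weight j / (ev j - \<nu>))) sums of_real (green \<nu>)"
    by (simp only: sums_of_real_iff)
  then show "R (of_real \<nu>) (delta a) a = of_real (green \<nu>)"
    by (rule sums_unique2[OF s])
qed

lemma green_diff_sums:
  assumes "regular_real \<nu>" "regular_real \<nu>'"
  shows "(\<lambda>j. (\<nu>' - \<nu>) * (weight j / ((ev j - \<nu>) * (ev j - \<nu>')))) sums (green \<nu>' - green \<nu>)"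
proof -
  have "weight j / (ev j - \<nu>') - weight j / (ev j - \<nu>) = (\<nu>' - \<nu>) * (weight j / ((ev j - \<nu>) * (ev j - \<nu>')))" for j
  proof -
    have "ev j - \<nu> \<noteq> 0" "ev j - \<nu>' \<noteq> 0" using assms by (auto simp: regular_real_iff)
    then show ?thesis by (simp add: divide_simps) (simp add: algebra_simps)
  qed
  then show ?thesis
    using sums_diff[OF green_sums[OF assms(2)] green_sums[OF assms(1)]] by simp
qed

lemma green_strict_mono:
  assumes "regular_real \<nu>" "regular_real \<nu>'" "\<nu> < \<nu>'" "\<And>j. 0 < (ev j - \<nu>) * (ev j - \<nu>')"
  shows "green \<nu> < green \<nu>'"
proof -
  note s = green_diff_sums[OF assms(1,2)]
  have "0 < (\<Sum>j. (\<nu>' - \<nu>) * (weight j / ((ev j - \<nu>) * (ev j - \<nu>'))))"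
    by (rule suminf_pos[OF sums_summable[OF s]]) (use assms(3,4) weight_pos in simp)
  then show ?thesis using s by (simp add: sums_iff)
qed

text \<open>Near a regular point all distances to the eigenvalues stay away from 0, so the formula for
  differences of \<open>green\<close> yields a local Lipschitz bound.\<close>

lemma isCont_green:
  assumes "regular_real \<nu>"
  shows "isCont green \<nu>"
proof -
  obtain d where d: "0 < d" "\<And>j. d \<le> cmod (of_real (ev j) - of_real \<nu>)"
    using regular_gap[OF assms] by blast
  have d': "d \<le> \<bar>ev j - \<nu>\<bar>" for j
    using d(2)[of j] unfolding of_real_diff[symmetric] norm_of_real .
  define \<delta> where "\<delta> = min (d / 2) \<bar>\<nu>\<bar>"
  have \<delta>: "0 < \<delta>" using d(1) assms by (auto simp: \<delta>_def regular_real_iff)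
  have lip: "\<bar>green \<nu>' - green \<nu>\<bar> \<le> \<bar>\<nu>' - \<nu>\<bar> * (2 / d\<^sup>2)" if "\<bar>\<nu>' - \<nu>\<bar> < \<delta>" for \<nu>'
  proof -
    have far: "d / 2 \<le> \<bar>ev j - \<nu>'\<bar>" for j using d'[of j] that unfolding \<delta>_def by linarith
    have "ev j \<noteq> \<nu>'" for j using far[of j] d(1) by auto
    then have r: "regular_real \<nu>'" using that by (auto simp: regular_real_iff \<delta>_def)
    note s = green_diff_sums[OF assms r]
    have bd: "\<bar>(\<nu>' - \<nu>) * (weight j / ((ev j - \<nu>) * (ev j - \<nu>')))\<bar> \<le> \<bar>\<nu>' - \<nu>\<bar> * (2 / d\<^sup>2) * weight j" for j
    proof -
      have "d * (d / 2) \<le> \<bar>ev j - \<nu>\<bar> * \<bar>ev j - \<nu>'\<bar>"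
        by (intro mult_mono d' far) (use d(1) in auto)
      moreover have "0 < \<bar>ev j - \<nu>\<bar>" "0 < \<bar>ev j - \<nu>'\<bar>"
        using d'[of j] far[of j] d(1) by linarith+
      ultimately have "weight j / (\<bar>ev j - \<nu>\<bar> * \<bar>ev j - \<nu>'\<bar>) \<le> weight j / (d * (d / 2))"
        using weight_pos[of j] d(1) by (intro divide_left_mono mult_pos_pos) linarith+
      also have "\<dots> = 2 / d\<^sup>2 * weight j" by (simp add: power2_eq_square)
      finally have "\<bar>\<nu>' - \<nu>\<bar> * (weight j / (\<bar>ev j - \<nu>\<bar> * \<bar>ev j - \<nu>'\<bar>)) \<le> \<bar>\<nu>' - \<nu>\<bar> * (2 / d\<^sup>2 * weight j)"
        by (intro mult_left_mono) auto
      then show ?thesis using weight_pos[of j] by (simp add: abs_mult mult.assoc)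
    qed
    have b: "(\<lambda>j. \<bar>\<nu>' - \<nu>\<bar> * (2 / d\<^sup>2) * weight j) sums (\<bar>\<nu>' - \<nu>\<bar> * (2 / d\<^sup>2))"
      using sums_mult[OF weight_sums, of "\<bar>\<nu>' - \<nu>\<bar> * (2 / d\<^sup>2)"] by simp
    have "green \<nu>' - green \<nu> \<le> \<bar>\<nu>' - \<nu>\<bar> * (2 / d\<^sup>2)"
      by (rule sums_le[OF _ s b]) (rule abs_le_D1[OF bd])
    moreover have "- (green \<nu>' - green \<nu>) \<le> \<bar>\<nu>' - \<nu>\<bar> * (2 / d\<^sup>2)"
      by (rule sums_le[OF _ sums_minus[OF s] b]) (rule abs_le_D2[OF bd])
    ultimately show ?thesis by linarith
  qed
  show ?thesis
    unfolding isCont_def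
  proof (rule LIM_zero_cancel, rule Lim_null_comparison)
    have "\<forall>\<^sub>F x in at \<nu>. dist x \<nu> < \<delta>"
      using \<delta> by (auto simp: eventually_at)
    then show "\<forall>\<^sub>F x in at \<nu>. norm (green x - green \<nu>) \<le> \<bar>x - \<nu>\<bar> * (2 / d\<^sup>2)"
      by (rule eventually_mono) (use lip in \<open>auto simp: dist_real_def\<close>)
    have "((\<lambda>x. \<bar>x - \<nu>\<bar> * (2 / d\<^sup>2)) \<longlongrightarrow> \<bar>\<nu> - \<nu>\<bar> * (2 / d\<^sup>2)) (at \<nu>)"
      by (intro tendsto_intros)
    then show "((\<lambda>x. \<bar>x - \<nu>\<bar> * (2 / d\<^sup>2)) \<longlongrightarrow> 0) (at \<nu>)" by simp
  qed
qed

lemma green_IVT: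
  assumes "x \<le> y" "green x \<le> s" "s \<le> green y" "\<And>\<nu>. x \<le> \<nu> \<Longrightarrow> \<nu> \<le> y \<Longrightarrow> regular_real \<nu>"
  obtains \<nu> where "x \<le> \<nu>" "\<nu> \<le> y" "green \<nu> = s"
  using IVT[of green x s y] assms isCont_green by blast

lemma regular_in_gap: "\<nu> \<in> {ev (Suc k)<..<ev k} \<Longrightarrow> regular_real \<nu>"
  using ev_pos[of "Suc k"] decseqD[OF ev_decseq] unfolding regular_real_iff
  by (metis greaterThanLessThan_iff less_asym' not_less not_less_eq_eq order_less_irrefl)

lemma regular_negative: "\<nu> < 0 \<Longrightarrow> regular_real \<nu>"
  using ev_pos by (auto simp: regular_real_iff) (metis less_asym)

lemma regular_above: "ev 0 < \<nu> \<Longrightarrow> regular_real \<nu>"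
proof -
  assume "ev 0 < \<nu>"
  moreover from this have "ev j \<noteq> \<nu>" for j using decseqD[OF ev_decseq, of 0 j] by force
  ultimately show "regular_real \<nu>" using ev_pos[of 0] by (simp add: regular_real_iff)
qed

lemma ev_cases:
  assumes "\<nu> \<noteq> 0" "\<And>j. ev j \<noteq> \<nu>"
  shows "\<nu> < 0 \<or> ev 0 < \<nu> \<or> (\<exists>k. \<nu> \<in> {ev (Suc k)<..<ev k})"
proof (rule ccontr)
  assume c: "\<not> ?thesis"
  then have \<nu>: "0 < \<nu>" using assms(1) by linarith
  have "\<nu> < ev k" for k
  proof (induction k)
    case 0
    then show ?case using c assms(2)[of 0] by linarith
  next
    case (Suc k)
    then show ?case using c assms(2)[of "Suc k"] by (metis greaterThanLessThan_iff linorder_neqE_linordered_idom)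
  qed
  then have "\<nu> \<le> 0" by (intro LIMSEQ_le_const[OF ev_tendsto_0]) (auto intro: less_imp_le)
  with \<nu> show False by simp
qed

lemma same_sign_in_gap:
  assumes "\<nu> \<in> {ev (Suc k)<..<ev k}" "\<nu>' \<in> {ev (Suc k)<..<ev k}"
  shows "0 < (ev j - \<nu>) * (ev j - \<nu>')"
proof (cases "j \<le> k")
  case True
  then show ?thesis using decseqD[OF ev_decseq True] assms by (intro mult_pos_pos) auto
next
  case False
  then have "ev j \<le> ev (Suc k)" by (intro decseqD[OF ev_decseq]) auto
  then show ?thesis using assms by (intro mult_neg_neg) auto
qed

text \<open>The weights of the terms with j \<le> k add up to at most 1, the term with j = k + 1 is kept, and the
  later terms are negative. This bound tends to \<open>-\<infinity>\<close> at the lower end of the gap.\<close>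

lemma green_upper_in_gap:
  assumes "\<nu> \<in> {ev (Suc k)<..<ev k}"
  shows "green \<nu> \<le> 1 / (ev k - \<nu>) + weight (Suc k) / (ev (Suc k) - \<nu>)"
proof -
  have d: "0 < ev k - \<nu>" "ev (Suc k) - \<nu> < 0" using assms by auto
  have "(\<lambda>j. weight j * (1 / (ev k - \<nu>))) sums (1 * (1 / (ev k - \<nu>)))"
    by (rule sums_mult2[OF weight_sums])
  from sums_add[OF this sums_single[of "Suc k" "\<lambda>j. weight j / (ev j - \<nu>)"]]
  have s: "(\<lambda>j. weight j * (1 / (ev k - \<nu>)) + (if j = Suc k then weight j / (ev j - \<nu>) else 0))
      sums (1 / (ev k - \<nu>) + weight (Suc k) / (ev (Suc k) - \<nu>))" by simp
  show ?thesis
  proof (rule sums_le[OF _ green_sums[OF regular_in_gap[OF assms]] s])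
    fix j
    consider "j \<le> k" | "j = Suc k" | "Suc k < j" by linarith
    then show "weight j / (ev j - \<nu>) \<le> weight j * (1 / (ev k - \<nu>)) + (if j = Suc k then weight j / (ev j - \<nu>) else 0)"
    proof cases
      case 1
      have "ev k - \<nu> \<le> ev j - \<nu>" using decseqD[OF ev_decseq 1] by simp
      then have "weight j / (ev j - \<nu>) \<le> weight j / (ev k - \<nu>)"
        using d(1) weight_pos[of j] by (intro divide_left_mono) auto
      then show ?thesis using 1 by simp
    next
      case 2
      then show ?thesis using d(1) weight_pos[of j] by simp
    next
      case 3
      have "ev j - \<nu> < 0" using ev_less[OF 3] d(2) by linarith
      then have "weight j / (ev j - \<nu>) \<le> 0" using weight_pos[of j] by (simp add: divide_le_0_iff)
      moreover have "0 \<le> weight j * (1 / (ev k - \<nu>))" using d(1) weight_pos[of j] by simp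
      ultimately show ?thesis using 3 by simp
    qed
  qed
qed

text \<open>The mirror image of the preceding bound, which tends to \<open>\<infinity>\<close> at the upper end of the gap.\<close>

lemma green_lower_in_gap:
  assumes "\<nu> \<in> {ev (Suc k)<..<ev k}"
  shows "weight k / (ev k - \<nu>) + 1 / (ev (Suc k) - \<nu>) \<le> green \<nu>"
proof -
  have d: "0 < ev k - \<nu>" "ev (Suc k) - \<nu> < 0" using assms by auto
  have "(\<lambda>j. weight j * (1 / (ev (Suc k) - \<nu>))) sums (1 * (1 / (ev (Suc k) - \<nu>)))"
    by (rule sums_mult2[OF weight_sums])
  from sums_add[OF this sums_single[of k "\<lambda>j. weight j / (ev j - \<nu>)"]]
  have s: "(\<lambda>j. weight j * (1 / (ev (Suc k) - \<nu>)) + (if j = k then weight j / (ev j - \<nu>) else 0))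
      sums (weight k / (ev k - \<nu>) + 1 / (ev (Suc k) - \<nu>))" by (simp add: add.commute)
  show ?thesis
  proof (rule sums_le[OF _ s green_sums[OF regular_in_gap[OF assms]]])
    fix j
    consider "j < k" | "j = k" | "Suc k \<le> j" by linarith
    then show "weight j * (1 / (ev (Suc k) - \<nu>)) + (if j = k then weight j / (ev j - \<nu>) else 0) \<le> weight j / (ev j - \<nu>)"
    proof cases
      case 1
      have "0 < ev j - \<nu>" using ev_less[OF 1] d(1) by linarith
      then have "0 \<le> weight j / (ev j - \<nu>)" using weight_pos[of j] by simp
      moreover have "weight j * (1 / (ev (Suc k) - \<nu>)) \<le> 0" using d(2) weight_pos[of j] by (simp add: divide_le_0_iff)
      ultimately show ?thesis using 1 by simp
    next
      case 2
      then show ?thesis using d(2) weight_pos[of j] by (simp add: divide_le_0_iff)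
    next
      case 3
      have "ev j - \<nu> \<le> ev (Suc k) - \<nu>" using decseqD[OF ev_decseq 3] by simp
      then have "1 / (ev (Suc k) - \<nu>) \<le> 1 / (ev j - \<nu>)"
        using d(2) by (simp add: divide_simps)
      then have "weight j * (1 / (ev (Suc k) - \<nu>)) \<le> weight j * (1 / (ev j - \<nu>))"
        using weight_pos[of j] by (intro mult_left_mono) auto
      then show ?thesis using 3 by simp
    qed
  qed
qed

lemma ex_small_positive:
  fixes c e M :: real
  assumes "0 < c" "0 < e"
  obtains t where "0 < t" "t \<le> e" "M < c / t"
proof
  define t where "t = min e (c / (\<bar>M\<bar> + 1))"
  show t: "0 < t" "t \<le> e" using assms by (auto simp: t_def)
  have "t \<le> c / (\<bar>M\<bar> + 1)" by (simp add: t_def)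
  then have "(\<bar>M\<bar> + 1) * t \<le> c" by (simp add: field_simps)
  then have "\<bar>M\<bar> + 1 \<le> c / t" using t(1) by (simp add: field_simps)
  then show "M < c / t" by linarith
qed

text \<open>In either half of the gap one of the two terms of the bounds is controlled by 2 / D, with D the length
  of the gap, while the other one is unbounded.\<close>

lemma ex1_root_in_gap: "\<exists>!\<nu>. \<nu> \<in> {ev (Suc k)<..<ev k} \<and> green \<nu> = s"
proof -
  define D where "D = ev k - ev (Suc k)"
  have D: "0 < D" using ev_Suc_less[of k] by (simp add: D_def)
  obtain t where t: "0 < t" "t \<le> D / 2" "2 / D - s < weight (Suc k) / t"
    using ex_small_positive[OF weight_pos[of "Suc k"], of "D / 2"] D by auto
  obtain u where u: "0 < u" "u \<le> D / 2" "2 / D + s < weight k / u"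
    using ex_small_positive[OF weight_pos[of k], of "D / 2"] D by auto
  define x where "x = ev (Suc k) + t"
  define y where "y = ev k - u"
  have xI: "x \<in> {ev (Suc k)<..<ev k}" and yI: "y \<in> {ev (Suc k)<..<ev k}"
    using t(1,2) u(1,2) D by (auto simp: x_def y_def D_def)
  have "green x \<le> 1 / (ev k - x) - weight (Suc k) / t"
    using green_upper_in_gap[OF xI] by (simp add: x_def)
  also have "1 / (ev k - x) \<le> 2 / D"
    using t(2) D by (simp add: x_def D_def divide_simps)
  finally have gx: "green x < s" using t(3) by linarith
  have "weight k / u + 1 / (ev (Suc k) - y) \<le> green y"
    using green_lower_in_gap[OF yI] by (simp add: y_def)
  moreover have "- (2 / D) \<le> 1 / (ev (Suc k) - y)"
  proof -
    have "1 / (y - ev (Suc k)) \<le> 2 / D" using u(2) D by (simp add: y_def D_def divide_simps)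
    moreover have "1 / (ev (Suc k) - y) = - (1 / (y - ev (Suc k)))"
      by (simp add: divide_minus_right[symmetric] del: divide_minus_right)
    ultimately show ?thesis by simp
  qed
  ultimately have gy: "s < green y" using u(3) by linarith
  have mono: "green \<nu> < green \<nu>'"
    if "\<nu> \<in> {ev (Suc k)<..<ev k}" "\<nu>' \<in> {ev (Suc k)<..<ev k}" "\<nu> < \<nu>'" for \<nu> \<nu>'
    by (rule green_strict_mono[OF regular_in_gap[OF that(1)] regular_in_gap[OF that(2)] that(3)
          same_sign_in_gap[OF that(1,2)]])
  have "x \<le> y"
  proof (rule ccontr)
    assume "\<not> x \<le> y"
    then have "green y < green x" using mono[OF yI xI] by simp
    then show False using gx gy by simp
  qed
  moreover have "regular_real \<nu>" if "x \<le> \<nu>" "\<nu> \<le> y" for \<nu>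
    by (rule regular_in_gap[of _ k]) (use that xI yI in auto)
  ultimately obtain \<nu> where \<nu>: "x \<le> \<nu>" "\<nu> \<le> y" "green \<nu> = s"
    using green_IVT[of x y s] less_imp_le[OF gx] less_imp_le[OF gy] by auto
  show ?thesis
  proof (rule ex1I[of _ \<nu>])
    show \<nu>I: "\<nu> \<in> {ev (Suc k)<..<ev k} \<and> green \<nu> = s" using \<nu> xI yI by auto
    show "\<nu>' = \<nu>" if "\<nu>' \<in> {ev (Suc k)<..<ev k} \<and> green \<nu>' = s" for \<nu>'
      using mono[of \<nu> \<nu>'] mono[of \<nu>' \<nu>] that \<nu>I by (cases \<nu> \<nu>' rule: linorder_cases) auto
  qed
qed

lemma green_strict_mono_above:
  assumes "ev 0 < \<nu>" "\<nu> < \<nu>'"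
  shows "green \<nu> < green \<nu>'"
proof (rule green_strict_mono)
  show "0 < (ev j - \<nu>) * (ev j - \<nu>')" for j
    using decseqD[OF ev_decseq, of 0 j] assms by (intro mult_neg_neg) auto
qed (use assms regular_above in auto)

lemma green_above:
  assumes "ev 0 < \<nu>"
  shows "1 / (ev 0 - \<nu>) \<le> green \<nu>" and "green \<nu> \<le> weight 0 / (ev 0 - \<nu>)" and "green \<nu> < 0"
proof -
  have neg: "ev j - \<nu> < 0" for j using decseqD[OF ev_decseq, of 0 j] assms by auto
  note g = green_sums[OF regular_above[OF assms]]
  have "(\<lambda>j. weight j * (1 / (ev 0 - \<nu>))) sums (1 * (1 / (ev 0 - \<nu>)))"
    by (rule sums_mult2[OF weight_sums])
  then have "1 * (1 / (ev 0 - \<nu>)) \<le> green \<nu>"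
  proof (rule sums_le[rotated, OF _ g])
    fix j
    have "1 / (ev 0 - \<nu>) \<le> 1 / (ev j - \<nu>)"
      using decseqD[OF ev_decseq, of 0 j] neg[of 0] neg[of j] by (simp add: divide_simps)
    then have "weight j * (1 / (ev 0 - \<nu>)) \<le> weight j * (1 / (ev j - \<nu>))"
      using weight_pos[of j] by (intro mult_left_mono) auto
    then show "weight j * (1 / (ev 0 - \<nu>)) \<le> weight j / (ev j - \<nu>)" by simp
  qed
  then show "1 / (ev 0 - \<nu>) \<le> green \<nu>" by simp
  show le: "green \<nu> \<le> weight 0 / (ev 0 - \<nu>)"
  proof (rule sums_le[OF _ g sums_single[of 0 "\<lambda>j. weight j / (ev j - \<nu>)"]])
    show "weight j / (ev j - \<nu>) \<le> (if j = 0 then weight j / (ev j - \<nu>) else 0)" for j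
      using neg[of j] weight_pos[of j] by (simp add: divide_le_0_iff)
  qed
  have "weight 0 / (ev 0 - \<nu>) < 0" using neg[of 0] weight_pos[of 0] by (simp add: divide_less_0_iff)
  with le show "green \<nu> < 0" by linarith
qed

lemma ex1_root_above:
  assumes "s < 0"
  shows "\<exists>!\<nu>. \<nu> \<in> {ev 0<..} \<and> green \<nu> = s"
proof -
  obtain t where t: "0 < t" "t \<le> 1" "- s < weight 0 / t" using ex_small_positive[OF weight_pos[of 0], of 1] by auto
  define x where "x = ev 0 + t"
  define y where "y = ev 0 + max t (- 1 / s)"
  have x: "ev 0 < x" using t(1) by (simp add: x_def)
  have y: "x \<le> y" by (simp add: x_def y_def)
  have "green x \<le> - (weight 0 / t)" using green_above(2)[OF x] by (simp add: x_def)
  then have gx: "green x \<le> s" using t(3) by linarith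
  have "s \<le> 1 / (ev 0 - y)"
  proof -
    have m: "0 < max t (- 1 / s)" "- 1 / s \<le> max t (- 1 / s)" using t(1) by auto
    have "1 \<le> - s * max t (- 1 / s)"
      using mult_left_mono[OF m(2), of "- s"] assms by simp
    then have "1 / max t (- 1 / s) \<le> - s" using m(1) by (simp add: pos_divide_le_eq mult.commute)
    moreover have "1 / (ev 0 - y) = - (1 / max t (- 1 / s))" by (simp add: y_def)
    ultimately show ?thesis by simp
  qed
  then have gy: "s \<le> green y" using green_above(1)[of y] x y by linarith
  obtain \<nu> where \<nu>: "x \<le> \<nu>" "\<nu> \<le> y" "green \<nu> = s"
    by (rule green_IVT[OF y gx gy]) (use x regular_above in auto)
  show ?thesis
  proof (rule ex1I[of _ \<nu>])
    show \<nu>I: "\<nu> \<in> {ev 0<..} \<and> green \<nu> = s" using \<nu> x by auto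
    show "\<nu>' = \<nu>" if "\<nu>' \<in> {ev 0<..} \<and> green \<nu>' = s" for \<nu>'
      using green_strict_mono_above[of \<nu> \<nu>'] green_strict_mono_above[of \<nu>' \<nu>] that \<nu>I
      by (cases \<nu> \<nu>' rule: linorder_cases) auto
  qed
qed

lemma green_strict_mono_negative:
  assumes "\<nu>' < 0" "\<nu> < \<nu>'"
  shows "green \<nu> < green \<nu>'"
proof (rule green_strict_mono)
  show "0 < (ev j - \<nu>) * (ev j - \<nu>')" for j
    using ev_pos[of j] assms by (intro mult_pos_pos) auto
qed (use assms regular_negative in auto)

lemma green_negative:
  assumes "\<nu> < 0"
  shows "0 < green \<nu>" and "green \<nu> \<le> 1 / (- \<nu>)"
proof -
  note g = green_sums[OF regular_negative[OF assms]]
  have pos: "0 < ev j - \<nu>" for j using ev_pos[of j] assms by linarith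
  have "0 < (\<Sum>j. weight j / (ev j - \<nu>))"
    by (rule suminf_pos[OF sums_summable[OF g]]) (use pos weight_pos in simp)
  then show "0 < green \<nu>" by (simp add: green_def)
  have b: "(\<lambda>j. weight j * (1 / (- \<nu>))) sums (1 * (1 / (- \<nu>)))"
    by (rule sums_mult2[OF weight_sums])
  have "green \<nu> \<le> 1 * (1 / (- \<nu>))"
  proof (rule sums_le[OF _ g b])
    fix j
    have "weight j / (ev j - \<nu>) \<le> weight j / (- \<nu>)"
      using ev_pos[of j] weight_pos[of j] assms by (intro divide_left_mono mult_pos_pos) auto
    then show "weight j / (ev j - \<nu>) \<le> weight j * (1 / (- \<nu>))" by simp
  qed
  then show "green \<nu> \<le> 1 / (- \<nu>)" by simp
qed

lemma green_negative_root:
  assumes s: "0 < s" and x: "x < 0" "s \<le> green x"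
  shows "\<exists>!\<nu>. \<nu> \<in> {..<0} \<and> green \<nu> = s"
proof -
  define y where "y = min x (- 1 / s)"
  have y: "y \<le> x" "y < 0" using x by (auto simp: y_def)
  have "1 / (- y) \<le> s"
  proof -
    have "1 / s \<le> - y" by (simp add: y_def)
    then have "1 \<le> s * (- y)" using s by (simp add: field_simps)
    then show ?thesis using y(2) by (simp add: divide_simps mult.commute)
  qed
  then have gy: "green y \<le> s" using green_negative(2)[OF y(2)] by linarith
  obtain \<nu> where \<nu>: "y \<le> \<nu>" "\<nu> \<le> x" "green \<nu> = s"
    by (rule green_IVT[OF y(1) gy x(2)]) (use x regular_negative in auto)
  show ?thesis
  proof (rule ex1I[of _ \<nu>])
    show \<nu>I: "\<nu> \<in> {..<0} \<and> green \<nu> = s" using \<nu> x by auto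
    show "\<nu>' = \<nu>" if "\<nu>' \<in> {..<0} \<and> green \<nu>' = s" for \<nu>'
      using green_strict_mono_negative[of \<nu> \<nu>'] green_strict_mono_negative[of \<nu>' \<nu>] that \<nu>I
      by (cases \<nu> \<nu>' rule: linorder_cases) auto
  qed
qed

text \<open>The right-hand side is the limit of \<open>green\<close> at 0 from the left, by monotone convergence; it is not
  attained on the negative half-line. It may be infinite.\<close>

lemma negative_root_iff:
  assumes s: "0 < s"
  shows "(\<exists>\<nu><0. green \<nu> = s) \<longleftrightarrow> ennreal s < (\<Sum>j. ennreal (weight j / ev j))"
proof
  assume "\<exists>\<nu><0. green \<nu> = s"
  then obtain \<nu> where \<nu>: "\<nu> < 0" "green \<nu> = s" by blast
  have \<nu>2: "\<nu> / 2 < 0" "\<nu> < \<nu> / 2" using \<nu> by auto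
  have g: "(\<lambda>j. weight j / (ev j - \<nu> / 2)) sums green (\<nu> / 2)"
    by (rule green_sums[OF regular_negative[OF \<nu>2(1)]])
  have nn: "0 \<le> weight j / (ev j - \<nu> / 2)" for j
    using ev_pos[of j] weight_pos[of j] \<nu>(1) by (intro divide_nonneg_nonneg) auto
  have "ennreal s < ennreal (green (\<nu> / 2))"
    using green_strict_mono_negative[OF \<nu>2] \<nu>(2) s by (intro ennreal_lessI) auto
  also have "ennreal (green (\<nu> / 2)) = (\<Sum>j. ennreal (weight j / (ev j - \<nu> / 2)))"
    using suminf_ennreal2[OF nn sums_summable[OF g]] g by (simp add: sums_iff)
  also have "\<dots> \<le> (\<Sum>j. ennreal (weight j / ev j))"
  proof (rule suminf_le)
    show "ennreal (weight j / (ev j - \<nu> / 2)) \<le> ennreal (weight j / ev j)" for j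
      using ev_pos[of j] weight_pos[of j] \<nu>(1) by (intro ennreal_leI divide_left_mono mult_pos_pos) auto
  qed auto
  finally show "ennreal s < (\<Sum>j. ennreal (weight j / ev j))" .
next
  assume "ennreal s < (\<Sum>j. ennreal (weight j / ev j))"
  then obtain N where N: "ennreal s < (\<Sum>j<N. ennreal (weight j / ev j))"
    unfolding suminf_eq_SUP by (auto simp: less_SUP_iff)
  have "(\<Sum>j<N. ennreal (weight j / ev j)) = ennreal (\<Sum>j<N. weight j / ev j)"
    using ev_pos weight_pos by (intro sum_ennreal) (auto intro: less_imp_le)
  with N have "s < (\<Sum>j<N. weight j / ev j)" using s by (simp add: ennreal_less_iff)
  moreover have "((\<lambda>\<nu>. \<Sum>j<N. weight j / (ev j - \<nu>)) \<longlongrightarrow> (\<Sum>j<N. weight j / (ev j - 0))) (at_left 0)"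
    using ev_pos by (intro tendsto_intros) (auto simp: less_imp_neq[symmetric])
  ultimately have "\<forall>\<^sub>F \<nu> in at_left 0. s < (\<Sum>j<N. weight j / (ev j - \<nu>))"
    by (intro order_tendstoD(1)) auto
  then obtain b :: real where b: "b < 0" "\<And>\<nu>. b < \<nu> \<Longrightarrow> \<nu> < 0 \<Longrightarrow> s < (\<Sum>j<N. weight j / (ev j - \<nu>))"
    by (auto simp: eventually_at_left_field)
  define x where "x = b / 2"
  have x: "x < 0" "b < x" using b(1) by (auto simp: x_def)
  have g: "(\<lambda>j. weight j / (ev j - x)) sums green x" by (rule green_sums[OF regular_negative[OF x(1)]])
  have "(\<Sum>j<N. weight j / (ev j - x)) \<le> (\<Sum>j. weight j / (ev j - x))"
  proof (rule sum_le_suminf[OF sums_summable[OF g]])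
    show "0 \<le> weight j / (ev j - x)" for j
      using ev_pos[of j] weight_pos[of j] x(1) by (intro divide_nonneg_nonneg) auto
  qed auto
  also have "\<dots> = green x" by (simp add: green_def)
  finally have "s \<le> green x" using b(2)[OF x(2,1)] by linarith
  from green_negative_root[OF s x(1) this] show "\<exists>\<nu><0. green \<nu> = s" by auto
qed

end

section \<open>Completeness of the eigenfunctions\<close>

context hierarchical_operator
begin

lemma L_form_nonneg: "f \<in> L2 \<Longrightarrow> 0 \<le> Re (L2_inner (L f) f)"
  unfolding L_eq_multiplier using L2_inner_multiplier_decreasing(1)[OF ev_decseq less_imp_le[OF ev_pos]] by simp

text \<open>On such h the operator L agrees with the multiplier whose values at the indices below K are lowered
  to \<open>ev K\<close>.\<close>

lemma L_form_le:
  assumes h: "h \<in> L2" and Q0: "\<And>j. j < K \<Longrightarrow> Q j h = 0"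
  shows "Re (L2_inner (L h) h) \<le> ev K * (L2_norm h)\<^sup>2"
proof -
  define m where "m j = ev (max j K)" for j
  have m: "decseq m" "\<And>j. 0 \<le> m j"
    using decseqD[OF ev_decseq] ev_pos by (auto simp: m_def decseq_def less_imp_le)
  note bv = bounded_variation_of_decreasing[OF m]
  have "L h = multiplier (\<lambda>k. of_real (m k)) h"
  proof (rule multiplier_eqI[OF bv h L_L2[OF h]])
    show "Q j (L h) = fscale (of_real (m j)) (Q j h)" for j
    proof (cases "j < K")
      case True
      then show ?thesis by (simp only: Q_L h Q0 fun_vs.scale_zero_right)
    next
      case False
      then have "m j = ev j" by (simp add: m_def)
      then show ?thesis by (simp only: Q_L h)
    qed
  qed
  then show ?thesis using L2_inner_multiplier_decreasing(2)[OF m h] by (simp add: m_def)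
qed

end

context rank_one_perturbation
begin

lemma eigenvalue_H_real_iff:
  assumes "regular_real \<mu>"
  shows "eigenvalue H (of_real \<mu>) \<longleftrightarrow> green \<mu> = 1 / \<sigma>"
proof -
  have "eigenvalue H (of_real \<mu>) \<longleftrightarrow> complex_of_real (\<sigma> * green \<mu>) = of_real 1"
    unfolding eigenvalue_H_regular_iff[OF assms] R_delta_eq_green[OF assms] by simp
  also have "\<dots> \<longleftrightarrow> green \<mu> = 1 / \<sigma>"
    unfolding of_real_eq_iff using \<sigma>_nonzero by (auto simp: field_simps)
  finally show ?thesis .
qed

text \<open>The eigenvalues of H outside the spectrum of L.\<close>

definition perturbed_root :: "real \<Rightarrow> bool" where
  "perturbed_root \<mu> \<longleftrightarrow> regular_real \<mu> \<and> green \<mu> = 1 / \<sigma>"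

lemma eigenfunction_at_root:
  assumes "perturbed_root \<mu>"
  shows "eigenfunction H (of_real \<mu>) (R (of_real \<mu>) (delta a))"
proof (rule R_delta_eigenfunction)
  show r: "regular_real \<mu>" using assms by (simp add: perturbed_root_def)
  show "of_real \<sigma> * R (of_real \<mu>) (delta a) a = 1"
    using eigenvalue_H_real_iff[OF r] eigenvalue_H_regular_iff[OF r] assms by (simp add: perturbed_root_def)
qed

definition gap_root :: "nat \<Rightarrow> real" where
  "gap_root k = (THE \<nu>. \<nu> \<in> {ev (Suc k)<..<ev k} \<and> green \<nu> = 1 / \<sigma>)"

lemma gap_root: "gap_root k \<in> {ev (Suc k)<..<ev k}" "green (gap_root k) = 1 / \<sigma>"
  using theI'[OF ex1_root_in_gap[of k "1 / \<sigma>"]] by (simp_all add: gap_root_def)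

lemma gap_root_unique: "\<nu> \<in> {ev (Suc k)<..<ev k} \<Longrightarrow> green \<nu> = 1 / \<sigma> \<Longrightarrow> \<nu> = gap_root k"
  using ex1_root_in_gap[of k "1 / \<sigma>"] gap_root[of k] by blast

lemma perturbed_root_gap_root: "perturbed_root (gap_root k)"
  by (simp add: perturbed_root_def gap_root regular_in_gap[OF gap_root(1)])

lemma gap_root_less: "j < k \<Longrightarrow> gap_root k < gap_root j"
  using gap_root(1)[of j] gap_root(1)[of k] decseqD[OF ev_decseq, of "Suc j" k] by force

lemma countable_perturbed_roots: "countable {\<mu>. perturbed_root \<mu>}"
proof -
  have neg: "\<exists>x. {\<mu>. \<mu> < 0 \<and> green \<mu> = 1 / \<sigma>} \<subseteq> {x}"
  proof (cases "{\<mu>. \<mu> < 0 \<and> green \<mu> = 1 / \<sigma>} = {}")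
    case False
    then obtain x where x: "x < 0" "green x = 1 / \<sigma>" by blast
    have "\<mu> = x" if "\<mu> < 0" "green \<mu> = 1 / \<sigma>" for \<mu>
      using green_strict_mono_negative[of x \<mu>] green_strict_mono_negative[of \<mu> x] x that
      by (cases \<mu> x rule: linorder_cases) auto
    then show ?thesis by blast
  qed blast
  have above: "\<exists>x. {\<mu>. ev 0 < \<mu> \<and> green \<mu> = 1 / \<sigma>} \<subseteq> {x}"
  proof (cases "{\<mu>. ev 0 < \<mu> \<and> green \<mu> = 1 / \<sigma>} = {}")
    case False
    then obtain x where x: "ev 0 < x" "green x = 1 / \<sigma>" by blast
    have "\<mu> = x" if "ev 0 < \<mu>" "green \<mu> = 1 / \<sigma>" for \<mu>
      using green_strict_mono_above[of x \<mu>] green_strict_mono_above[of \<mu> x] x that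
      by (cases \<mu> x rule: linorder_cases) auto
    then show ?thesis by blast
  qed blast
  obtain x y where xy: "{\<mu>. \<mu> < 0 \<and> green \<mu> = 1 / \<sigma>} \<subseteq> {x}" "{\<mu>. ev 0 < \<mu> \<and> green \<mu> = 1 / \<sigma>} \<subseteq> {y}"
    using neg above by blast
  have "{\<mu>. perturbed_root \<mu>} \<subseteq> {x, y} \<union> range gap_root"
  proof
    fix \<mu> assume "\<mu> \<in> {\<mu>. perturbed_root \<mu>}"
    then have \<mu>: "\<mu> \<noteq> 0" "\<And>j. ev j \<noteq> \<mu>" "green \<mu> = 1 / \<sigma>"
      by (auto simp: perturbed_root_def regular_real_iff)
    from ev_cases[OF \<mu>(1,2)] consider "\<mu> < 0" | "ev 0 < \<mu>" | k where "\<mu> \<in> {ev (Suc k)<..<ev k}" by blast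
    then show "\<mu> \<in> {x, y} \<union> range gap_root"
    proof cases
      case 3
      then show ?thesis using gap_root_unique \<mu>(3) by blast
    qed (use \<mu>(3) xy in auto)
  qed
  then show ?thesis by (rule countable_subset) auto
qed

text \<open>When the Green function at 0 equals \<open>1 / \<sigma>\<close> exactly, 0 can be an eigenvalue of H, and a basis
  of eigenfunctions then has to contain an eigenfunction for it.\<close>

lemma kernel_at_most_one_dimensional:
  "\<exists>\<psi>\<in>eigenspace H 0. \<forall>f\<in>eigenspace H 0. \<exists>c. f = fscale c \<psi>"
proof -
  note sub = eigenspace_subspace[OF symmetric_H, of 0]
  have nz: "complex_of_real (ev j) \<noteq> 0" for j using ev_pos[of j] by simp
  show ?thesis
  proof (cases "\<forall>f\<in>eigenspace H 0. f a = 0")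
    case True
    have z: "0 \<in> eigenspace H 0" by (rule fun_vs.subspace_0[OF sub])
    have "f = fscale 1 0" if "f \<in> eigenspace H 0" for f
      using eigenvector_determined_by_value[OF that _ nz] True that by simp
    then show ?thesis using z by blast
  next
    case False
    then obtain \<psi> where \<psi>: "\<psi> \<in> eigenspace H 0" "\<psi> a \<noteq> 0" by blast
    have "f = fscale (f a / \<psi> a) \<psi>" if "f \<in> eigenspace H 0" for f
    proof -
      have "f - fscale (f a / \<psi> a) \<psi> \<in> eigenspace H 0"
        by (intro fun_vs.subspace_diff[OF sub] fun_vs.subspace_scale[OF sub] that \<psi>)
      moreover have "(f - fscale (f a / \<psi> a) \<psi>) a = 0" using \<psi>(2) by (simp add: fscale_def)
      ultimately have "f - fscale (f a / \<psi> a) \<psi> = 0"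
        by (rule eigenvector_determined_by_value[OF _ _ nz])
      then show ?thesis by simp
    qed
    then show ?thesis using \<psi>(1) by blast
  qed
qed

lemma eigen_proj_add: "eigen_proj k (f + g) = eigen_proj k f + eigen_proj k g"
  by (simp add: eigen_proj_def Q_add add_divide_distrib fun_vs.scale_left_distrib)

lemma eigen_proj_fscale: "eigen_proj k (fscale c f) = fscale c (eigen_proj k f)"
  by (simp add: eigen_proj_def Q_fscale fun_vs.scale_right_diff_distrib) (simp add: fscale_def)

text \<open>The orthogonal complement of the eigenspaces of H at the points \<open>ev k\<close>. It is the subspace in which
  each component Q j f is a multiple of \<open>Q j (delta a)\<close>.\<close>

definition cyclic :: "('a \<Rightarrow> complex) set" where
  "cyclic = {f \<in> L2. \<forall>j. eigen_proj j f = 0}"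

lemma cyclic_subspace: "fun_vs.subspace cyclic"
proof (rule fun_vs.subspaceI)
  show "0 \<in> cyclic" using eigen_proj_fscale[of _ 0 0] by (simp add: cyclic_def fun_vs.scale_zero_left)
  show "x + y \<in> cyclic" if "x \<in> cyclic" "y \<in> cyclic" for x y
    using that by (simp add: cyclic_def L2_add eigen_proj_add)
  show "fscale c x \<in> cyclic" if "x \<in> cyclic" for c x
    using that by (simp add: cyclic_def L2_fscale eigen_proj_fscale)
qed

lemma cyclic_Q_eq_0:
  assumes "f \<in> cyclic" "Q j f a = 0"
  shows "Q j f = 0"
proof -
  have "eigen_proj j f = 0" using assms(1) by (simp add: cyclic_def)
  then show ?thesis using assms(2) by (simp add: eigen_proj_def fun_vs.scale_zero_left)
qed

lemma R_delta_cyclic: "regular z \<Longrightarrow> R z (delta a) \<in> cyclic"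
proof -
  assume z: "regular z"
  have "eigen_proj j (R z (delta a)) = 0" for j
    using weight_pos[of j] by (simp add: eigen_proj_def Q_R z fscale_def Q_delta_self fun_eq_iff)
  then show ?thesis by (simp add: cyclic_def R_L2 z)
qed

text \<open>The functions orthogonal to all eigenfunctions of H with eigenvalue different from 0.\<close>

definition residual :: "('a \<Rightarrow> complex) set" where
  "residual = {g \<in> cyclic. \<forall>\<mu>. perturbed_root \<mu> \<longrightarrow> L2_inner g (R (of_real \<mu>) (delta a)) = 0}"

lemma residual_L2: "g \<in> residual \<Longrightarrow> g \<in> L2"
  by (simp add: residual_def cyclic_def)

lemma residual_orth: "g \<in> residual \<Longrightarrow> perturbed_root \<mu> \<Longrightarrow> L2_inner g (R (of_real \<mu>) (delta a)) = 0"
  by (simp add: residual_def)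

lemma root_L2: "perturbed_root \<mu> \<Longrightarrow> R (of_real \<mu>) (delta a) \<in> L2"
  by (simp add: R_L2 perturbed_root_def)

lemma residual_add: "f \<in> residual \<Longrightarrow> g \<in> residual \<Longrightarrow> f + g \<in> residual"
  using fun_vs.subspace_add[OF cyclic_subspace, of f g]
  by (simp add: residual_def cyclic_def L2_inner_add_left root_L2)

lemma residual_H: 
  assumes g: "g \<in> residual"
  shows "H g \<in> residual"
proof -
  note gL = residual_L2[OF g]
  have "eigen_proj k (H g) = 0" for k
  proof (rule orthogonal_to_eigen_proj_delta[OF H_L2[OF gL]])
    fix y
    have "eigen_proj k g = 0" using g by (simp add: residual_def cyclic_def)
    then have "L2_inner g (eigen_proj k (delta y)) = 0"
      using L2_inner_eigen_proj[OF gL delta_in_L2, of k y] by simp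
    moreover have "H (eigen_proj k (delta y)) = fscale (of_real (ev k)) (eigen_proj k (delta y))"
      using eigen_proj_in_eigenspace[OF delta_in_L2, of k y] by (simp add: eigenspace_def)
    ultimately show "L2_inner (H g) (eigen_proj k (delta y)) = 0"
      using symmetric_on_L2_inner[OF symmetric_H gL eigen_proj_L2[OF delta_in_L2], of k y]
      by (simp add: L2_inner_fscale_right)
  qed
  moreover have "L2_inner (H g) (R (of_real \<mu>) (delta a)) = 0" if "perturbed_root \<mu>" for \<mu>
  proof -
    have "H (R (of_real \<mu>) (delta a)) = fscale (of_real \<mu>) (R (of_real \<mu>) (delta a))"
      using eigenfunction_at_root[OF that] by (simp add: eigenfunction_def eigenspace_def)
    then show ?thesis
      using symmetric_on_L2_inner[OF symmetric_H gL root_L2[OF that]] residual_orth[OF g that]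
      by (simp add: L2_inner_fscale_right)
  qed
  ultimately show ?thesis by (simp add: residual_def cyclic_def H_L2 gL)
qed

lemma symmetric_scaled_H: "symmetric_on_L2 (\<lambda>f. fscale (of_real s) (H f))"
proof -
  have "fscale (of_real s) (H (fscale c f)) = fscale c (fscale (of_real s) (H f))" if "f \<in> L2" for c f
    using symmetric_on_L2_fscale[OF symmetric_H that, of c] by (simp add: mult.commute)
  then show ?thesis
    unfolding symmetric_on_L2_def
    using symmetric_on_L2_add[OF symmetric_H] symmetric_on_L2_inner[OF symmetric_H]
    by (simp add: H_L2 L2_fscale fun_vs.scale_right_distrib L2_inner_fscale_left L2_inner_fscale_right)
qed

text \<open>The min-max principle for g and the eigenfunctions at n perturbed eigenvalues. The sign s makes the
  statement applicable to both bounds of the form of H.\<close>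

lemma residual_form_bound:
  fixes s t :: real and l :: "nat \<Rightarrow> ('a \<Rightarrow> complex) \<Rightarrow> complex"
  assumes g: "g \<in> residual"
    and \<mu>: "\<And>i. i < N \<Longrightarrow> perturbed_root (\<mu> i)" "\<And>i. i < N \<Longrightarrow> t < s * \<mu> i" "inj_on \<mu> {..<N}"
    and l: "\<And>i f g. l i (f + g) = l i f + l i g" "\<And>i c f. l i (fscale c f) = c * l i f"
    and bound: "\<And>h. h \<in> cyclic \<Longrightarrow> (\<And>i. i < N \<Longrightarrow> l i h = 0) \<Longrightarrow>
      s * Re (L2_inner (H h) h) \<le> t * (L2_norm h)\<^sup>2"
  shows "s * Re (L2_inner (H g) g) \<le> t * (L2_norm g)\<^sup>2"
proof -
  define v where "v i = (if i < N then R (of_real (\<mu> i)) (delta a) else g)" for i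
  have v_root: "v i = R (of_real (\<mu> i)) (delta a)" if "i < N" for i using that by (simp add: v_def)
  have v_g: "v N = g" by (simp add: v_def)
  have eig: "eigenfunction H (of_real (\<mu> i)) (v i)" if "i < N" for i
    unfolding v_root[OF that] by (rule eigenfunction_at_root[OF \<mu>(1)[OF that]])
  have vc: "v i \<in> cyclic" for i
    using \<mu>(1) R_delta_cyclic g by (auto simp: v_def residual_def perturbed_root_def)
  have vL: "v i \<in> L2" for i using vc by (simp add: cyclic_def)
  have gv: "L2_inner g (v i) = 0" if "i < N" for i
    unfolding v_root[OF that] by (rule residual_orth[OF g \<mu>(1)[OF that]])
  have vv: "L2_inner (v i) (v j) = 0" if "i < N" "j < N" "i \<noteq> j" for i j
  proof (rule eigenspaces_orthogonal[OF symmetric_H])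
    show "v i \<in> eigenspace H (of_real (\<mu> i))" "v j \<in> eigenspace H (of_real (\<mu> j))"
      using eig that by (auto simp: eigenfunction_def)
    show "complex_of_real (\<mu> i) \<noteq> of_real (\<mu> j)" using inj_onD[OF \<mu>(3), of i j] that by auto
  qed
  let ?T = "\<lambda>f. fscale (of_real s) (H f)"
  have l_sum: "l i (\<Sum>j\<in>I. fscale (c j) (v j)) = (\<Sum>j\<in>I. c j * l i (v j))" if "finite I" for i I c
    using that
  proof (induction I rule: finite_induct)
    case empty
    have "l i 0 = 0" using l(2)[of i 0 0] by (simp only: fun_vs.scale_zero_left mult_zero_left)
    then show ?case unfolding sum.empty .
  next
    case (insert x I)
    then show ?case unfolding sum.insert[OF insert(1,2)] by (simp only: l)
  qed
  have "Re (L2_inner (?T (v N)) (v N)) \<le> t * (L2_norm (v N))\<^sup>2"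
  proof (rule minimax_upper_bound[OF symmetric_scaled_H, where \<mu> = "\<lambda>i. s * \<mu> i" and l = l])
    show "L2_inner (v i) (v j) = 0" if "i \<le> N" "j \<le> N" "i \<noteq> j" for i j
    proof -
      consider "i < N" "j < N" | "i = N" "j < N" | "i < N" "j = N" using \<open>i \<le> N\<close> \<open>j \<le> N\<close> \<open>i \<noteq> j\<close> by linarith
      then show ?thesis
      proof cases
        case 1
        then show ?thesis using vv that(3) by simp
      next
        case 2
        then show ?thesis using gv by (simp add: v_g)
      next
        case 3
        then show ?thesis using gv L2_inner_commute[of "v i" g] by (simp add: v_g)
      qed
    qed
    show "?T (v i) = fscale (of_real (s * \<mu> i)) (v i)" if "i < N" for i
      using eig[OF that] by (simp add: eigenfunction_def eigenspace_def)
    show "v i \<noteq> 0" if "i < N" for i using eig[OF that] by (simp add: eigenfunction_def)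
    show "Re (L2_inner (?T h) h) \<le> t * (L2_norm h)\<^sup>2"
      if h: "h \<in> fun_vs.span (v ` {..N})" and l0: "\<And>i. i < N \<Longrightarrow> l i h = 0" for h
    proof -
      have "fun_vs.span (v ` {..N}) \<subseteq> cyclic"
        using vc by (intro fun_vs.span_minimal cyclic_subspace) auto
      then have "h \<in> cyclic" using h by (rule subsetD)
      from bound[OF this l0] show ?thesis by (simp add: L2_inner_fscale_left)
    qed
  qed (use vL \<mu>(2) l_sum in auto)
  then show ?thesis by (simp add: v_g L2_inner_fscale_left)
qed

lemma H_form: "f \<in> L2 \<Longrightarrow> Re (L2_inner (H f) f) = Re (L2_inner (L f) f) - \<sigma> * (cmod (f a))\<^sup>2"
proof -
  assume f: "f \<in> L2"
  have "f a * cnj (f a) = of_real ((cmod (f a))\<^sup>2)" by (simp only: complex_norm_square)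
  then have "L2_inner (H f) f = L2_inner (L f) f - of_real (\<sigma> * (cmod (f a))\<^sup>2)"
    unfolding L2_inner_H[OF f f] by (simp only: mult.assoc of_real_mult)
  then show ?thesis by simp
qed

text \<open>For \<open>\<sigma> > 0\<close> the K roots in the gaps above \<open>ev K\<close> are matched by the K conditions \<open>Q i h a = 0\<close>, i < K,
  under which the form of L is at most \<open>ev K\<close>; the perturbation only lowers it. For \<open>\<sigma> < 0\<close> there is one more
  root, above \<open>ev 0\<close>, and one more condition, \<open>h a = 0\<close>, which removes the perturbation.\<close>

lemma residual_form_le:
  assumes g: "g \<in> residual"
  shows "Re (L2_inner (H g) g) \<le> ev K * (L2_norm g)\<^sup>2"
proof -
  have gr: "ev K < gap_root i" if "i < K" for i
    using gap_root(1)[of i] decseqD[OF ev_decseq, of "Suc i" K] that by auto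
  have inj: "inj gap_root"
    by (rule inj_onI) (metis gap_root_less linorder_neqE_nat order_less_irrefl)
  have lin: "Q i (f + g) a = Q i f a + Q i g a" "Q i (fscale c f) a = c * Q i f a" for i f g c
    by (simp_all add: Q_add Q_fscale) (simp add: fscale_def)
  have "1 * Re (L2_inner (H g) g) \<le> ev K * (L2_norm g)\<^sup>2"
  proof (cases "\<sigma> > 0")
    case True
    show ?thesis
    proof (rule residual_form_bound[OF g, where N = K and \<mu> = gap_root and l = "\<lambda>i f. Q i f a"])
      fix h assume h: "h \<in> cyclic" "\<And>i. i < K \<Longrightarrow> Q i h a = 0"
      then have hL: "h \<in> L2" by (simp add: cyclic_def)
      have "Re (L2_inner (L h) h) \<le> ev K * (L2_norm h)\<^sup>2"
        by (rule L_form_le[OF hL]) (use h cyclic_Q_eq_0 in blast)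
      then show "1 * Re (L2_inner (H h) h) \<le> ev K * (L2_norm h)\<^sup>2"
        using True H_form[OF hL] by (smt (verit) mult_nonneg_nonneg zero_le_power2)
    qed (use gr inj perturbed_root_gap_root lin in \<open>auto intro: inj_on_subset\<close>)
  next
    case False
    then have s: "1 / \<sigma> < 0" using \<sigma>_nonzero by auto
    obtain p where p: "ev 0 < p" "green p = 1 / \<sigma>" using ex1_root_above[OF s] by auto
    define \<mu> where "\<mu> i = (if i < K then gap_root i else p)" for i
    define l where "l i f = (if i < K then Q i f a else f a)" for i and f :: "'a \<Rightarrow> complex"
    have pr: "perturbed_root p" using p regular_above by (simp add: perturbed_root_def)
    have evp: "ev K < p" using p(1) decseqD[OF ev_decseq, of 0 K] by simp
    have gp: "gap_root i \<noteq> p" for i using gap_root(1)[of i] p(1) decseqD[OF ev_decseq, of 0 i] by force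
    show ?thesis
    proof (rule residual_form_bound[OF g, where N = "Suc K" and \<mu> = \<mu> and l = l])
      show "inj_on \<mu> {..<Suc K}"
        using gp injD[OF inj] by (auto simp: inj_on_def \<mu>_def less_Suc_eq)
      fix h assume h: "h \<in> cyclic" "\<And>i. i < Suc K \<Longrightarrow> l i h = 0"
      then have hL: "h \<in> L2" by (simp add: cyclic_def)
      have ha: "h a = 0" using h(2)[of K] by (simp add: l_def)
      have "Q i h a = 0" if "i < K" for i using h(2)[of i] that by (simp add: l_def)
      then have "Re (L2_inner (L h) h) \<le> ev K * (L2_norm h)\<^sup>2"
        by (intro L_form_le[OF hL] cyclic_Q_eq_0[OF h(1)])
      then show "1 * Re (L2_inner (H h) h) \<le> ev K * (L2_norm h)\<^sup>2"
        using H_form[OF hL] by (simp add: ha)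
    qed (use pr evp gr perturbed_root_gap_root lin in \<open>auto simp: \<mu>_def l_def fscale_def\<close>)
  qed
  then show ?thesis by simp
qed

text \<open>For \<open>\<nu> < 0\<close> let \<open>u = R \<nu> (delta a)\<close> and let p be h minus the multiple of u that has the same value at a.
  The form of the positive operator L - \<open>\<nu>\<close> at p is its value at h minus \<open>|h a|\<^sup>2 / green \<nu>\<close>, and
  \<open>1 / green \<nu> \<ge> \<sigma>\<close> in the absence of a root. So the form of H is at least that of \<open>\<nu>\<close>, for all \<open>\<nu> < 0\<close>.\<close>

lemma form_nonneg_without_negative_root:
  assumes \<sigma>: "\<sigma> > 0" and no_root: "\<And>\<nu>. \<nu> < 0 \<Longrightarrow> green \<nu> \<noteq> 1 / \<sigma>" and h: "h \<in> L2"
  shows "0 \<le> Re (L2_inner (H h) h)"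
proof -
  have bound: "\<nu> * (L2_norm h)\<^sup>2 \<le> Re (L2_inner (H h) h)" if \<nu>: "\<nu> < 0" for \<nu>
  proof -
    note r = regular_negative[OF \<nu>]
    define G where "G = green \<nu>"
    define u where "u = R (of_real \<nu>) (delta a)"
    define S where "S f = L f - fscale (of_real \<nu>) f" for f
    have G0: "0 < G" unfolding G_def by (rule green_negative(1)[OF \<nu>])
    have "\<not> 1 / \<sigma> \<le> G"
    proof
      assume "1 / \<sigma> \<le> G"
      then have "\<exists>!\<nu>. \<nu> \<in> {..<0} \<and> green \<nu> = 1 / \<sigma>"
        unfolding G_def by (intro green_negative_root[OF _ \<nu>]) (use \<sigma> in simp)
      then show False using no_root by auto
    qed
    then have G: "\<sigma> \<le> 1 / G" using G0 \<sigma> by (simp add: field_simps)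
    have uL: "u \<in> L2" unfolding u_def by (rule R_L2[OF r delta_in_L2])
    have Su: "S u = delta a" unfolding S_def using resolvent_equation_iff[OF r uL delta_in_L2] by (simp add: u_def)
    have ua: "u a = of_real G" unfolding u_def G_def by (rule R_delta_eq_green[OF r])
    have SL: "S f \<in> L2" if "f \<in> L2" for f using that by (simp add: S_def L2_diff L_L2 L2_fscale)
    have S_form: "Re (L2_inner (S f) f) = Re (L2_inner (L f) f) - \<nu> * (L2_norm f)\<^sup>2" if "f \<in> L2" for f
      using that by (simp add: S_def L2_inner_diff_left L_L2 L2_fscale L2_inner_fscale_left L2_inner_self)
    have S_sym: "L2_inner (S f) g = L2_inner f (S g)" if "f \<in> L2" "g \<in> L2" for f g
      using that by (simp add: S_def L2_inner_diff_left L2_inner_diff_right L_L2 L2_fscale L2_inner_fscale_left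
          L2_inner_fscale_right L2_inner_L)
    define t where "t = h a / of_real G"
    define p where "p = h - fscale t u"
    have pL: "p \<in> L2" unfolding p_def by (intro L2_diff h L2_fscale uL)
    have Sp: "S p = S h - fscale t (delta a)"
    proof -
      have "L p = L h - fscale t (L u)"
        using L_add[OF h L2_fscale[OF uL, of "- t"]] L_fscale[OF uL, of "- t"]
        by (simp add: p_def fun_vs.scale_minus_left)
      then have "S p = S h - fscale t (S u)"
        by (simp add: S_def p_def fun_vs.scale_right_diff_distrib mult.commute)
      then show ?thesis by (simp only: Su)
    qed
    have pa: "p a = 0" using G0 by (simp add: p_def fscale_def t_def ua)
    have "L2_inner (S p) p = L2_inner (S h) p"
    proof -
      have "L2_inner (delta a) p = cnj (p a)" by (subst L2_inner_commute) (simp add: L2_inner_delta)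
      then show ?thesis unfolding Sp
        by (simp add: L2_inner_diff_left SL h L2_fscale pL L2_inner_fscale_left pa)
    qed
    also have "\<dots> = L2_inner (S h) h - cnj t * h a"
      using S_sym[OF h uL]
      by (simp add: p_def L2_inner_diff_right SL h L2_fscale uL L2_inner_fscale_right Su L2_inner_delta)
    also have "cnj t * h a = of_real ((cmod (h a))\<^sup>2 / G)"
    proof -
      have "cnj t * h a = (h a * cnj (h a)) / of_real G" by (simp add: t_def)
      also have "h a * cnj (h a) = of_real ((cmod (h a))\<^sup>2)" by (simp only: complex_norm_square)
      finally show ?thesis by simp
    qed
    finally have "Re (L2_inner (S p) p) = Re (L2_inner (S h) h) - (cmod (h a))\<^sup>2 / G" by simp
    moreover have "0 \<le> Re (L2_inner (S p) p)"
      using S_form[OF pL] L_form_nonneg[OF pL] \<nu> mult_nonpos_nonneg[of \<nu> "(L2_norm p)\<^sup>2"] by simp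
    moreover have "\<sigma> * (cmod (h a))\<^sup>2 \<le> (cmod (h a))\<^sup>2 / G"
      using mult_right_mono[OF G, of "(cmod (h a))\<^sup>2"] by simp
    ultimately have "\<nu> * (L2_norm h)\<^sup>2 \<le> Re (L2_inner (L h) h) - \<sigma> * (cmod (h a))\<^sup>2"
      using S_form[OF h] by linarith
    then show ?thesis unfolding H_form[OF h] .
  qed
  show ?thesis
  proof (rule ccontr)
    define X where "X = Re (L2_inner (H h) h)"
    define N where "N = (L2_norm h)\<^sup>2"
    assume "\<not> ?thesis"
    then have X: "X < 0" by (simp add: X_def)
    have N: "0 \<le> N" by (simp add: N_def)
    \<comment> \<open>This negative number is so close to 0 that the bound contradicts the negative value X.\<close>
    have "X / (N + 1) < 0" using X N by (simp add: divide_neg_pos)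
    from bound[OF this] have "X / (N + 1) * N \<le> X" by (simp add: X_def N_def)
    then have "X * N \<le> X * (N + 1)" using N by (simp add: field_simps)
    then show False using X by (simp add: algebra_simps)
  qed
qed

text \<open>A negative root is matched by the condition \<open>h a = 0\<close>, under which the forms of H and L agree.\<close>

lemma residual_form_nonneg:
  assumes g: "g \<in> residual"
  shows "0 \<le> Re (L2_inner (H g) g)"
proof -
  note gL = residual_L2[OF g]
  consider "\<sigma> < 0" | "\<sigma> > 0" "\<And>\<nu>. \<nu> < 0 \<Longrightarrow> green \<nu> \<noteq> 1 / \<sigma>"
    | \<nu> where "\<sigma> > 0" "\<nu> < 0" "green \<nu> = 1 / \<sigma>"
    using \<sigma>_nonzero by (meson linorder_neqE_linordered_idom)
  then show ?thesis
  proof cases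
    case 1
    then have "\<sigma> * (cmod (g a))\<^sup>2 \<le> 0" by (simp add: mult_nonpos_nonneg)
    then show ?thesis using H_form[OF gL] L_form_nonneg[OF gL] by linarith
  next
    case 2
    then show ?thesis using form_nonneg_without_negative_root gL by blast
  next
    case 3
    then have pr: "perturbed_root \<nu>" using regular_negative by (simp add: perturbed_root_def)
    have "(- 1) * Re (L2_inner (H g) g) \<le> 0 * (L2_norm g)\<^sup>2"
    proof (rule residual_form_bound[OF g, where N = 1 and \<mu> = "\<lambda>_. \<nu>" and l = "\<lambda>_ f. f a"])
      fix h assume h: "h \<in> cyclic" "\<And>i. i < (1::nat) \<Longrightarrow> h a = 0"
      then have hL: "h \<in> L2" and ha: "h a = 0" by (auto simp: cyclic_def)
      show "- 1 * Re (L2_inner (H h) h) \<le> 0 * (L2_norm h)\<^sup>2"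
        using H_form[OF hL] L_form_nonneg[OF hL] by (simp add: ha)
    qed (use 3 pr in \<open>auto simp: fscale_def inj_on_def\<close>)
    then show ?thesis by simp
  qed
qed

text \<open>By the two bounds the form of H vanishes on the invariant subspace \<open>residual\<close>. At g + H g it has the
  value \<open>2 \<parallel>H g\<parallel>\<^sup>2\<close>.\<close>

lemma residual_kernel:
  assumes g: "g \<in> residual"
  shows "H g = 0"
proof -
  have zero: "Re (L2_inner (H f) f) = 0" if f: "f \<in> residual" for f
  proof -
    have "(\<lambda>K. ev K * (L2_norm f)\<^sup>2) \<longlonglongrightarrow> 0 * (L2_norm f)\<^sup>2"
      by (intro tendsto_intros ev_tendsto_0)
    then have "Re (L2_inner (H f) f) \<le> 0 * (L2_norm f)\<^sup>2"
      by (rule LIMSEQ_le_const) (use residual_form_le[OF f] in auto)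
    then show ?thesis using residual_form_nonneg[OF f] by simp
  qed
  define k where "k = H g"
  have kW: "k \<in> residual" unfolding k_def by (rule residual_H[OF g])
  note gL = residual_L2[OF g] and kL = residual_L2[OF kW]
  have "L2_inner (H (g + k)) (g + k) =
      L2_inner (H g) g + L2_inner (H g) k + (L2_inner (H k) g + L2_inner (H k) k)"
    by (simp add: symmetric_on_L2_add[OF symmetric_H gL kL] L2_inner_add_left L2_inner_add_right H_L2 gL kL L2_add)
  also have "L2_inner (H k) g = L2_inner k k"
    using symmetric_on_L2_inner[OF symmetric_H kL gL] by (simp add: k_def)
  also have "L2_inner (H g) k = L2_inner k k" by (simp add: k_def)
  finally have "Re (L2_inner (H (g + k)) (g + k)) =
      Re (L2_inner (H g) g) + Re (L2_inner k k) + (Re (L2_inner k k) + Re (L2_inner (H k) k))"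
    by (simp only: plus_complex.sel)
  then have "Re (L2_inner k k) = 0" using zero[OF residual_add[OF g kW]] zero[OF g] zero[OF kW] by simp
  then have "L2_norm k = 0" by (simp add: L2_inner_self)
  then show ?thesis using L2_norm_eq_0_iff[OF kL] by (simp add: k_def)
qed

lemma pure_point_spectrum_H:
  assumes count: "countable (UNIV :: 'a set)"
  shows "pure_point_spectrum H"
proof -
  obtain \<psi> where \<psi>: "\<psi> \<in> eigenspace H 0" "\<And>f. f \<in> eigenspace H 0 \<Longrightarrow> \<exists>c. f = fscale c \<psi>"
    using kernel_at_most_one_dimensional by blast
  define S where "S = insert \<psi> ((\<lambda>(k, y). eigen_proj k (delta y)) ` UNIV \<union>
     (\<lambda>\<mu>. R (of_real \<mu>) (delta a)) ` {\<mu>. perturbed_root \<mu>})"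
  have SU: "S \<subseteq> \<Union>(range (eigenspace H))"
  proof
    fix v assume "v \<in> S"
    then consider "v = \<psi>" | k y where "v = eigen_proj k (delta y)"
      | \<mu> where "perturbed_root \<mu>" "v = R (of_real \<mu>) (delta a)"
      by (auto simp: S_def)
    then have "\<exists>z. v \<in> eigenspace H z"
    proof cases
      case 1
      then show ?thesis using \<psi>(1) by blast
    next
      case 2
      then show ?thesis using eigen_proj_in_eigenspace[OF delta_in_L2] by blast
    next
      case 3
      then show ?thesis using eigenfunction_at_root unfolding eigenfunction_def by blast
    qed
    then show "v \<in> \<Union>(range (eigenspace H))" by blast
  qed
  have "\<exists>E. orthonormal_basis_of E L2 \<and> E \<subseteq> \<Union>(range (eigenspace H))"
  proof (rule orthonormal_basis_from_total_set[where S = S])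
    show "fun_vs.subspace U \<and> U \<subseteq> L2" if "U \<in> range (eigenspace H)" for U
      using that eigenspace_subspace[OF symmetric_H] by (auto simp: eigenspace_def)
    show "pairwise (\<lambda>U U'. \<forall>u\<in>U. \<forall>u'\<in>U'. L2_inner u u' = 0) (range (eigenspace H))"
      unfolding pairwise_def
    proof (intro ballI impI)
      fix U U' u u' assume U: "U \<in> range (eigenspace H)" "U' \<in> range (eigenspace H)" "U \<noteq> U'" "u \<in> U" "u' \<in> U'"
      then obtain z z' where z: "U = eigenspace H z" "U' = eigenspace H z'" by blast
      then have "z \<noteq> z'" using U(3) by auto
      then show "L2_inner u u' = 0" using eigenspaces_orthogonal[OF symmetric_H] U(4,5) z by blast
    qed
    show "countable S"
      unfolding S_def using count countable_perturbed_roots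
      by (intro countable_insert countable_Un countable_image) (use count in \<open>simp_all add: countable_SIGMA UNIV_Times_UNIV[symmetric] del: UNIV_Times_UNIV\<close>)
    show "S \<subseteq> \<Union>(range (eigenspace H))" by (rule SU)
    fix g f assume g: "g \<in> L2" "\<And>v. v \<in> S \<Longrightarrow> L2_inner g v = 0"
    have "g \<in> residual"
    proof -
      have "eigen_proj k g = 0" for k
      proof (rule orthogonal_to_eigen_proj_delta[OF g(1)])
        show "L2_inner g (eigen_proj k (delta y)) = 0" for y
          by (rule g(2)) (auto simp: S_def)
      qed
      moreover have "L2_inner g (R (of_real \<mu>) (delta a)) = 0" if "perturbed_root \<mu>" for \<mu>
        by (rule g(2)) (use that in \<open>auto simp: S_def\<close>)
      ultimately show ?thesis by (simp add: residual_def cyclic_def g(1))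
    qed
    then have "H g = 0" by (rule residual_kernel)
    then have "g \<in> eigenspace H 0" by (simp add: eigenspace_def g(1) fun_vs.scale_zero_left)
    then obtain c where c: "g = fscale c \<psi>" using \<psi>(2) by blast
    have "L2_inner g g = cnj c * L2_inner g \<psi>" by (subst (2) c) (rule L2_inner_fscale_right)
    also have "L2_inner g \<psi> = 0" by (rule g(2)) (simp add: S_def)
    finally have "L2_norm g = 0" by (simp add: L2_inner_self)
    then have "g = 0" using L2_norm_eq_0_iff[OF g(1)] by simp
    then show "L2_inner g f = 0" by simp
  qed simp
  then obtain E where E: "orthonormal_basis_of E L2" "E \<subseteq> \<Union>(range (eigenspace H))" by blast
  have "\<exists>z. eigenfunction H z e" if e: "e \<in> E" for e
  proof -
    have "L2_inner e e = 1" using E(1) e by (simp add: orthonormal_basis_of_def)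
    then have "e \<noteq> 0" by auto
    moreover obtain z where "e \<in> eigenspace H z" using E(2) e by blast
    ultimately show ?thesis unfolding eigenfunction_def by blast
  qed
  then show ?thesis unfolding pure_point_spectrum_def using E(1) by blast
qed

end

section \<open>The heat kernel on the diagonal\<close>

context hierarchical_operator
begin

lemma
  assumes "f \<in> L2"
  shows L_power_L2: "(L ^^ i) f \<in> L2"
    and Q_L_power: "Q j ((L ^^ i) f) = fscale (of_real (ev j ^ i)) (Q j f)"
proof (induction i)
  case (Suc i)
  { case 1
    show ?case using Suc.IH(1) by (simp add: L_L2)
  next
    case 2
    show ?case using Suc.IH by (simp add: Q_L mult.commute)
  }
qed (use assms in auto)

lemma L_power_delta_sums: "(\<lambda>j. complex_of_real (weight j * ev j ^ i)) sums ((L ^^ i) (delta a) a)"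
proof -
  have "Q j ((L ^^ i) (delta a)) a = of_real (weight j * ev j ^ i)" for j
    by (simp only: Q_L_power[OF delta_in_L2] fscale_def Q_delta_self of_real_mult[symmetric] mult.commute)
  then show ?thesis using Q_sums[OF L_power_L2[OF delta_in_L2], of i a a] by simp
qed

text \<open>The value \<open>p(t, a, a)\<close> of the heat kernel, as the Laplace transform of the spectral measure.\<close>

definition heat_diag :: "real \<Rightarrow> real" where
  "heat_diag t = (\<Sum>j. weight j * exp (- t * ev j))"

lemma heat_diag_sums: "0 \<le> t \<Longrightarrow> (\<lambda>j. weight j * exp (- t * ev j)) sums heat_diag t"
  unfolding heat_diag_def
proof (rule summable_sums, rule summable_comparison_test'[OF sums_summable[OF weight_sums]])
  fix j assume "0 \<le> t"
  then have "exp (- t * ev j) \<le> 1" using ev_pos[of j] by simp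
  then show "norm (weight j * exp (- t * ev j)) \<le> weight j"
    using weight_pos[of j] by (simp add: abs_mult mult_left_le)
qed

text \<open>The exponential series is exchanged with the sum over the eigenvalues. All eigenvalues lie in
  [0, ev 0], so the remainder of the exponential series is bounded by its value at \<open>t * ev 0\<close>.\<close>

lemma exp_series_sums_heat:
  assumes t: "0 \<le> t"
  shows "(\<lambda>i. of_real ((- t) ^ i / fact i) * (L ^^ i) (delta a) a) sums complex_of_real (heat_diag t)"
proof -
  define A where "A i = (\<Sum>j. weight j * ev j ^ i)" for i
  have A: "(\<lambda>j. weight j * ev j ^ i) sums A i" and LA: "(L ^^ i) (delta a) a = of_real (A i)" for i
  proof -
    have "(\<lambda>j. weight j * ev j ^ i) sums Re ((L ^^ i) (delta a) a)"
      using sums_Re[OF L_power_delta_sums[of i a]] by simp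
    then show A: "(\<lambda>j. weight j * ev j ^ i) sums A i" by (simp add: A_def sums_iff)
    then have "(\<lambda>j. complex_of_real (weight j * ev j ^ i)) sums of_real (A i)" by (simp only: sums_of_real_iff)
    then show "(L ^^ i) (delta a) a = of_real (A i)" by (rule sums_unique2[OF L_power_delta_sums])
  qed
  define X where "X = t * ev 0"
  have X: "summable (\<lambda>i. X ^ i / fact i)"
    using summable_exp_generic[of X] by (simp add: divide_inverse mult.commute)
  define \<epsilon> where "\<epsilon> N = (\<Sum>i. X ^ (i + N) / fact (i + N))" for N
  have \<epsilon>: "\<epsilon> \<longlonglongrightarrow> 0" unfolding \<epsilon>_def[abs_def] using suminf_exist_split2[OF X] by simp
  have taylor: "\<bar>exp (- t * ev j) - (\<Sum>i<N. (- t) ^ i / fact i * ev j ^ i)\<bar> \<le> \<epsilon> N" for j N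
  proof -
    define y where "y = - t * ev j"
    have y: "\<bar>y\<bar> \<le> X"
      using t ev_pos[of j] decseqD[OF ev_decseq, of 0 j] by (simp add: y_def X_def abs_mult mult_left_mono)
    have s: "(\<lambda>i. y ^ i / fact i) sums exp y"
      using exp_converges[of y] by (simp add: divide_inverse mult.commute)
    have "exp y - (\<Sum>i<N. y ^ i / fact i) = (\<Sum>i. y ^ (i + N) / fact (i + N))"
      using suminf_split_initial_segment[OF sums_summable[OF s], of N] s by (simp add: sums_iff)
    also have "\<bar>\<dots>\<bar> \<le> \<epsilon> N"
      unfolding \<epsilon>_def real_norm_def[symmetric]
    proof (rule norm_suminf_le)
      show "norm (y ^ (i + N) / fact (i + N)) \<le> X ^ (i + N) / fact (i + N)" for i
        using power_mono[OF y, of "i + N"] by (simp add: power_abs divide_right_mono)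
      show "summable (\<lambda>i. X ^ (i + N) / fact (i + N))" by (rule summable_ignore_initial_segment[OF X])
    qed
    finally have "\<bar>exp y - (\<Sum>i<N. y ^ i / fact i)\<bar> \<le> \<epsilon> N" .
    moreover have "y ^ i / fact i = (- t) ^ i / fact i * ev j ^ i" for i
      unfolding y_def power_mult_distrib by simp
    ultimately show ?thesis by (simp only: y_def[symmetric])
  qed
  have "\<bar>heat_diag t - (\<Sum>i<N. (- t) ^ i / fact i * A i)\<bar> \<le> \<epsilon> N" for N
  proof -
    have "(\<lambda>j. \<Sum>i<N. (- t) ^ i / fact i * (weight j * ev j ^ i)) sums (\<Sum>i<N. (- t) ^ i / fact i * A i)"
      by (intro sums_sum sums_mult A)
    moreover have "(\<Sum>i<N. (- t) ^ i / fact i * (weight j * ev j ^ i)) = weight j * (\<Sum>i<N. (- t) ^ i / fact i * ev j ^ i)" for j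
      by (simp add: sum_distrib_left mult_ac)
    ultimately have "(\<lambda>j. weight j * (\<Sum>i<N. (- t) ^ i / fact i * ev j ^ i)) sums (\<Sum>i<N. (- t) ^ i / fact i * A i)"
      by simp
    from sums_diff[OF heat_diag_sums[OF t] this]
    have d: "(\<lambda>j. weight j * (exp (- t * ev j) - (\<Sum>i<N. (- t) ^ i / fact i * ev j ^ i))) sums
        (heat_diag t - (\<Sum>i<N. (- t) ^ i / fact i * A i))"
      by (simp only: right_diff_distrib)
    have e: "(\<lambda>j. weight j * \<epsilon> N) sums \<epsilon> N" using sums_mult2[OF weight_sums, of "\<epsilon> N"] by simp
    have b: "\<bar>weight j * (exp (- t * ev j) - (\<Sum>i<N. (- t) ^ i / fact i * ev j ^ i))\<bar> \<le> weight j * \<epsilon> N" for j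
      using mult_left_mono[OF taylor, of "weight j" j N] weight_pos[of j] by (simp add: abs_mult)
    have "heat_diag t - (\<Sum>i<N. (- t) ^ i / fact i * A i) \<le> \<epsilon> N"
      by (rule sums_le[OF _ d e]) (rule abs_le_D1[OF b])
    moreover have "- (heat_diag t - (\<Sum>i<N. (- t) ^ i / fact i * A i)) \<le> \<epsilon> N"
      by (rule sums_le[OF _ sums_minus[OF d] e]) (rule abs_le_D2[OF b])
    ultimately show ?thesis by linarith
  qed
  then have "(\<lambda>N. heat_diag t - (\<Sum>i<N. (- t) ^ i / fact i * A i)) \<longlonglongrightarrow> 0"
    by (intro Lim_null_comparison[OF _ \<epsilon>]) auto
  from tendsto_diff[OF tendsto_const[of "heat_diag t"] this]
  have "(\<lambda>i. (- t) ^ i / fact i * A i) sums heat_diag t" by (simp add: sums_def)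
  then have "(\<lambda>i. complex_of_real ((- t) ^ i / fact i * A i)) sums of_real (heat_diag t)"
    by (simp only: sums_of_real_iff)
  then show ?thesis by (simp only: LA of_real_mult)
qed

lemma heat_integral: "(\<integral>\<^sup>+t\<in>{0<..}. ennreal (heat_diag t) \<partial>lborel) = (\<Sum>j. ennreal (weight j / ev j))"
proof -
  have exp_int: "(\<integral>\<^sup>+t. ennreal (weight j * exp (- t * ev j)) * indicator {0..} t \<partial>lborel) = ennreal (weight j / ev j)" for j
  proof -
    have "(\<integral>\<^sup>+t. ennreal (weight j * exp (- t * ev j)) * indicator {0..} t \<partial>lborel) =
        ennreal (0 - (- (weight j / ev j) * exp (- 0 * ev j)))"
    proof (rule nn_integral_FTC_atLeast[where F = "\<lambda>t. - (weight j / ev j) * exp (- t * ev j)"])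
      show "((\<lambda>t. - (weight j / ev j) * exp (- t * ev j)) has_real_derivative weight j * exp (- x * ev j)) (at x)" for x
        using ev_pos[of j] by (auto intro!: derivative_eq_intros)
      have "filterlim (\<lambda>t. - (t * ev j)) at_bot at_top"
        using filterlim_tendsto_pos_mult_at_top[OF tendsto_const ev_pos filterlim_ident, of j]
        by (simp add: filterlim_uminus_at_bot mult.commute)
      then have "((\<lambda>t. exp (- (t * ev j))) \<longlongrightarrow> 0) at_top" by (rule filterlim_compose[OF exp_at_bot])
      from tendsto_mult[OF tendsto_const[of "- (weight j / ev j)"] this]
      show "((\<lambda>t. - (weight j / ev j) * exp (- t * ev j)) \<longlongrightarrow> 0) at_top" by simp
    qed (use weight_pos[of j] in auto)
    then show ?thesis by simp
  qed
  have "(\<integral>\<^sup>+t\<in>{0<..}. ennreal (heat_diag t) \<partial>lborel) =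
      (\<integral>\<^sup>+t. (\<Sum>j. ennreal (weight j * exp (- t * ev j)) * indicator {0..} t) \<partial>lborel)"
  proof (rule nn_integral_cong_AE)
    \<comment> \<open>The integral over the open half-line equals that over the closed one.\<close>
    have "AE t in lborel. t \<noteq> (0::real)" by (rule AE_lborel_singleton)
    then show "AE t in lborel. ennreal (heat_diag t) * indicator {0<..} t =
      (\<Sum>j. ennreal (weight j * exp (- t * ev j)) * indicator {0..} t)"
    proof (rule AE_mp, intro AE_I2 impI)
      fix t :: real assume "t \<noteq> 0"
      show "ennreal (heat_diag t) * indicator {0<..} t = (\<Sum>j. ennreal (weight j * exp (- t * ev j)) * indicator {0..} t)"
      proof (cases "0 < t")
        case True
        note s = heat_diag_sums[of t]
        have "(\<Sum>j. ennreal (weight j * exp (- t * ev j))) = ennreal (\<Sum>j. weight j * exp (- t * ev j))"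
          by (rule suminf_ennreal2) (use weight_pos s True in \<open>auto simp: less_imp_le sums_iff\<close>)
        then show ?thesis using True by (simp add: heat_diag_def)
      qed (use \<open>t \<noteq> 0\<close> in simp)
    qed
  qed
  also have "\<dots> = (\<Sum>j. \<integral>\<^sup>+t. ennreal (weight j * exp (- t * ev j)) * indicator {0..} t \<partial>lborel)"
    by (rule nn_integral_suminf) measurable
  finally show ?thesis by (simp only: exp_int)
qed

end

section \<open>The list of eigenvalues\<close>

context rank_one_perturbation
begin

lemma real_eigenvalue_iff:
  assumes "\<mu> \<noteq> 0"
  shows "eigenvalue H (of_real \<mu>) \<longleftrightarrow>
    \<mu> \<in> range ev \<union> range gap_root \<union> {\<mu>. \<mu> < 0 \<and> green \<mu> = 1 / \<sigma>} \<union> {\<mu>. ev 0 < \<mu> \<and> green \<mu> = 1 / \<sigma>}"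
proof
  assume e: "eigenvalue H (of_real \<mu>)"
  show "\<mu> \<in> range ev \<union> range gap_root \<union> {\<mu>. \<mu> < 0 \<and> green \<mu> = 1 / \<sigma>} \<union> {\<mu>. ev 0 < \<mu> \<and> green \<mu> = 1 / \<sigma>}"
  proof (cases "\<mu> \<in> range ev")
    case False
    then have ne: "\<And>j. ev j \<noteq> \<mu>" by auto
    then have "regular_real \<mu>" using assms by (simp add: regular_real_iff)
    then have g: "green \<mu> = 1 / \<sigma>" using eigenvalue_H_real_iff e by simp
    from ev_cases[OF assms ne] consider "\<mu> < 0" | "ev 0 < \<mu>" | k where "\<mu> \<in> {ev (Suc k)<..<ev k}" by blast
    then show ?thesis
    proof cases
      case 3
      then show ?thesis using g gap_root_unique by blast
    qed (use g in auto)
  qed auto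
next
  assume "\<mu> \<in> range ev \<union> range gap_root \<union> {\<mu>. \<mu> < 0 \<and> green \<mu> = 1 / \<sigma>} \<union> {\<mu>. ev 0 < \<mu> \<and> green \<mu> = 1 / \<sigma>}"
  then consider k where "\<mu> = ev k" | "perturbed_root \<mu>"
    using perturbed_root_gap_root regular_negative regular_above by (auto simp: perturbed_root_def)
  then show "eigenvalue H (of_real \<mu>)"
    using eigenvalue_ev(1) eigenfunction_at_root by cases (auto simp: eigenvalue_def)
qed

lemma positive_eigenvalues:
  "{\<mu>. 0 < \<mu> \<and> eigenvalue H (of_real \<mu>)} = range ev \<union> range gap_root \<union> {\<mu>. ev 0 < \<mu> \<and> green \<mu> = 1 / \<sigma>}"
proof -
  have "0 < gap_root k" for k using gap_root(1)[of k] ev_pos[of "Suc k"] by simp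
  moreover have "0 < \<mu>" if "ev 0 < \<mu>" for \<mu> using that ev_pos[of 0] by linarith
  ultimately show ?thesis using real_eigenvalue_iff ev_pos by (auto simp: less_imp_neq[symmetric])
qed

lemma negative_eigenvalues:
  "{\<mu>. \<mu> < 0 \<and> eigenvalue H (of_real \<mu>)} = {\<mu>. \<mu> < 0 \<and> green \<mu> = 1 / \<sigma>}"
  using eigenvalue_H_real_iff regular_negative by auto

lemma negative_root_at_most_one:
  "\<mu> < 0 \<Longrightarrow> green \<mu> = s \<Longrightarrow> \<nu> < 0 \<Longrightarrow> green \<nu> = s \<Longrightarrow> \<mu> = \<nu>"
  using green_strict_mono_negative[of \<mu> \<nu>] green_strict_mono_negative[of \<nu> \<mu>]
  by (cases \<mu> \<nu> rule: linorder_cases) auto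

lemma roots_above_finite: "finite {\<mu>. ev 0 < \<mu> \<and> green \<mu> = s}"
proof (cases "s < 0")
  case True
  obtain p where "\<And>\<mu>. ev 0 < \<mu> \<Longrightarrow> green \<mu> = s \<Longrightarrow> \<mu> = p"
    using ex1_root_above[OF True] unfolding greaterThan_iff by blast
  then have "{\<mu>. ev 0 < \<mu> \<and> green \<mu> = s} \<subseteq> {p}" by blast
  then show ?thesis by (rule finite_subset) simp
next
  case False
  then have "{\<mu>. ev 0 < \<mu> \<and> green \<mu> = s} = {}" using green_above(3) by force
  then show ?thesis by (simp only: finite.emptyI)
qed

lemma negative_eigenvalue_iff:
  "(\<exists>\<nu><0. green \<nu> = 1 / \<sigma>) \<longleftrightarrow> 0 < \<sigma> \<and> ennreal (1 / \<sigma>) < (\<Sum>j. ennreal (weight j / ev j))"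
proof (cases "0 < \<sigma>")
  case True
  then show ?thesis using negative_root_iff[of "1 / \<sigma>"] by simp
next
  case False
  then have "1 / \<sigma> \<le> 0" by simp
  then show ?thesis using False green_negative(1) by force
qed

lemma islimpt_positive_eigenvalues:
  "{x. x islimpt {\<mu>. 0 < \<mu> \<and> eigenvalue H (of_real \<mu>)}} = {0}"
proof -
  define P where "P = {\<mu>. 0 < \<mu> \<and> eigenvalue H (of_real \<mu>)}"
  have "0 islimpt P"
    unfolding islimpt_sequential
    by (intro exI[of _ ev] conjI allI ev_tendsto_0)
       (use ev_pos eigenvalue_ev(1) in \<open>auto simp: P_def less_imp_neq[symmetric]\<close>)
  moreover have "x = 0" if x: "x islimpt P" for x
  proof (rule ccontr)
    assume "x \<noteq> 0"
    then consider "x < 0" | "0 < x" by linarith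
    then show False
    proof cases
      case 1
      then have "eventually (\<lambda>y. y \<in> {..<0}) (at x)"
        by (intro eventually_at_in_open') auto
      from islimpt_Int_eventually[OF x this] have "x islimpt (P \<inter> {..<0})" .
      moreover have "P \<inter> {..<0} = {}" by (auto simp: P_def)
      ultimately show False by simp
    next
      case 2
      have fin: "finite {k. x / 2 < ev k}"
      proof -
        obtain N where "\<And>k. k \<ge> N \<Longrightarrow> ev k < x / 2"
          using order_tendstoD(2)[OF ev_tendsto_0, of "x / 2"] 2 by (auto simp: eventually_sequentially)
        then have "{k. x / 2 < ev k} \<subseteq> {..<N}" by (force simp: not_less[symmetric])
        then show ?thesis by (rule finite_subset) simp
      qed
      have "eventually (\<lambda>y. y \<in> {x / 2<..}) (at x)"
        using 2 by (intro eventually_at_in_open') auto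
      from islimpt_Int_eventually[OF x this] have "x islimpt (P \<inter> {x / 2<..})" .
      moreover have "finite (P \<inter> {x / 2<..})"
      proof (rule finite_subset)
        have "x / 2 < ev k" if "x / 2 < gap_root k" for k using gap_root(1)[of k] that by simp
        then show "P \<inter> {x / 2<..} \<subseteq> ev ` {k. x / 2 < ev k} \<union> gap_root ` {k. x / 2 < ev k} \<union>
            {\<mu>. ev 0 < \<mu> \<and> green \<mu> = 1 / \<sigma>}"
          unfolding P_def positive_eigenvalues by auto
        show "finite (ev ` {k. x / 2 < ev k} \<union> gap_root ` {k. x / 2 < ev k} \<union>
            {\<mu>. ev 0 < \<mu> \<and> green \<mu> = 1 / \<sigma>})"
          using fin roots_above_finite by simp
      qed
      ultimately show False by (simp add: islimpt_finite)
    qed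
  qed
  ultimately show ?thesis by (auto simp: P_def)
qed

end

section \<open>The balls of a homogeneous ultrametric space\<close>

text \<open>At the first difference the smaller of the two values would be missing in the other range.\<close>

lemma strict_mono_range_unique:
  fixes f g :: "nat \<Rightarrow> nat"
  assumes f: "strict_mono f" and g: "strict_mono g" and r: "range f = range g"
  shows "f = g"
proof (rule ext)
  have ge: "g k \<le> f k" if f: "strict_mono f" and g: "strict_mono g" and r: "range f = range g"
      and IH: "\<And>j. j < k \<Longrightarrow> f j = g j" for f g :: "nat \<Rightarrow> nat" and k
  proof -
    have "f k \<in> range g" using r by auto
    then obtain j where j: "f k = g j" by blast
    have "\<not> j < k"
    proof
      assume "j < k"
      then have "f k = f j" using IH j by simp
      then show False using strict_monoD[OF f \<open>j < k\<close>] by simp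
    qed
    then show ?thesis unfolding j by (simp add: strict_mono_less_eq[OF g])
  qed
  fix k show "f k = g k"
  proof (induction k rule: less_induct)
    case (less k)
    have "g k \<le> f k" by (rule ge[OF f g r]) (rule less)
    moreover have "f k \<le> g k" by (rule ge[OF g f r[symmetric]]) (rule less[symmetric])
    ultimately show ?case by simp
  qed
qed

context
  assumes homogeneous_space: "homogeneous_ultrametric_measure_space TYPE('a::metric_space)"
begin

lemma
  shows homogeneous_space_countable: "countable (UNIV :: 'a set)"
    and homogeneous_space_infinite: "infinite (UNIV :: 'a set)"
    and homogeneous_space_ultra: "dist (x::'a) y \<le> max (dist x z) (dist z y)"
    and homogeneous_space_finite: "finite (cball (x::'a) r)"
    and homogeneous_space_isometry: "\<exists>\<phi>. bij \<phi> \<and> (\<forall>u v. dist (\<phi> u) (\<phi> v) = dist u v) \<and> \<phi> (x::'a) = y"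
    and homogeneous_space_diameter: "(B::'a set) \<in> balls \<Longrightarrow> \<not> is_singleton B \<Longrightarrow> real (card B) = diameter B"
proof -
  note h = homogeneous_space[unfolded homogeneous_ultrametric_measure_space_def]
  show "countable (UNIV :: 'a set)" using h by (elim conjE)
  show "infinite (UNIV :: 'a set)" using h by (elim conjE)
  show "dist (x::'a) y \<le> max (dist x z) (dist z y)" using h by (elim conjE) blast
  show "finite (cball (x::'a) r)" using h by (elim conjE) blast
  show "\<exists>\<phi>. bij \<phi> \<and> (\<forall>u v. dist (\<phi> u) (\<phi> v) = dist u v) \<and> \<phi> (x::'a) = y" using h by (elim conjE) blast
  show "(B::'a set) \<in> balls \<Longrightarrow> \<not> is_singleton B \<Longrightarrow> real (card B) = diameter B" using h by (elim conjE) blast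
qed

lemma cball_recentre:
  assumes "x \<in> cball (u::'a) r"
  shows "cball u r = cball x r"
proof -
  have "cball p r \<subseteq> cball q r" if "dist p q \<le> r" for p q :: 'a
  proof
    fix y assume "y \<in> cball p r"
    then show "y \<in> cball q r" using homogeneous_space_ultra[of q y p] that by (simp add: dist_commute)
  qed
  then show ?thesis using assms by (metis dist_commute mem_cball subset_antisym)
qed

text \<open>Every point of an ultrametric ball is a centre of it.\<close>

lemma balls_at_eq: "balls_at (x::'a) = {cball x r | r. 0 < r}"
proof (intro set_eqI iffI)
  fix B assume "B \<in> balls_at x"
  then obtain u r where "B = cball u r" "0 < r" "x \<in> B" by (auto simp: balls_at_def balls_def)
  then show "B \<in> {cball x r | r. 0 < r}" using cball_recentre[of x u r] by blast
qed (auto simp: balls_at_def balls_def)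

lemma balls_at_chain:
  assumes "A \<in> balls_at (x::'a)" "B \<in> balls_at x"
  shows "A \<subseteq> B \<or> B \<subseteq> A"
proof -
  obtain r s where "A = cball x r" "B = cball x s" using assms unfolding balls_at_eq by blast
  then show ?thesis using subset_cball[of r s x] subset_cball[of s r x] by (cases "r \<le> s") auto
qed

lemma finite_ball_at: "B \<in> balls_at (x::'a) \<Longrightarrow> finite B"
  unfolding balls_at_eq using homogeneous_space_finite by auto

lemma small_cball: "\<exists>r>0. cball (x::'a) r = {x}"
proof -
  obtain d where d: "0 < d" "\<And>y. y \<in> cball x 1 \<Longrightarrow> y \<noteq> x \<Longrightarrow> d \<le> dist x y"
    using finite_set_avoid[OF homogeneous_space_finite[of x 1], of x] by blast
  define r where "r = min 1 (d / 2)"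
  have "cball x r = {x}"
  proof
    show "cball x r \<subseteq> {x}"
    proof
      fix y assume "y \<in> cball x r"
      then have "dist x y \<le> 1" "dist x y \<le> d / 2" by (simp_all add: r_def)
      then show "y \<in> {x}" using d(1) d(2)[of y] by force
    qed
  qed (use d(1) in \<open>simp add: r_def\<close>)
  then show ?thesis using d(1) by (intro exI[of _ r]) (simp add: r_def)
qed

lemma singleton_in_balls_at: "{x::'a} \<in> balls_at x"
  using small_cball[of x] unfolding balls_at_eq by (smt (verit) mem_Collect_eq)

lemma inj_on_card_balls_at: "inj_on card (balls_at (x::'a))"
proof (rule inj_onI)
  fix A B assume AB: "A \<in> balls_at x" "B \<in> balls_at x" "card A = card B"
  then show "A = B"
    using balls_at_chain[OF AB(1,2)] card_subset_eq[of A B] card_subset_eq[of B A] finite_ball_at by metis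
qed

lemma infinite_balls_at: "infinite (balls_at (x::'a))"
proof
  assume "finite (balls_at x)"
  then have "finite (\<Union>(balls_at x))" by (rule finite_Union) (rule finite_ball_at)
  moreover have "y \<in> \<Union>(balls_at x)" for y
  proof
    show "y \<in> cball x (dist x y + 1)" by simp
    show "cball x (dist x y + 1) \<in> balls_at x"
      unfolding balls_at_eq using zero_le_dist[of x y] by (intro CollectI exI[of _ "dist x y + 1"] conjI refl) linarith
  qed
  then have "\<Union>(balls_at x) = UNIV" by blast
  ultimately show False using homogeneous_space_infinite by simp
qed

lemma card_strict_mono_chain:
  assumes "\<And>k. F k \<subset> F (Suc k)" "range F = balls_at (x::'a)"
  shows "strict_mono (\<lambda>k. card (F k))" and "range (\<lambda>k. card (F k)) = card ` balls_at x"
proof -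
  have "finite (F k)" for k using finite_ball_at assms(2) by blast
  then show "strict_mono (\<lambda>k. card (F k))"
    using assms(1) by (intro strict_mono_Suc_iff[THEN iffD2] allI psubset_card_mono) auto
  show "range (\<lambda>k. card (F k)) = card ` balls_at x" unfolding assms(2)[symmetric] by (simp add: image_image)
qed

text \<open>The balls around x form a chain of finite sets, so they are determined by their sizes; enumerating the
  infinite set of sizes enumerates the balls.\<close>

lemma ball_chain_exists:
  "\<exists>F. F 0 = {x::'a} \<and> (\<forall>k. F k \<subset> F (Suc k)) \<and> range F = balls_at x"
proof -
  define S where "S = card ` balls_at x"
  have S: "infinite S" unfolding S_def using finite_imageD[OF _ inj_on_card_balls_at] infinite_balls_at by blast
  define F where "F k = inv_into (balls_at x) card (enumerate S k)" for k
  have in_S: "enumerate S k \<in> S" for k by (rule enumerate_in_set[OF S])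
  have F: "F k \<in> balls_at x" "card (F k) = enumerate S k" for k
    unfolding F_def using in_S[of k] unfolding S_def by (auto intro: inv_into_into f_inv_into_f)
  have sub: "F k \<subset> F (Suc k)" for k
  proof -
    have c: "card (F k) < card (F (Suc k))" unfolding F(2) by (rule enumerate_step[OF S])
    have "\<not> F (Suc k) \<subseteq> F k"
      using card_mono[OF finite_ball_at[OF F(1)[of k]], of "F (Suc k)"] c by linarith
    then show ?thesis using balls_at_chain[OF F(1)[of k] F(1)[of "Suc k"]] by blast
  qed
  have range: "range F = balls_at x"
  proof
    show "range F \<subseteq> balls_at x" using F(1) by blast
    show "balls_at x \<subseteq> range F"
    proof
      fix B assume B: "B \<in> balls_at x"
      then obtain k where "card B = enumerate S k"
        using enumerate_Ex[of S "card B"] S unfolding S_def by (metis imageI)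
      then have "F k = B" using inj_onD[OF inj_on_card_balls_at _ F(1)[of k] B] F(2) by simp
      then show "B \<in> range F" by blast
    qed
  qed
  obtain j where j: "F j = {x}" using singleton_in_balls_at[of x] range by (metis rangeE)
  have "j = 0"
  proof (rule ccontr)
    assume "j \<noteq> 0"
    then obtain i where "j = Suc i" by (cases j) auto
    then have "F i \<subset> {x}" using sub[of i] j by simp
    moreover have "x \<in> F i" using F(1)[of i] by (simp add: balls_at_def)
    ultimately show False by blast
  qed
  with j sub range show ?thesis by blast
qed

lemma
  shows ball_chain_0: "ball_chain (x::'a) 0 = {x}"
    and ball_chain_Suc: "ball_chain x k \<subset> ball_chain x (Suc k)"
    and range_ball_chain: "range (ball_chain x) = balls_at x"
proof -
  have "\<exists>!F. F 0 = {x} \<and> (\<forall>k. F k \<subset> F (Suc k)) \<and> range F = balls_at x"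
  proof (rule ex_ex1I[OF ball_chain_exists])
    fix F G
    assume F: "F 0 = {x} \<and> (\<forall>k. F k \<subset> F (Suc k)) \<and> range F = balls_at x"
      and G: "G 0 = {x} \<and> (\<forall>k. G k \<subset> G (Suc k)) \<and> range G = balls_at x"
    have F': "\<And>k. F k \<subset> F (Suc k)" "range F = balls_at x"
      and G': "\<And>k. G k \<subset> G (Suc k)" "range G = balls_at x" using F G by simp_all
    have card_eq: "(\<lambda>k. card (F k)) = (\<lambda>k. card (G k))"
      by (rule strict_mono_range_unique)
         (simp_all only: card_strict_mono_chain[OF F'] card_strict_mono_chain[OF G'])
    show "F = G"
    proof (rule ext)
      fix k
      show "F k = G k"
      proof (rule inj_onD[OF inj_on_card_balls_at])
        show "card (F k) = card (G k)" using card_eq by (rule fun_cong)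
        show "F k \<in> balls_at x" by (simp only: F'(2)[symmetric] rangeI)
        show "G k \<in> balls_at x" by (simp only: G'(2)[symmetric] rangeI)
      qed
    qed
  qed
  from theI'[OF this] have "ball_chain x 0 = {x} \<and> (\<forall>k. ball_chain x k \<subset> ball_chain x (Suc k)) \<and>
      range (ball_chain x) = balls_at x"
    unfolding ball_chain_def .
  then show "ball_chain x 0 = {x}" "ball_chain x k \<subset> ball_chain x (Suc k)" "range (ball_chain x) = balls_at x"
    by simp_all
qed

lemma ball_chain_in: "ball_chain (x::'a) k \<in> balls_at x"
  using range_ball_chain[of x] by blast

lemma card_ball_chain_mono: "strict_mono (\<lambda>k. card (ball_chain (x::'a) k))"
  by (rule card_strict_mono_chain(1)[OF ball_chain_Suc range_ball_chain])

text \<open>An isometry that takes x to y maps the balls around x onto the balls around y, so both chains have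
  the same set of sizes.\<close>

lemma card_ball_chain_eq: "card (ball_chain (x::'a) k) = card (ball_chain (y::'a) k)"
proof -
  have sub: "card ` balls_at u \<subseteq> card ` balls_at v" for u v :: 'a
  proof -
    obtain \<phi> where "bij \<phi> \<and> (\<forall>p q. dist (\<phi> p) (\<phi> q) = dist p q) \<and> \<phi> u = v"
      using homogeneous_space_isometry[of u v] by (rule exE)
    then have \<phi>: "bij \<phi>" "\<And>p q. dist (\<phi> p) (\<phi> q) = dist p q" "\<phi> u = v" by simp_all
    have im: "\<phi> ` cball u r = cball v r" for r
    proof
      show "cball v r \<subseteq> \<phi> ` cball u r"
      proof
        fix q assume q: "q \<in> cball v r"
        obtain p where p: "q = \<phi> p" using \<phi>(1) by (metis bij_pointE)
        then have "p \<in> cball u r" using q \<phi>(2)[of u p] \<phi>(3) by simp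
        then show "q \<in> \<phi> ` cball u r" using p by blast
      qed
      show "\<phi> ` cball u r \<subseteq> cball v r" using \<phi>(2)[of u] \<phi>(3) by auto
    qed
    have "card (cball u r) = card (cball v r)" for r
      using card_image[of \<phi> "cball u r"] im[of r] \<phi>(1) by (metis bij_is_inj inj_on_subset subset_UNIV)
    then show ?thesis unfolding balls_at_eq by blast
  qed
  have "range (\<lambda>k. card (ball_chain x k)) = range (\<lambda>k. card (ball_chain y k))"
    unfolding card_strict_mono_chain(2)[OF ball_chain_Suc range_ball_chain] using sub by blast
  then have "(\<lambda>k. card (ball_chain x k)) = (\<lambda>k. card (ball_chain y k))"
    by (rule strict_mono_range_unique[OF card_ball_chain_mono card_ball_chain_mono])
  then show ?thesis by (rule fun_cong)
qed

lemma homogeneous_hierarchy_ball_chain: "homogeneous_hierarchy (ball_chain :: 'a \<Rightarrow> nat \<Rightarrow> 'a set)"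
proof
  fix x y :: 'a and k
  show "ball_chain x 0 = {x}" by (rule ball_chain_0)
  show "ball_chain x k \<subset> ball_chain x (Suc k)" by (rule ball_chain_Suc)
  show "finite (ball_chain x k)" by (rule finite_ball_at[OF ball_chain_in])
  show "card (ball_chain x k) = card (ball_chain y k)" by (rule card_ball_chain_eq)
  assume y: "y \<in> ball_chain x k"
  then have "ball_chain x k \<in> balls_at y" using ball_chain_in[of x k] by (simp add: balls_at_def)
  then obtain j where j: "ball_chain x k = ball_chain y j" using range_ball_chain[of y] by (metis rangeE)
  then have "card (ball_chain x k) = card (ball_chain x j)" using card_ball_chain_eq[of x j y] by simp
  then have "k = j" using strict_mono_eq[OF card_ball_chain_mono[of x]] by simp
  then show "ball_chain y k = ball_chain x k" using j by simp
qed

lemma inj_ball_chain: "inj (ball_chain (x::'a))"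
proof (rule injI)
  fix j k assume "ball_chain x j = ball_chain x k"
  then have "card (ball_chain x j) = card (ball_chain x k)" by simp
  then show "j = k" using strict_mono_eq[OF card_ball_chain_mono[of x]] by simp
qed

text \<open>Level 0 is treated separately, because the diameter of a singleton is 0 and not its size.\<close>

lemma diameter_ball_chain: "diameter (ball_chain (x::'a) k) = diameter (ball_chain (y::'a) k)"
proof (cases "k = 0")
  case True
  then show ?thesis by (simp add: ball_chain_0)
next
  case False
  have "real (card (ball_chain u k)) = diameter (ball_chain u k)" for u :: 'a
  proof (rule homogeneous_space_diameter)
    show "ball_chain u k \<in> balls" using ball_chain_in[of u k] by (simp add: balls_at_def)
    have "card (ball_chain u 0) < card (ball_chain u k)"
      using False by (intro strict_monoD[OF card_ball_chain_mono]) simp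
    then show "\<not> is_singleton (ball_chain u k)" by (simp add: ball_chain_0 is_singleton_altdef)
  qed
  then show ?thesis using card_ball_chain_eq[of x k y] by metis
qed

lemma open_singleton: "open {x::'a}"
proof -
  obtain r where "0 < r" "cball x r = {x}" using small_cball by blast
  then show ?thesis unfolding open_contains_cball by auto
qed

lemma supp_eq: "supp (f :: 'a \<Rightarrow> complex) = {x. f x \<noteq> 0}"
proof -
  have "open S" for S :: "'a set"
  proof -
    have "S = (\<Union>x\<in>S. {x})" by blast
    then show ?thesis using open_singleton by (metis open_UN)
  qed
  then have "closed {x. f x \<noteq> 0}" by (simp add: closed_def)
  then show ?thesis by (simp add: supp_def closure_closed)
qed

lemma compact_iff_finite: "compact (S :: 'a set) \<longleftrightarrow> finite S"
proof
  assume "compact S"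
  then have "bounded S" by (rule compact_imp_bounded)
  then obtain x r where "S \<subseteq> cball x r" unfolding bounded_subset_cball by blast
  then show "finite S" using homogeneous_space_finite finite_subset by blast
qed (rule finite_imp_compact)

end

section \<open>Hierarchical Laplacians\<close>

locale hierarchical_choice =
  fixes C :: "'a::metric_space set \<Rightarrow> real" and a :: 'a
  assumes homogeneous_space: "homogeneous_ultrametric_measure_space TYPE('a)"
    and choice: "homogeneous_choice_function C"
begin

sublocale homogeneous_hierarchy "ball_chain :: 'a \<Rightarrow> nat \<Rightarrow> 'a set"
  by (rule homogeneous_hierarchy_ball_chain[OF homogeneous_space])

lemma C_pos: "B \<in> balls \<Longrightarrow> 0 < C B"
  and C_eq: "A \<in> balls \<Longrightarrow> B \<in> balls \<Longrightarrow> diameter A = diameter B \<Longrightarrow> C A = C B"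
  and C_summable: "B \<in> balls \<Longrightarrow> C summable_on {T \<in> balls. B \<subseteq> T}"
proof -
  note h = choice[unfolded homogeneous_choice_function_def]
  show "B \<in> balls \<Longrightarrow> 0 < C B" using h by (elim conjE) (rule bspec)
  have eq: "\<forall>A\<in>balls. \<forall>B\<in>balls. diameter A = diameter B \<longrightarrow> C A = C B" using h by (elim conjE)
  show "C A = C B" if "A \<in> balls" "B \<in> balls" "diameter A = diameter B"
    by (rule mp[OF bspec[OF bspec[OF eq that(1)] that(2)] that(3)])
  show "B \<in> balls \<Longrightarrow> C summable_on {T \<in> balls. B \<subseteq> T}" using h by (elim conjE) (rule bspec)
qed

definition level_choice :: "nat \<Rightarrow> real" where "level_choice k = C (ball_chain a k)"

lemma ball_chain_balls: "ball_chain x k \<in> balls" for x :: 'a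
  using ball_chain_in[OF homogeneous_space, of x k] by (simp add: balls_at_def)

lemma C_ball_chain: "C (ball_chain x k) = level_choice k"
  unfolding level_choice_def by (intro C_eq ball_chain_balls diameter_ball_chain[OF homogeneous_space])

lemma level_choice_pos: "0 < level_choice k"
  unfolding level_choice_def by (intro C_pos ball_chain_balls)

lemma superballs: "{T \<in> balls. ball_chain a k \<subseteq> T} = ball_chain a ` {k..}"
proof (intro set_eqI iffI)
    fix T assume T: "T \<in> {T \<in> balls. ball_chain a k \<subseteq> T}"
    then have "a \<in> T" using self_in_B[of a k] by blast
    then have "T \<in> range (ball_chain a)" using T range_ball_chain[OF homogeneous_space, of a] by (simp add: balls_at_def)
    then obtain j where j: "T = ball_chain a j" by blast
    have "k \<le> j"
    proof (rule ccontr)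
      assume "\<not> k \<le> j"
      then have "card (ball_chain a j) < card (ball_chain a k)"
        by (intro strict_monoD[OF card_ball_chain_mono[OF homogeneous_space]]) simp
      moreover have "card (ball_chain a k) \<le> card (ball_chain a j)"
        using T j finite_B by (intro card_mono) auto
      ultimately show False by simp
    qed
    then show "T \<in> ball_chain a ` {k..}" using j by simp
  next
    fix T assume "T \<in> ball_chain a ` {k..}"
    then show "T \<in> {T \<in> balls. ball_chain a k \<subseteq> T}" using B_mono[of k _ a] ball_chain_balls by auto
qed

lemma level_choice_summable: "summable level_choice"
proof -
  have "C summable_on ball_chain a ` {0..}"
    using C_summable[OF ball_chain_balls[of a 0]] unfolding superballs .
  then have "(C \<circ> ball_chain a) summable_on {0..}"
    by (subst (asm) summable_on_reindex) (auto intro: inj_on_subset[OF inj_ball_chain[OF homogeneous_space]])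
  moreover have "C \<circ> ball_chain a = level_choice" by (simp add: fun_eq_iff level_choice_def)
  ultimately have "level_choice summable_on UNIV" by (simp add: atLeast_0)
  then show ?thesis by (rule summable_on_imp_summable)
qed

lemma lam_seq_eq: "lam_seq C a k = (\<Sum>i. level_choice (i + k))"
proof -
  have s: "summable (\<lambda>i. level_choice (i + k))" by (rule summable_ignore_initial_segment[OF level_choice_summable])
  have "lam_seq C a k = infsum C (ball_chain a ` {k..})" by (simp add: lam_seq_def lam_def superballs)
  also have "\<dots> = infsum (C \<circ> ball_chain a) {k..}"
    by (rule infsum_reindex) (auto intro: inj_on_subset[OF inj_ball_chain[OF homogeneous_space]])
  also have "{k..} = (\<lambda>i. i + k) ` UNIV" by (auto simp: image_iff intro: le_add_diff_inverse2[symmetric])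
  also have "infsum (C \<circ> ball_chain a) ((\<lambda>i. i + k) ` UNIV) = infsum (C \<circ> ball_chain a \<circ> (\<lambda>i. i + k)) UNIV"
    by (rule infsum_reindex) (auto simp: inj_on_def)
  also have "C \<circ> ball_chain a \<circ> (\<lambda>i. i + k) = (\<lambda>i. level_choice (i + k))" by (simp add: fun_eq_iff level_choice_def)
  also have "infsum (\<lambda>i. level_choice (i + k)) UNIV = (\<Sum>i. level_choice (i + k))"
  proof (rule infsumI, rule norm_summable_imp_has_sum)
    show "summable (\<lambda>i. norm (level_choice (i + k)))" using s level_choice_pos by (simp add: less_imp_le)
  qed (rule summable_sums[OF s])
  finally show ?thesis .
qed

lemma lam_seq_Suc: "lam_seq C a k = level_choice k + lam_seq C a (Suc k)"
  unfolding lam_seq_eq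
  using suminf_split_head[OF summable_ignore_initial_segment[OF level_choice_summable, of k]] by simp

lemma lam_seq_tendsto_0: "lam_seq C a \<longlonglongrightarrow> 0"
  unfolding lam_seq_eq[abs_def] by (rule suminf_exist_split2[OF level_choice_summable])

text \<open>The ball of level 0 contributes nothing to the Laplacian. The remaining series is the multiplier
  because \<open>lam_seq\<close> decreases by \<open>level_choice (k + 1)\<close> from one level to the next.\<close>

lemma Laplacian_eq_multiplier:
  assumes f: "f \<in> L2"
  shows "Laplacian C f = multiplier (\<lambda>k. of_real (lam_seq C a (Suc k))) f"
proof (rule ext)
  fix x
  define u where "u k = of_real (level_choice k) * (f x - P k f x)" for k
  have bound: "cmod (u k) \<le> level_choice k * (2 * L2_norm f)" for k
  proof -
    have "cmod (f x - P k f x) \<le> cmod (f x) + cmod (P k f x)" by (rule norm_triangle_ineq4)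
    also have "\<dots> \<le> 2 * L2_norm f"
      using cmod_le_L2_norm[OF f, of x] cmod_le_L2_norm[OF P_L2[OF f], of k x] L2_norm_P_le[OF f, of k] by linarith
    finally show ?thesis using level_choice_pos[of k] by (simp add: u_def norm_mult)
  qed
  have u_summable: "summable (\<lambda>k. cmod (u k))"
    by (rule summable_comparison_test'[OF summable_mult2[OF level_choice_summable, of "2 * L2_norm f"]])
       (use bound in simp)
  have "Laplacian C f x = infsum (\<lambda>B. of_real (C B) * (f x - (\<Sum>y\<in>B. f y) / of_nat (card B))) (range (ball_chain x))"
    by (simp add: Laplacian_def range_ball_chain[OF homogeneous_space])
  also have "\<dots> = infsum ((\<lambda>B. of_real (C B) * (f x - (\<Sum>y\<in>B. f y) / of_nat (card B))) \<circ> ball_chain x) UNIV"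
    by (rule infsum_reindex[OF inj_ball_chain[OF homogeneous_space]])
  also have "(\<lambda>B. of_real (C B) * (f x - (\<Sum>y\<in>B. f y) / of_nat (card B))) \<circ> ball_chain x = u"
    by (simp add: fun_eq_iff u_def P_def card_B C_ball_chain)
  also have "infsum u UNIV = suminf u"
    using summable_sums[OF summable_norm_cancel[OF u_summable]] norm_summable_imp_has_sum[OF u_summable]
    by (intro infsumI) blast
  also have "suminf u = (\<Sum>k. u (Suc k))"
  proof -
    have "u 0 = 0" by (simp add: u_def P_0)
    then show ?thesis using suminf_split_head[OF summable_norm_cancel[OF u_summable]] by simp
  qed
  also have "\<dots> = multiplier (\<lambda>k. of_real (lam_seq C a (Suc k))) f x"
  proof -
    have s1: "(\<lambda>k. of_real (level_choice (Suc k)) * f x) sums (of_real (lam_seq C a 1) * f x)"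
    proof (rule sums_mult2)
      have "(\<lambda>k. level_choice (k + 1)) sums lam_seq C a 1"
        unfolding lam_seq_eq by (rule summable_sums[OF summable_ignore_initial_segment[OF level_choice_summable]])
      then show "(\<lambda>k. complex_of_real (level_choice (Suc k))) sums of_real (lam_seq C a 1)"
        by (simp only: sums_of_real_iff Suc_eq_plus1)
    qed
    have su: "(\<lambda>k. u (Suc k)) sums (\<Sum>k. u (Suc k))"
      using summable_ignore_initial_segment[OF summable_norm_cancel[OF u_summable], of 1]
      by (intro summable_sums) simp
    have m: "of_real (lam_seq C a (Suc (Suc k))) - of_real (lam_seq C a (Suc k)) = - complex_of_real (level_choice (Suc k))" for k
      unfolding lam_seq_Suc[of "Suc k"] by simp
    have "(\<lambda>k. - complex_of_real (level_choice (Suc k)) * P (Suc k) f x) sums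
        ((\<Sum>k. u (Suc k)) - of_real (lam_seq C a 1) * f x)"
      using sums_diff[OF su s1] by (simp add: u_def algebra_simps)
    then have "(\<Sum>k. - complex_of_real (level_choice (Suc k)) * P (Suc k) f x) =
        (\<Sum>k. u (Suc k)) - of_real (lam_seq C a 1) * f x" by (simp only: sums_iff)
    then show ?thesis unfolding multiplier_def m by simp
  qed
  finally show "Laplacian C f x = multiplier (\<lambda>k. of_real (lam_seq C a (Suc k))) f x" .
qed

sublocale hierarchical_operator ball_chain "Laplacian C" "\<lambda>k. lam_seq C a (Suc k)"
proof
  show "lam_seq C a (Suc (Suc k)) < lam_seq C a (Suc k)" for k
    using lam_seq_Suc[of "Suc k"] level_choice_pos[of "Suc k"] by linarith
  show "(\<lambda>k. lam_seq C a (Suc k)) \<longlonglongrightarrow> 0" by (rule LIMSEQ_Suc[OF lam_seq_tendsto_0])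
qed (rule Laplacian_eq_multiplier)

lemma resolvent_kernel_eq:
  assumes "regular z"
  shows "resolvent_kernel C z x a = R z (delta a) x"
proof -
  have "(THE \<psi>. \<psi> \<in> L2 \<and> Laplacian C \<psi> - fscale z \<psi> = delta a) = R z (delta a)"
  proof (rule the_equality)
    show "R z (delta a) \<in> L2 \<and> Laplacian C (R z (delta a)) - fscale z (R z (delta a)) = delta a"
      using resolvent_equation_iff[OF assms R_L2[OF assms delta_in_L2] delta_in_L2] R_L2[OF assms delta_in_L2]
      by simp
    show "\<psi> = R z (delta a)" if "\<psi> \<in> L2 \<and> Laplacian C \<psi> - fscale z \<psi> = delta a" for \<psi>
      using resolvent_equation_iff[OF assms conjunct1[OF that] delta_in_L2[of a]] that by simp
  qed
  then show ?thesis unfolding resolvent_kernel_def by (rule fun_cong)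
qed

lemma green0_eq: "green0 C a = (\<Sum>j. ennreal (weight j / lam_seq C a (Suc j)))"
proof -
  have "heat_kernel C t a a = of_real (heat_diag t)" if "0 \<le> t" for t
    unfolding heat_kernel_def heat_semigroup_def
    using exp_series_sums_heat[OF that, of a] by (simp add: sums_iff)
  then have "green0 C a = (\<integral>\<^sup>+t\<in>{0<..}. ennreal (heat_diag t) \<partial>lborel)"
    unfolding green0_def by (intro nn_integral_cong) (simp add: indicator_def)
  then show ?thesis by (simp only: heat_integral)
qed

end

locale hierarchical_schroedinger = hierarchical_choice C a
  for C :: "'a::metric_space set \<Rightarrow> real" and a +
  fixes \<sigma> :: real
  assumes \<sigma>_neq_0: "\<sigma> \<noteq> 0"
begin

sublocale rank_one_perturbation ball_chain "Laplacian C" "\<lambda>k. lam_seq C a (Suc k)" a \<sigma> "Schroedinger C \<sigma> a"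
  by unfold_locales (rule Schroedinger_def \<sigma>_neq_0)+

text \<open>The resolvent kernel is \<open>R \<nu> (delta a)\<close>, and in a discrete space with finite balls a compact support
  is a finite one.\<close>

lemma perturbed_eigenvalueI:
  assumes I: "\<And>\<nu>. \<nu> \<in> I \<Longrightarrow> regular_real \<nu>"
    and \<mu>: "\<mu> \<in> I" "\<And>\<nu>. \<nu> \<in> I \<Longrightarrow> green \<nu> = 1 / \<sigma> \<longleftrightarrow> \<nu> = \<mu>"
  shows "perturbed_eigenvalue C \<sigma> a I \<mu>"
proof -
  have r: "regular_real \<mu>" by (rule I[OF \<mu>(1)])
  have root: "perturbed_root \<mu>" using r \<mu> by (simp add: perturbed_root_def)
  have kernel: "(\<lambda>x. resolvent_kernel C (of_real \<mu>) x a) = R (of_real \<mu>) (delta a)"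
    by (rule ext) (rule resolvent_kernel_eq[OF r])
  have root_iff: "resolvent_kernel C (of_real \<nu>) a a = of_real (1 / \<sigma>) \<longleftrightarrow> \<nu> = \<mu>" if "\<nu> \<in> I" for \<nu>
    unfolding resolvent_kernel_eq[OF I[OF that]] R_delta_eq_green[OF I[OF that]] of_real_eq_iff
    by (rule \<mu>(2)[OF that])
  have mult: "eig_mult (Schroedinger C \<sigma> a) (of_real \<mu>) = 1"
    using eigenvalue_H_regular_iff[OF r] eigenvalue_H_real_iff[OF r] root
    by (intro eig_mult_H_regular[OF r]) (simp add: perturbed_root_def)
  have not_compact: "\<not> compact (supp (R (of_real \<mu>) (delta a)))"
    unfolding compact_iff_finite[OF homogeneous_space] supp_eq[OF homogeneous_space] by (rule infinite_support_R_delta[OF r])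
  show ?thesis
    unfolding perturbed_eigenvalue_def kernel
    by (intro conjI ballI root_iff mult not_compact eigenfunction_at_root[OF root] \<mu>(1))
qed

lemma perturbed_eigenvalue_gap:
  "perturbed_eigenvalue C \<sigma> a {lam_seq C a (Suc (Suc k))<..<lam_seq C a (Suc k)} (gap_root k)"
proof (rule perturbed_eigenvalueI)
  show "gap_root k \<in> {lam_seq C a (Suc (Suc k))<..<lam_seq C a (Suc k)}" by (rule gap_root(1))
  fix \<nu> assume \<nu>: "\<nu> \<in> {lam_seq C a (Suc (Suc k))<..<lam_seq C a (Suc k)}"
  show "regular_real \<nu>" by (rule regular_in_gap[OF \<nu>])
  show "green \<nu> = 1 / \<sigma> \<longleftrightarrow> \<nu> = gap_root k"
    using gap_root_unique[OF \<nu>] gap_root(2)[of k] by blast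
qed

lemma perturbed_eigenvalue_negative:
  assumes "\<nu> < 0" "green \<nu> = 1 / \<sigma>"
  shows "perturbed_eigenvalue C \<sigma> a {..<0} \<nu>"
proof (rule perturbed_eigenvalueI)
  fix \<mu> :: real assume \<mu>: "\<mu> \<in> {..<0}"
  then show "regular_real \<mu>" by (intro regular_negative) simp
  show "green \<mu> = 1 / \<sigma> \<longleftrightarrow> \<mu> = \<nu>"
    using negative_root_at_most_one[of \<mu> "1 / \<sigma>" \<nu>] \<mu> assms by auto
qed (use assms in simp)

lemma perturbed_eigenvalue_above:
  assumes "\<sigma> < 0"
  shows "\<exists>p. perturbed_eigenvalue C \<sigma> a {lam_seq C a 1<..} p \<and>
    {\<mu>. lam_seq C a 1 < \<mu> \<and> green \<mu> = 1 / \<sigma>} = {p}"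
proof -
  have s: "1 / \<sigma> < 0" using assms by simp
  obtain p where P: "p \<in> {lam_seq C a (Suc 0)<..} \<and> green p = 1 / \<sigma>"
    and U: "\<forall>\<nu>. \<nu> \<in> {lam_seq C a (Suc 0)<..} \<and> green \<nu> = 1 / \<sigma> \<longrightarrow> \<nu> = p"
    using ex1_root_above[OF s] by (rule ex1E)
  have p: "lam_seq C a 1 < p" "green p = 1 / \<sigma>" using P by simp_all
  have u: "\<nu> = p" if "lam_seq C a 1 < \<nu>" "green \<nu> = 1 / \<sigma>" for \<nu>
    using U[rule_format, of \<nu>] that by simp
  have "perturbed_eigenvalue C \<sigma> a {lam_seq C a 1<..} p"
  proof (rule perturbed_eigenvalueI)
    fix \<nu> assume \<nu>: "\<nu> \<in> {lam_seq C a 1<..}"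
    then show "regular_real \<nu>" by (intro regular_above) simp
    show "green \<nu> = 1 / \<sigma> \<longleftrightarrow> \<nu> = p" using u[of \<nu>] \<nu> p by auto
  qed (use p in simp)
  moreover have "{\<mu>. lam_seq C a 1 < \<mu> \<and> green \<mu> = 1 / \<sigma>} = {p}"
  proof (intro set_eqI iffI)
    fix \<mu> assume "\<mu> \<in> {\<mu>. lam_seq C a 1 < \<mu> \<and> green \<mu> = 1 / \<sigma>}"
    then have "\<mu> = p" by (intro u) simp_all
    then show "\<mu> \<in> {p}" by simp
  qed (use p in simp)
  ultimately show ?thesis by blast
qed

end

section \<open>The spectrum of the perturbed operator\<close>

theorem theorem4p3:
  fixes C :: "'a::metric_space set \<Rightarrow> real" and a :: 'a and \<sigma> :: real
  assumes "homogeneous_ultrametric_measure_space TYPE('a)"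
    and "homogeneous_choice_function C"
    and "\<sigma> \<noteq> 0"
  defines "L \<equiv> Laplacian C"
    and "H \<equiv> Schroedinger C \<sigma> a"
    and "lk \<equiv> lam_seq C a"
  defines "Neg \<equiv> {\<mu>::real. \<mu> < 0 \<and> eigenvalue H (of_real \<mu>)}"
    and "Pos \<equiv> {\<mu>::real. \<mu> > 0 \<and> eigenvalue H (of_real \<mu>)}"
  shows
    "pure_point_spectrum H
     \<and> spectrum H = insert 0 (of_real ` (Neg \<union> Pos))
     \<and> (\<forall>\<mu>\<in>Neg. \<forall>\<nu>\<in>Neg. \<mu> = \<nu>)
     \<and> countable Pos \<and> infinite Pos \<and> {x. x islimpt Pos} = {0}
     \<and> ((\<exists>!\<mu>. \<mu> \<in> Neg) \<longleftrightarrow>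
          \<sigma> > 0 \<and> (recurrent C a \<or> (transient C a \<and> green0 C a > ennreal (1 / \<sigma>))))
     \<and> (\<forall>k\<ge>1. 0 < lk (Suc k) \<and> lk (Suc k) < lk k)
     \<and> (\<forall>k\<ge>1.
          eigenvalue L (of_real (lk k))
          \<and> eigenvalue H (of_real (lk k))
          \<and> eig_mult H (of_real (lk k)) = \<infinity>
          \<and> {f. eigenfunction H (of_real (lk k)) f}
              = {f. eigenfunction L (of_real (lk k)) f \<and> a \<notin> supp f}
          \<and> (\<exists>E. orthonormal_basis_of E (eigenspace H (of_real (lk k)))
                 \<and> (\<forall>e\<in>E. compact (supp e))))
     \<and> (\<exists>ls :: nat \<Rightarrow> real.
          (\<forall>k\<ge>1. perturbed_eigenvalue C \<sigma> a {lk (Suc k)<..<lk k} (ls k))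
          \<and> ((\<exists>!\<mu>. \<mu> \<in> Neg) \<longrightarrow>
               (\<exists>lneg. perturbed_eigenvalue C \<sigma> a {..<0} lneg
                  \<and> spectrum H = of_real ` ({lneg, 0} \<union> lk ` {1..} \<union> ls ` {1..})))
          \<and> (\<sigma> > 0 \<and> \<not> (\<exists>!\<mu>. \<mu> \<in> Neg) \<longrightarrow>
               spectrum H = of_real ` ({0} \<union> lk ` {1..} \<union> ls ` {1..}))
          \<and> (\<sigma> < 0 \<longrightarrow>
               (\<exists>lpos. perturbed_eigenvalue C \<sigma> a {lk 1<..} lpos
                  \<and> spectrum H = of_real ` ({0, lpos} \<union> lk ` {1..} \<union> ls ` {1..}))))"
proof -
  interpret S: hierarchical_schroedinger C a \<sigma>
    by unfold_locales (fact assms(1), fact assms(2), fact assms(3))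
  have from_1: "f ` {1..} = range (\<lambda>k. f (Suc k))" for f :: "nat \<Rightarrow> real"
  proof -
    have "{1..} = range Suc" by (auto simp: image_iff Suc_le_eq gr0_conv_Suc)
    then show ?thesis by (simp add: image_image)
  qed
  have Neg: "Neg = {\<mu>. \<mu> < 0 \<and> S.green \<mu> = 1 / \<sigma>}"
    unfolding Neg_def H_def by (rule S.negative_eigenvalues)
  have Pos: "Pos = range (\<lambda>k. lk (Suc k)) \<union> range S.gap_root \<union>
      {\<mu>. lk 1 < \<mu> \<and> S.green \<mu> = 1 / \<sigma>}"
    unfolding Pos_def H_def S.positive_eigenvalues by (simp add: lk_def)
  have spec: "spectrum H = insert 0 (of_real ` (Neg \<union> Pos))"
  proof -
    have "insert 0 (Neg \<union> Pos) = insert 0 {\<mu>. eigenvalue H (of_real \<mu>)}"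
      by (auto simp: Neg_def Pos_def)
    then have "of_real ` insert 0 (Neg \<union> Pos) = (of_real ` insert 0 {\<mu>. eigenvalue H (of_real \<mu>)} :: complex set)"
      by (rule arg_cong)
    then show ?thesis using S.spectrum_H by (simp add: H_def)
  qed
  have Neg_unique: "\<mu> = \<nu>" if "\<mu> \<in> Neg" "\<nu> \<in> Neg" for \<mu> \<nu>
    using that S.negative_root_at_most_one[of \<mu> "1 / \<sigma>" \<nu>] by (simp add: Neg)
  have Neg_ex1: "(\<exists>!\<mu>. \<mu> \<in> Neg) \<longleftrightarrow> (\<exists>\<mu>. \<mu> \<in> Neg)"
    using Neg_unique by (intro iffI ex_ex1I) (rule ex1_implies_ex)
  have Neg_iff: "(\<exists>\<mu>. \<mu> \<in> Neg) \<longleftrightarrow> 0 < \<sigma> \<and> ennreal (1 / \<sigma>) < green0 C a"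
    using S.negative_eigenvalue_iff unfolding Neg S.green0_eq by simp
  have transience: "recurrent C a \<or> (transient C a \<and> green0 C a > ennreal (1 / \<sigma>)) \<longleftrightarrow>
      green0 C a > ennreal (1 / \<sigma>)"
  proof (cases "transient C a")
    case False
    then have "green0 C a = \<infinity>" by (metis infinity_ennreal_def less_top transient_def)
    then show ?thesis using False by (simp add: recurrent_def)
  qed (simp add: recurrent_def)
  have lk_dec: "0 < lk (Suc k) \<and> lk (Suc k) < lk k" if "1 \<le> k" for k
  proof -
    obtain j where "k = Suc j" using \<open>1 \<le> k\<close> by (cases k) auto
    then show ?thesis using S.ev_pos[of k] S.ev_Suc_less[of j] by (simp add: lk_def)
  qed
  have above_empty: "{\<mu>. lk 1 < \<mu> \<and> S.green \<mu> = 1 / \<sigma>} = {}" if "0 < \<sigma>"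
  proof -
    have "S.green \<mu> < 1 / \<sigma>" if "lk 1 < \<mu>" for \<mu>
    proof -
      have "S.green \<mu> < 0" by (rule S.green_above(3)) (use that in \<open>simp add: lk_def\<close>)
      then show ?thesis using \<open>0 < \<sigma>\<close> by (meson less_trans zero_less_divide_1_iff)
    qed
    then show ?thesis by (auto simp: less_le)
  qed
  have countable_above: "countable {\<mu>. lk 1 < \<mu> \<and> S.green \<mu> = 1 / \<sigma>}"
    using S.roots_above_finite[of "1 / \<sigma>"] by (intro countable_finite) (simp add: lk_def)
  \<comment> \<open>The gaps and their roots are indexed from 0.\<close>
  define ls where "ls k = S.gap_root (k - 1)" for k
  have ls_image: "ls ` {1..} = range S.gap_root" unfolding from_1 by (simp add: ls_def)
  show ?thesis
  proof (intro conjI)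
    show "pure_point_spectrum H"
      unfolding H_def by (rule S.pure_point_spectrum_H[OF homogeneous_space_countable[OF assms(1)]])
    show "spectrum H = insert 0 (of_real ` (Neg \<union> Pos))" by (rule spec)
    show "\<forall>\<mu>\<in>Neg. \<forall>\<nu>\<in>Neg. \<mu> = \<nu>" using Neg_unique by (intro ballI)
    show "countable Pos" unfolding Pos by (intro countable_Un countable_above) simp_all
    have "inj (\<lambda>k. lk (Suc k))" using S.ev_eq_iff by (intro injI) (simp add: lk_def)
    then have "infinite (range (\<lambda>k. lk (Suc k)))" by (rule range_inj_infinite)
    then show "infinite Pos" unfolding Pos by simp
    show "{x. x islimpt Pos} = {0}"
      unfolding Pos_def H_def by (rule S.islimpt_positive_eigenvalues)
    show "(\<exists>!\<mu>. \<mu> \<in> Neg) \<longleftrightarrow>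
        \<sigma> > 0 \<and> (recurrent C a \<or> (transient C a \<and> green0 C a > ennreal (1 / \<sigma>)))"
      unfolding Neg_ex1 Neg_iff transience ..
    show "\<forall>k\<ge>1. 0 < lk (Suc k) \<and> lk (Suc k) < lk k" using lk_dec by (intro allI impI)
    show "\<forall>k\<ge>1.
          eigenvalue L (of_real (lk k))
          \<and> eigenvalue H (of_real (lk k))
          \<and> eig_mult H (of_real (lk k)) = \<infinity>
          \<and> {f. eigenfunction H (of_real (lk k)) f}
              = {f. eigenfunction L (of_real (lk k)) f \<and> a \<notin> supp f}
          \<and> (\<exists>E. orthonormal_basis_of E (eigenspace H (of_real (lk k)))
                 \<and> (\<forall>e\<in>E. compact (supp e)))"
    proof (intro allI impI)
      fix k :: nat assume "1 \<le> k"
      then obtain j where k: "k = Suc j" by (cases k) auto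
      show "eigenvalue L (of_real (lk k))
          \<and> eigenvalue H (of_real (lk k))
          \<and> eig_mult H (of_real (lk k)) = \<infinity>
          \<and> {f. eigenfunction H (of_real (lk k)) f}
              = {f. eigenfunction L (of_real (lk k)) f \<and> a \<notin> supp f}
          \<and> (\<exists>E. orthonormal_basis_of E (eigenspace H (of_real (lk k)))
                 \<and> (\<forall>e\<in>E. compact (supp e)))"
        unfolding k lk_def H_def L_def compact_iff_finite[OF assms(1)] supp_eq[OF assms(1)]
      proof (intro conjI)
        show "{f. eigenfunction (Schroedinger C \<sigma> a) (of_real (lam_seq C a (Suc j))) f} =
            {f. eigenfunction (Laplacian C) (of_real (lam_seq C a (Suc j))) f \<and> a \<notin> {x. f x \<noteq> 0}}"
          unfolding S.eigenfunctions_H_ev by simp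
      qed (rule S.eigenvalue_ev S.eig_mult_H_ev S.eigenspace_ev_basis[OF homogeneous_space_countable[OF assms(1)]])+
    qed
    show "\<exists>ls :: nat \<Rightarrow> real.
          (\<forall>k\<ge>1. perturbed_eigenvalue C \<sigma> a {lk (Suc k)<..<lk k} (ls k))
          \<and> ((\<exists>!\<mu>. \<mu> \<in> Neg) \<longrightarrow>
               (\<exists>lneg. perturbed_eigenvalue C \<sigma> a {..<0} lneg
                  \<and> spectrum H = of_real ` ({lneg, 0} \<union> lk ` {1..} \<union> ls ` {1..})))
          \<and> (\<sigma> > 0 \<and> \<not> (\<exists>!\<mu>. \<mu> \<in> Neg) \<longrightarrow>
               spectrum H = of_real ` ({0} \<union> lk ` {1..} \<union> ls ` {1..}))
          \<and> (\<sigma> < 0 \<longrightarrow>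
               (\<exists>lpos. perturbed_eigenvalue C \<sigma> a {lk 1<..} lpos
                  \<and> spectrum H = of_real ` ({0, lpos} \<union> lk ` {1..} \<union> ls ` {1..})))"
    proof (intro exI[of _ ls] conjI allI impI)
      fix k :: nat assume "1 \<le> k"
      then obtain j where k: "k = Suc j" by (cases k) auto
      show "perturbed_eigenvalue C \<sigma> a {lk (Suc k)<..<lk k} (ls k)"
        using S.perturbed_eigenvalue_gap[of j] by (simp add: k lk_def ls_def)
    next
      assume "\<exists>!\<mu>. \<mu> \<in> Neg"
      then obtain \<nu> where \<nu>: "\<nu> \<in> Neg" unfolding Neg_ex1 by (rule exE)
      have "0 < \<sigma>" using Neg_iff \<nu> by blast
      have N: "Neg = {\<nu>}" using \<nu> Neg_unique by blast
      have "perturbed_eigenvalue C \<sigma> a {..<0} \<nu>"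
        using \<nu> S.perturbed_eigenvalue_negative by (simp add: Neg)
      moreover have "spectrum H = of_real ` ({\<nu>, 0} \<union> lk ` {1..} \<union> ls ` {1..})"
        unfolding spec N Pos above_empty[OF \<open>0 < \<sigma>\<close>] ls_image from_1[of lk] by auto
      ultimately show "\<exists>lneg. perturbed_eigenvalue C \<sigma> a {..<0} lneg
                  \<and> spectrum H = of_real ` ({lneg, 0} \<union> lk ` {1..} \<union> ls ` {1..})"
        by (intro exI conjI)
    next
      assume \<sigma>: "\<sigma> > 0 \<and> \<not> (\<exists>!\<mu>. \<mu> \<in> Neg)"
      then have N: "Neg = {}" unfolding Neg_ex1 by blast
      show "spectrum H = of_real ` ({0} \<union> lk ` {1..} \<union> ls ` {1..})"
        unfolding spec N Pos above_empty[OF conjunct1[OF \<sigma>]] ls_image from_1[of lk] by auto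
    next
      assume \<sigma>: "\<sigma> < 0"
      then have N: "Neg = {}" using Neg_iff by auto
      obtain p where p: "perturbed_eigenvalue C \<sigma> a {lk 1<..} p"
        and above: "{\<mu>. lk 1 < \<mu> \<and> S.green \<mu> = 1 / \<sigma>} = {p}"
        using S.perturbed_eigenvalue_above[OF \<sigma>] unfolding lk_def by blast
      have "spectrum H = of_real ` ({0, p} \<union> lk ` {1..} \<union> ls ` {1..})"
        unfolding spec N Pos above ls_image from_1[of lk] by auto
      with p show "\<exists>lpos. perturbed_eigenvalue C \<sigma> a {lk 1<..} lpos
                  \<and> spectrum H = of_real ` ({0, lpos} \<union> lk ` {1..} \<union> ls ` {1..})"
        by (intro exI conjI)
    qed
  qed
qed

end
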